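(* Assume that the real random variable $X$ satisfies one of the following three conditions: (1) $X\sim N(0,1)$; (2) $X\sim \Gamma(r,1)$ with $r\geq 1$; (3) $X\sim \beta(a,b)$ with $a,b\geq 1$. Let $X_1,X_2,\ldots$ be independent copies of $X$. Fix an integer $d\geq 1$ and, for each $n\geq 1$, let $m_n$ be a positive integer and let $Q_n\in \mathbb{R}[x_1,\ldots,x_{m_n}]$ be a multilinear polynomial of degree at most $d$; assume further that $m_n\to\infty$ as $n\to\infty$. Finally, suppose that $F_n$ has the form \[ F_n = Q_n(X_1,\ldots,X_{m_n}),\quad n\geq 1, \] and that $F_n$ converges in law as $n\to\infty$ to a non-constant random variable $F_\infty$. Then the law of $F_\infty$ is absolutely continuous with respect to the Lebesgue measure on $\mathbb{R}$, and $F_n$ converges to $F_\infty$ in total variation, that is, $d_{TV}(F_n,F_\infty)\to 0$ as $n\to\infty$.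
   Context: A multilinear polynomial of degree at most $d$ in $m$ variables is a polynomial $Q\in\mathbb{R}[x_1,\ldots,x_m]$ of the form \[ Q(x_1,\ldots,x_m)=\sum_{S\subset\{1,\ldots,m\},\ |S|\leq d} a_S\prod_{i\in S}x_i, \] for some real coefficients $a_S$, with the convention $\prod_{i\in\emptyset}x_i=1$. The law $\Gamma(r,1)$ is the probability measure on $\mathbb{R}$ with density $t\mapsto t^{r-1}e^{-t}/\Gamma(r)$ on $t\geq 0$ (and $0$ for $t<0$), where in this formula $\Gamma(r)$ is the Euler Gamma function. The law $\beta(a,b)$ is the probability measure on $\mathbb{R}$ with density $t\mapsto t^{a-1}(1-t)^{b-1}\big/\int_0^1u^{a-1}(1-u)^{b-1}\,du$ for $t\in[0,1]$ and $0$ otherwise. The total variation distance between (the laws of) real random variables $F$ and $G$ is \[ d_{TV}(F,G)=\sup_{A\in\mathcal{B}(\mathbb{R})}\big|P(F\in A)-P(G\in A)\big|, \] where $\mathcal{B}(\mathbb{R})$ is the Borel $\sigma$-algebra of $\mathbb{R}$. Convergence in law is the usual convergence in distribution. Non-constant means that the law of $F_\infty$ is not a Dirac mass. *)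

theory Defs
  imports "HOL-Probability.Probability"
begin

text \<open>
  A real polynomial in $x_1, \ldots, x_m$ is represented by its polynomial function on sequences
  $x$, of which only the entries $x_1, \ldots, x_m$ matter; over the reals polynomials and
  polynomial functions are the same thing.
\<close>

definition multilinear_poly :: "nat \<Rightarrow> nat \<Rightarrow> ((nat \<Rightarrow> real) \<Rightarrow> real) \<Rightarrow> bool" where
  "multilinear_poly d m Q \<longleftrightarrow>
     (\<exists>a :: nat set \<Rightarrow> real. \<forall>x. Q x = (\<Sum>S | S \<subseteq> {1..m} \<and> card S \<le> d. a S * (\<Prod>i\<in>S. x i)))"

text \<open>
  Both densities below use \<open>powr\<close>, for which \<open>0 powr 0 = 0\<close>. They can therefore differ from the
  usual formula at an endpoint of the support, which does not affect the law.
\<close>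

definition gamma_density :: "real \<Rightarrow> real \<Rightarrow> real" where
  "gamma_density r t = (if t < 0 then 0 else t powr (r - 1) * exp (- t) / Gamma r)"

definition beta_density :: "real \<Rightarrow> real \<Rightarrow> real \<Rightarrow> real" where
  "beta_density a b t =
     (if t \<in> {0..1}
      then t powr (a - 1) * (1 - t) powr (b - 1)
             / integral {0..1} (\<lambda>u. u powr (a - 1) * (1 - u) powr (b - 1))
      else 0)"

lemma borel_measurable_gamma_density [measurable]: "gamma_density r \<in> borel_measurable borel"
  unfolding gamma_density_def [abs_def] by measurable

lemma borel_measurable_beta_density [measurable]: "beta_density a b \<in> borel_measurable borel"
  unfolding beta_density_def [abs_def] by measurable

lemma beta_density_eq_Beta:
  assumes "a > 0" "b > 0" "t \<in> {0..1}"
  shows "beta_density a b t = t powr (a - 1) * (1 - t) powr (b - 1) / Beta a b"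
  using assms has_integral_Beta_real[of a b] by (simp add: beta_density_def integral_unique)

definition tv_dist :: "real measure \<Rightarrow> real measure \<Rightarrow> real" where
  "tv_dist \<mu> \<nu> = (SUP A\<in>sets borel. \<bar>measure \<mu> A - measure \<nu> A\<bar>)"

end

theory Submission
  imports Defs
begin

text \<open>
  Weak convergence becomes convergence in total variation as soon as the laws $\mu_n$ are smooth in
  the following uniform sense (\<open>almost_smooth\<close>): for every $\eta > 0$ there is a $K$ such that, for
  all large $n$,
  $|\int f\,d\mu_n| \leq K \sup|\varphi| + \eta$ whenever $f = \varphi'$ is continuous and
  $|f| \leq 1$. Indeed, applied to $f_\delta - f$, where $f_\delta(y)$ is the mean of $f$ over
  $[y, y + \delta]$, this says that averaging $\mu_n$ over a window of length $\delta$ changes it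
  little, uniformly in $n$. The averaged laws have the densities
  $(G_n(x) - G_n(x - \delta)) / \delta$, with $G_n$ the distribution function, and these converge
  almost everywhere, hence in $L^1$ by Scheffe's lemma. This is the lemma
  \<open>weak_convergence_in_total_variation\<close>, which knows nothing about polynomials.

  Smoothness comes from integration by parts. All three laws have densities $p$ for which
  $\int g' w p = - \int g \tau p$ with a bounded weight $w$ that is positive almost surely and a
  square integrable $\tau$ (locale \<open>ibp_law\<close>). Let $F$ be a multilinear polynomial of
  variance 1 in independent variables $X_i$, put $B_i = \partial_i F$ and
  $\Gamma = \sum_i w(X_i) B_i^2$. Integration by parts against
  $\varphi(F) B_i / (\Gamma + e)$, summed over $i$, gives
  $|E f(F) \Gamma / (\Gamma + e)| \leq (K_d / e) \sup|\varphi|$ with $K_d$ independent of the number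
  of variables (\<open>weighted_test_bound\<close>). Multilinearity matters twice here: $B_i$ does not
  depend on $X_i$, and all error terms are controlled by second moments of $F$, its gradient and its
  Hessian, which orthogonality of the centred monomials bounds by the variance.

  Replacing the factor $\Gamma / (\Gamma + e)$ by 1 costs little if $\Gamma$ is rarely small. As
  the $B_i$ have degree $d - 1$, this follows by induction on $d$ from a small ball estimate for each
  single $B_i$: a weighted average of the normalised terms $w(X_i) B_i^2 / E B_i^2$ can only be small
  if terms carrying half of the total weight are small (\<open>wgrad2_small_ball\<close>).
  Conversely, a smooth law charges no small ball, which closes the induction
  (\<open>small_balls_of_smooth_laws\<close>).

  Finally, smoothness at variance 1 rescales to all polynomials whose variance is bounded below, and
  a non-constant weak limit forces such a lower bound, because the variance of $\arctan F_n$ is at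
  most that of $F_n$ and converges to a positive number.
\<close>

section \<open>Multilinear polynomials in centred variables\<close>

text \<open>
  A polynomial is handled through its coefficients in the monomials $\prod_{i \in S} (x_i - c)$. With
  $c$ the mean of the variables these monomials are orthogonal, so second moments can be read off the
  coefficients.
\<close>

definition mlin :: "real \<Rightarrow> nat set \<Rightarrow> (nat set \<Rightarrow> real) \<Rightarrow> (nat \<Rightarrow> real) \<Rightarrow> real" where
  "mlin c I b x = (\<Sum>S\<in>Pow I. b S * (\<Prod>i\<in>S. x i - c))"

text \<open>
  The coefficients of the partial derivative in the $i$-th variable.
\<close>

definition der :: "nat \<Rightarrow> (nat set \<Rightarrow> real) \<Rightarrow> nat set \<Rightarrow> real" where
  "der i b S = (if i \<in> S then 0 else b (insert i S))"

definition deg_le :: "nat \<Rightarrow> (nat set \<Rightarrow> real) \<Rightarrow> bool" where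
  "deg_le d b \<longleftrightarrow> (\<forall>S. d < card S \<longrightarrow> b S = 0)"

lemma deg_le_der:
  assumes "deg_le (Suc d) b"
  shows "deg_le d (der i b)"
  unfolding deg_le_def der_def
proof (intro allI impI)
  fix S :: "nat set" assume S: "d < card S"
  then have "finite S" by (metis card.infinite not_less_zero)
  then show "(if i \<in> S then 0 else b (insert i S)) = 0"
    using assms S by (auto simp: deg_le_def)
qed

lemma mlin_cong: "(\<And>i. i \<in> I \<Longrightarrow> x i = y i) \<Longrightarrow> mlin c I b x = mlin c I b y"
  unfolding mlin_def by (intro sum.cong refl arg_cong2[where f="(*)"] prod.cong) auto

lemma finite_insertE:
  assumes "i \<in> I" "finite I"
  obtains J where "I = insert i J" "i \<notin> J" "finite J"
  using assms by (metis finite_insert mk_disjoint_insert)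

lemma sum_Pow_insert:
  assumes "finite J" "i \<notin> J"
  shows "(\<Sum>S\<in>Pow (insert i J). h S) = (\<Sum>S\<in>Pow J. h S) + (\<Sum>S\<in>Pow J. h (insert i S) :: 'c :: comm_monoid_add)"
proof -
  have inj: "inj_on (insert i) (Pow J)"
    using assms(2) by (intro inj_onI) (metis Diff_insert_absorb PowD in_mono)
  have "(\<Sum>S\<in>Pow (insert i J). h S) = (\<Sum>S\<in>Pow J \<union> insert i ` Pow J. h S)"
    by (simp add: Pow_insert)
  also have "\<dots> = (\<Sum>S\<in>Pow J. h S) + (\<Sum>S\<in>insert i ` Pow J. h S)"
    using assms by (intro sum.union_disjoint) auto
  also have "(\<Sum>S\<in>insert i ` Pow J. h S) = (\<Sum>S\<in>Pow J. h (insert i S))"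
    using inj by (simp add: sum.reindex)
  finally show ?thesis .
qed

lemma mlin_insert:
  assumes "finite J" "i \<notin> J"
  shows "mlin c (insert i J) b x = mlin c J b x + (x i - c) * mlin c J (\<lambda>S. b (insert i S)) x"
proof -
  have "(\<Sum>S\<in>Pow J. b (insert i S) * (\<Prod>k\<in>insert i S. x k - c))
      = (x i - c) * mlin c J (\<lambda>S. b (insert i S)) x"
    unfolding mlin_def sum_distrib_left
  proof (intro sum.cong refl)
    fix S assume "S \<in> Pow J"
    then have "finite S" "i \<notin> S" using assms finite_subset by auto
    then show "b (insert i S) * (\<Prod>k\<in>insert i S. x k - c) = (x i - c) * (b (insert i S) * (\<Prod>k\<in>S. x k - c))"
      by simp
  qed
  then show ?thesis unfolding mlin_def[of c "insert i J"] sum_Pow_insert[OF assms]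
    by (simp add: mlin_def)
qed

lemma mlin_der_insert:
  assumes "finite J" "i \<notin> J"
  shows "mlin c (insert i J) (der i b) x = mlin c J (\<lambda>S. b (insert i S)) x"
proof -
  have "mlin c J (der i b) x = mlin c J (\<lambda>S. b (insert i S)) x"
    unfolding mlin_def using assms by (intro sum.cong) (auto simp: der_def)
  moreover have "mlin c J (\<lambda>S. der i b (insert i S)) x = 0"
    by (simp add: mlin_def der_def)
  ultimately show ?thesis by (simp add: mlin_insert[OF assms])
qed

lemma mlin_upd:
  assumes "finite I" "i \<in> I"
  shows "mlin c I b (x(i := t)) = mlin c I b x + (t - x i) * mlin c I (der i b) x"
proof -
  obtain J where J: "I = insert i J" "i \<notin> J" "finite J"
    using assms(2,1) by (rule finite_insertE)
  have [simp]: "mlin c J b' (x(i := t)) = mlin c J b' x" for b'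
    using J by (intro mlin_cong) auto
  have "mlin c I b x = mlin c J b x + (x i - c) * mlin c J (\<lambda>S. b (insert i S)) x"
    "mlin c I b (x(i := t)) = mlin c J b x + (t - c) * mlin c J (\<lambda>S. b (insert i S)) x"
    using mlin_insert[OF J(3,2), of c b x] mlin_insert[OF J(3,2), of c b "x(i := t)"] J(1) by simp_all
  moreover have "mlin c I (der i b) x = mlin c J (\<lambda>S. b (insert i S)) x"
    using mlin_der_insert[OF J(3,2), of c b x] J(1) by simp
  ultimately show ?thesis by (simp add: algebra_simps)
qed

lemma der_der_same: "der i (der i b) = (\<lambda>_. 0)"
  by (auto simp: der_def fun_eq_iff)

lemma mlin_der_der_same: "mlin c I (der i (der i b)) x = 0"
  by (simp add: mlin_def der_der_same)

lemma mlin_der_upd: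
  assumes "finite I" "i \<in> I"
  shows "mlin c I (der i b) (x(i := t)) = mlin c I (der i b) x"
  using mlin_upd[OF assms, of c "der i b"] by (simp add: mlin_der_der_same)

text \<open>
  The pairs of a variable $i$ and a set $S$ not containing it correspond to the pairs of a set $U$ and
  an element $i \in U$, by $U = S \cup \{i\}$. This turns sums over all coefficients of all partial
  derivatives into sums over the coefficients of the polynomial itself.
\<close>

lemma sum_der_reindex:
  fixes h :: "nat \<Rightarrow> nat set \<Rightarrow> real"
  assumes I: "finite I"
  shows "(\<Sum>i\<in>I. \<Sum>S\<in>Pow I. if i \<in> S then 0 else h i (insert i S)) = (\<Sum>U\<in>Pow I. \<Sum>i\<in>U. h i U)"
proof -
  have "(\<Sum>S\<in>Pow I. if i \<in> S then 0 else h i (insert i S)) = (\<Sum>U\<in>Pow I. if i \<in> U then h i U else 0)"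
    if "i \<in> I" for i
  proof -
    obtain J where J: "I = insert i J" "i \<notin> J" "finite J"
      using \<open>i \<in> I\<close> I by (rule finite_insertE)
    have *: "(\<Sum>S\<in>Pow J. if i \<in> S then 0 else h i (insert i S)) = (\<Sum>S\<in>Pow J. h i (insert i S))"
      "(\<Sum>S\<in>Pow J. if i \<in> S then h i S else 0) = 0"
      subgoal using J by (intro sum.cong) auto
      subgoal using J by (intro sum.neutral) auto
      done
    show ?thesis unfolding J(1) sum_Pow_insert[OF J(3,2)] using * by simp
  qed
  then have "(\<Sum>i\<in>I. \<Sum>S\<in>Pow I. if i \<in> S then 0 else h i (insert i S))
      = (\<Sum>i\<in>I. \<Sum>U\<in>Pow I. if i \<in> U then h i U else 0)"
    by (rule sum.cong[OF refl])
  also have "\<dots> = (\<Sum>U\<in>Pow I. \<Sum>i\<in>I. if i \<in> U then h i U else 0)"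
    by (rule sum.swap)
  also have "\<dots> = (\<Sum>U\<in>Pow I. \<Sum>i\<in>U. h i U)"
  proof (rule sum.cong[OF refl])
    fix U assume "U \<in> Pow I"
    then have "I \<inter> U = U" by auto
    then show "(\<Sum>i\<in>I. if i \<in> U then h i U else 0) = (\<Sum>i\<in>U. h i U)"
      using sum.inter_restrict[OF I, of "\<lambda>i. h i U" U] by simp
  qed
  finally show ?thesis .
qed

text \<open>
  Recentring: expand each $x_i = (x_i - c) + c$ in every monomial. The degree does not grow because
  the new monomials are indexed by subsets of the old ones.
\<close>

lemma multilinear_poly_imp_mlin:
  assumes "multilinear_poly d m Q"
  obtains b where "deg_le d b" "\<And>x. Q x = mlin c {1..m} b x"
proof -
  from assms obtain a where a: "\<And>x. Q x = (\<Sum>S | S \<subseteq> {1..m} \<and> card S \<le> d. a S * (\<Prod>i\<in>S. x i))"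
    by (auto simp: multilinear_poly_def)
  define I where "I = {1..m}"
  define a' where "a' S = (if card S \<le> d then a S else 0)" for S
  define b where "b T = (\<Sum>S\<in>{S\<in>Pow I. T \<subseteq> S}. a' S * (\<Prod>i\<in>S - T. c))" for T
  have fin: "finite I" by (simp add: I_def)
  have Q: "Q x = mlin c I b x" for x
  proof -
    have "Q x = (\<Sum>S\<in>Pow I. a' S * (\<Prod>i\<in>S. x i))"
    proof -
      have "(\<Sum>S\<in>{S\<in>Pow I. card S \<le> d}. a S * (\<Prod>i\<in>S. x i)) = (\<Sum>S\<in>Pow I. if card S \<le> d then a S * (\<Prod>i\<in>S. x i) else 0)"
        using fin by (intro sum.inter_filter) auto
      also have "\<dots> = (\<Sum>S\<in>Pow I. a' S * (\<Prod>i\<in>S. x i))"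
        by (intro sum.cong) (auto simp: a'_def)
      finally show ?thesis by (simp add: a I_def Pow_def)
    qed
    also have "\<dots> = (\<Sum>S\<in>Pow I. \<Sum>T\<in>Pow S. a' S * ((\<Prod>i\<in>T. x i - c) * (\<Prod>i\<in>S - T. c)))"
    proof (intro sum.cong refl)
      fix S assume "S \<in> Pow I"
      then have "finite S" using fin finite_subset by auto
      from prod_add[OF this, of "\<lambda>i. x i - c" "\<lambda>_. c"]
      show "a' S * (\<Prod>i\<in>S. x i) = (\<Sum>T\<in>Pow S. a' S * ((\<Prod>i\<in>T. x i - c) * (\<Prod>i\<in>S - T. c)))"
        by (simp add: sum_distrib_left)
    qed
    also have "\<dots> = (\<Sum>S\<in>Pow I. \<Sum>T\<in>{T\<in>Pow I. T \<subseteq> S}. a' S * ((\<Prod>i\<in>T. x i - c) * (\<Prod>i\<in>S - T. c)))"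
      by (intro sum.cong refl) auto
    also have "\<dots> = (\<Sum>T\<in>Pow I. \<Sum>S\<in>{S\<in>Pow I. T \<subseteq> S}. a' S * ((\<Prod>i\<in>T. x i - c) * (\<Prod>i\<in>S - T. c)))"
      using fin by (intro sum.swap_restrict) auto
    also have "\<dots> = mlin c I b x"
      unfolding mlin_def b_def sum_distrib_right by (intro sum.cong refl) (simp add: mult_ac)
    finally show ?thesis .
  qed
  have "deg_le d b"
    unfolding deg_le_def b_def
  proof (intro allI impI sum.neutral ballI)
    fix T S assume "d < card T" "S \<in> {S \<in> Pow I. T \<subseteq> S}"
    moreover then have "card T \<le> card S" using fin by (intro card_mono) (auto intro: finite_subset)
    ultimately show "a' S * (\<Prod>i\<in>S - T. c) = 0" by (simp add: a'_def)
  qed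
  with Q that show thesis by (simp add: I_def)
qed

section \<open>Laws with an integration by parts formula\<close>

lemma integrable_mult_of_squares:
  fixes f g :: "'a \<Rightarrow> real"
  assumes [measurable]: "f \<in> borel_measurable M" "g \<in> borel_measurable M"
    and f: "integrable M (\<lambda>x. (f x)\<^sup>2)" and g: "integrable M (\<lambda>x. (g x)\<^sup>2)"
  shows "integrable M (\<lambda>x. f x * g x)"
proof (rule Bochner_Integration.integrable_bound[OF Bochner_Integration.integrable_add[OF f g]])
  show "AE x in M. norm (f x * g x) \<le> norm ((f x)\<^sup>2 + (g x)\<^sup>2)"
  proof (rule AE_I2)
    fix x
    have "2 * \<bar>f x * g x\<bar> \<le> (f x)\<^sup>2 + (g x)\<^sup>2"
      using sum_squares_bound[of "\<bar>f x\<bar>" "\<bar>g x\<bar>"] by (simp add: abs_mult)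
    then show "norm (f x * g x) \<le> norm ((f x)\<^sup>2 + (g x)\<^sup>2)" by simp
  qed
qed simp

lemma abs_arctan_le_2: "\<bar>arctan x\<bar> \<le> 2"
  using arctan_bounded[of x] pi_less_4 by (auto simp: abs_le_iff)

text \<open>
  With $\eta = 0$ this says that the law has a density whose derivative is a measure of total mass at
  most $K$. Laws for which every $\eta > 0$ admits a $K$ have a density, but no derivative of it need
  exist; the quantitative form is what survives uniformly along a sequence.
\<close>

definition almost_smooth :: "real \<Rightarrow> real \<Rightarrow> real measure \<Rightarrow> bool" where
  "almost_smooth K \<eta> \<rho> \<longleftrightarrow> (\<forall>\<phi> f C.
     (\<forall>y. (\<phi> has_real_derivative f y) (at y)) \<longrightarrow> continuous_on UNIV f \<longrightarrow>
     (\<forall>y. \<bar>\<phi> y\<bar> \<le> C) \<longrightarrow> (\<forall>y. \<bar>f y\<bar> \<le> 1) \<longrightarrow> \<bar>\<integral>x. f x \<partial>\<rho>\<bar> \<le> K * C + \<eta>)"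

lemma sum_square_le_card:
  fixes f :: "'j \<Rightarrow> real"
  assumes "finite A"
  shows "(\<Sum>i\<in>A. f i)\<^sup>2 \<le> real (card A) * (\<Sum>i\<in>A. (f i)\<^sup>2)"
proof (cases "A = {}")
  case False
  have "(\<Sum>i\<in>A. f i * 1)\<^sup>2 \<le> (\<Sum>i\<in>A. (f i)\<^sup>2) * (\<Sum>i\<in>A. 1\<^sup>2)"
    by (rule Cauchy_Schwarz_ineq_sum)
  then show ?thesis by (simp add: mult.commute)
qed simp

lemma orthogonal_expansion:
  assumes "finite A" and int: "\<And>U V. U \<in> A \<Longrightarrow> V \<in> A \<Longrightarrow> integrable N (\<lambda>x. e U x * e V x :: real)"
    and orth: "\<And>U V. U \<in> A \<Longrightarrow> V \<in> A \<Longrightarrow> U \<noteq> V \<Longrightarrow> (\<integral>x. e U x * e V x \<partial>N) = 0"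
  shows "integrable N (\<lambda>x. (\<Sum>U\<in>A. e U x)\<^sup>2)"
    and "(\<integral>x. (\<Sum>U\<in>A. e U x)\<^sup>2 \<partial>N) = (\<Sum>U\<in>A. \<integral>x. (e U x)\<^sup>2 \<partial>N)"
proof -
  have sq: "(\<Sum>U\<in>A. e U x)\<^sup>2 = (\<Sum>U\<in>A. \<Sum>V\<in>A. e U x * e V x)" for x
    by (simp add: power2_eq_square sum_product)
  show "integrable N (\<lambda>x. (\<Sum>U\<in>A. e U x)\<^sup>2)"
    unfolding sq using int by auto
  have "(\<integral>x. (\<Sum>U\<in>A. e U x)\<^sup>2 \<partial>N) = (\<Sum>U\<in>A. \<Sum>V\<in>A. \<integral>x. e U x * e V x \<partial>N)"
    unfolding sq using int by (subst Bochner_Integration.integral_sum; auto intro!: sum.cong Bochner_Integration.integral_sum)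
  also have "\<dots> = (\<Sum>U\<in>A. \<integral>x. e U x * e U x \<partial>N)"
  proof (intro sum.cong refl)
    fix U assume "U \<in> A"
    then have "(\<Sum>V\<in>A. \<integral>x. e U x * e V x \<partial>N) = (\<Sum>V\<in>A. if V = U then \<integral>x. e U x * e U x \<partial>N else 0)"
      using orth by (intro sum.cong) auto
    then show "(\<Sum>V\<in>A. \<integral>x. e U x * e V x \<partial>N) = (\<integral>x. e U x * e U x \<partial>N)"
      using \<open>finite A\<close> \<open>U \<in> A\<close> by simp
  qed
  finally show "(\<integral>x. (\<Sum>U\<in>A. e U x)\<^sup>2 \<partial>N) = (\<Sum>U\<in>A. \<integral>x. (e U x)\<^sup>2 \<partial>N)"
    by (simp add: power2_eq_square)
qed

text \<open>
  If the law has a density $p$, the integration by parts formula says that $\tau = (w p)' / p$, with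
  $w p$ vanishing at the ends of the support. The weight kills the boundary terms; that it is bounded
  with bounded derivative keeps all later estimates at the level of second moments.
\<close>

locale ibp_law = prob_space \<mu> for \<mu> :: "real measure" +
  fixes w w' \<tau> :: "real \<Rightarrow> real"
  assumes sets_mu [measurable_cong, simp]: "sets \<mu> = sets borel"
    and square_integrable: "integrable \<mu> (\<lambda>x. x\<^sup>2)"
    and not_degenerate: "\<And>a. \<not> (AE x in \<mu>. x = a)"
    and w_bounds: "\<And>x. 0 \<le> w x" "\<And>x. w x \<le> 1"
    and w_pos: "AE x in \<mu>. 0 < w x"
    and w_deriv: "\<And>x. (w has_real_derivative w' x) (at x)"
    and w'_cont: "continuous_on UNIV w'"
    and w'_bound: "\<And>x. \<bar>w' x\<bar> \<le> 2"
    and tau_measurable [measurable]: "\<tau> \<in> borel_measurable borel"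
    and tau_square_integrable: "integrable \<mu> (\<lambda>x. (\<tau> x)\<^sup>2)"
    and ibp: "\<And>g g' C. (\<And>x. (g has_real_derivative g' x) (at x)) \<Longrightarrow> continuous_on UNIV g'
       \<Longrightarrow> (\<And>x. \<bar>g x\<bar> \<le> C) \<Longrightarrow> (\<And>x. \<bar>g' x\<bar> \<le> C)
       \<Longrightarrow> (\<integral>x. g' x * w x \<partial>\<mu>) = - (\<integral>x. g x * \<tau> x \<partial>\<mu>)"
begin

lemma space_mu [simp]: "space \<mu> = UNIV"
  using sets_eq_imp_space_eq[OF sets_mu] by simp

lemma prob_UNIV [simp]: "prob UNIV = 1"
  using prob_space by simp

sublocale smp: product_prob_space "\<lambda>_::nat. \<mu>" UNIV
  by unfold_locales

abbreviation samples :: "nat set \<Rightarrow> (nat \<Rightarrow> real) measure" where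
  "samples I \<equiv> PiM I (\<lambda>_. \<mu>)"

lemma prob_space_Pi: "prob_space (samples I)"
  by (rule prob_space_PiM) (rule prob_space_axioms)

definition c :: real where "c = (\<integral>x. x \<partial>\<mu>)"
definition v :: real where "v = (\<integral>x. (x - c)\<^sup>2 \<partial>\<mu>)"
definition tau_norm2 :: real where "tau_norm2 = (\<integral>x. (\<tau> x)\<^sup>2 \<partial>\<mu>)"

lemma integrable_of_square:
  assumes [measurable]: "f \<in> borel_measurable borel" and "integrable \<mu> (\<lambda>x. (f x)\<^sup>2)"
  shows "integrable \<mu> (f :: real \<Rightarrow> real)"
  using integrable_mult_of_squares[of f \<mu> "\<lambda>_. 1"] assms by simp

lemma integrable_id: "integrable \<mu> (\<lambda>x. x)"
  using integrable_of_square[of "\<lambda>x. x"] square_integrable by simp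

lemma centred_square_integrable: "integrable \<mu> (\<lambda>x. (x - c)\<^sup>2)"
  unfolding power2_diff using integrable_id square_integrable by auto

lemma centred_mean: "(\<integral>x. x - c \<partial>\<mu>) = 0"
  using integrable_id by (simp add: c_def)

lemma v_pos: "0 < v"
proof -
  have "v \<noteq> 0"
  proof
    assume "v = 0"
    then have "AE x in \<mu>. (x - c)\<^sup>2 = 0"
      using centred_square_integrable integral_nonneg_eq_0_iff_AE[of \<mu> "\<lambda>x. (x - c)\<^sup>2"] by (simp add: v_def)
    then have "AE x in \<mu>. x = c" by simp
    then show False using not_degenerate by auto
  qed
  moreover have "0 \<le> v" by (simp add: v_def)
  ultimately show ?thesis by simp
qed

lemma tau_norm2_nonneg: "0 \<le> tau_norm2" by (simp add: tau_norm2_def)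

lemma tau_mean: "(\<integral>x. \<tau> x \<partial>\<mu>) = 0"
  using ibp[of "\<lambda>_. 1" "\<lambda>_. 0" 1] by simp

text \<open>
  By independence the integral of the product factors over the coordinates. If $U \neq V$, a
  coordinate in exactly one of the two sets contributes a mean, which is zero.
\<close>

lemma product_orthogonal:
  fixes f g :: "nat \<Rightarrow> real \<Rightarrow> real"
  assumes I: "finite I" and UV: "U \<subseteq> I" "V \<subseteq> I"
    and [measurable]: "\<And>k. f k \<in> borel_measurable borel" "\<And>k. g k \<in> borel_measurable borel"
    and sq: "\<And>k. integrable \<mu> (\<lambda>t. (f k t)\<^sup>2)" "\<And>k. integrable \<mu> (\<lambda>t. (g k t)\<^sup>2)"
    and mean: "\<And>k. (\<integral>t. f k t \<partial>\<mu>) = 0" "\<And>k. (\<integral>t. g k t \<partial>\<mu>) = 0"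
  shows "integrable (samples I) (\<lambda>x. (\<Prod>k\<in>U. f k (x k)) * (\<Prod>k\<in>V. g k (x k)))" (is ?int)
    and "(\<integral>x. (\<Prod>k\<in>U. f k (x k)) * (\<Prod>k\<in>V. g k (x k)) \<partial>samples I)
       = (if U = V then \<Prod>k\<in>U. \<integral>t. f k t * g k t \<partial>\<mu> else 0)" (is ?eq)
proof -
  define h where "h k t = (if k \<in> U then f k t else 1) * (if k \<in> V then g k t else 1)" for k t
  have split: "(\<Prod>k\<in>U. f k (x k)) * (\<Prod>k\<in>V. g k (x k)) = (\<Prod>k\<in>I. h k (x k))" for x
  proof -
    have "(\<Prod>k\<in>U. f k (x k)) = (\<Prod>k\<in>I. if k \<in> U then f k (x k) else 1)"
      "(\<Prod>k\<in>V. g k (x k)) = (\<Prod>k\<in>I. if k \<in> V then g k (x k) else 1)"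
      using prod.inter_restrict[OF I, of "\<lambda>k. f k (x k)" U] prod.inter_restrict[OF I, of "\<lambda>k. g k (x k)" V] UV
      by (simp_all add: Int_absorb1)
    then show ?thesis by (simp add: h_def prod.distrib)
  qed
  have h_int: "integrable \<mu> (h k)" for k
  proof -
    have "integrable \<mu> (\<lambda>t. f k t * g k t)" "integrable \<mu> (f k)" "integrable \<mu> (g k)"
      by (rule integrable_mult_of_squares integrable_of_square; simp add: sq)+
    then show ?thesis by (cases "k \<in> U"; cases "k \<in> V") (simp_all add: h_def[abs_def])
  qed
  show ?int
    unfolding split by (intro smp.product_integrable_prod I h_int)
  have eq: "(\<integral>x. (\<Prod>k\<in>U. f k (x k)) * (\<Prod>k\<in>V. g k (x k)) \<partial>samples I) = (\<Prod>k\<in>I. integral\<^sup>L \<mu> (h k))"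
    unfolding split by (intro smp.product_integral_prod I h_int)
  show ?eq
  proof (cases "U = V")
    case True
    have "(\<Prod>k\<in>I. integral\<^sup>L \<mu> (h k)) = (\<Prod>k\<in>U. integral\<^sup>L \<mu> (h k))"
      using UV True by (intro prod.mono_neutral_right I) (auto simp: h_def[abs_def])
    also have "\<dots> = (\<Prod>k\<in>U. \<integral>t. f k t * g k t \<partial>\<mu>)"
      using True by (intro prod.cong) (auto simp: h_def[abs_def])
    finally show ?thesis using True eq by simp
  next
    case False
    then obtain k where "k \<in> I" "k \<in> U \<longleftrightarrow> k \<notin> V" using UV by blast
    moreover then have "integral\<^sup>L \<mu> (h k) = 0"
      using mean by (auto simp: h_def[abs_def])
    ultimately have "(\<Prod>k\<in>I. integral\<^sup>L \<mu> (h k)) = 0"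
      using I by (intro prod_zero) auto
    then show ?thesis using False eq by simp
  qed
qed

section \<open>Second moments of a polynomial and of its derivatives\<close>

text \<open>
  The second moment and the variance of \<open>mlin c I b\<close>, by orthogonality of the centred monomials.
\<close>

definition moment2 :: "nat set \<Rightarrow> (nat set \<Rightarrow> real) \<Rightarrow> real" where
  "moment2 I b = (\<Sum>U\<in>Pow I. (b U)\<^sup>2 * v ^ card U)"

definition mlin_var :: "nat set \<Rightarrow> (nat set \<Rightarrow> real) \<Rightarrow> real" where
  "mlin_var I b = (\<Sum>U\<in>Pow I - {{}}. (b U)\<^sup>2 * v ^ card U)"

text \<open>
  The divergence of the vector field $w(x_i) \partial_i F$ with respect to the product law.
\<close>

definition divergence :: "nat set \<Rightarrow> (nat set \<Rightarrow> real) \<Rightarrow> (nat \<Rightarrow> real) \<Rightarrow> real" where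
  "divergence I b x = (\<Sum>i\<in>I. \<tau> (x i) * mlin c I (der i b) x)"

lemma moment2_nonneg: "0 \<le> moment2 I b"
  using v_pos by (auto simp: moment2_def intro!: sum_nonneg)

lemma moment2_eq: "finite I \<Longrightarrow> moment2 I b = (b {})\<^sup>2 + mlin_var I b"
  by (simp add: moment2_def mlin_var_def sum.remove[of "Pow I" "{}"])

lemma component_measurable: "i \<in> I \<Longrightarrow> (\<lambda>x. x i) \<in> borel_measurable (samples I)"
  using measurable_component_singleton[of i I "\<lambda>_. \<mu>"] by (simp add: measurable_cong_sets[OF refl sets_mu])

lemma mlin_measurable [measurable]: "mlin c I b \<in> borel_measurable (samples I)"
  unfolding mlin_def[abs_def]
  by (intro borel_measurable_sum borel_measurable_times borel_measurable_prod
      borel_measurable_const borel_measurable_diff component_measurable) auto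

lemma integrable_component:
  assumes "i \<in> I" "finite I" "integrable \<mu> f"
  shows "integrable (samples I) (\<lambda>x. f (x i) :: real)"
proof -
  have "integrable (samples I) (\<lambda>x. \<Prod>k\<in>I. (if k = i then f else (\<lambda>_. 1)) (x k))"
    using assms by (intro smp.product_integrable_prod) auto
  moreover have "(\<Prod>k\<in>I. (if k = i then f else (\<lambda>_. 1)) (x k)) = f (x i)" for x
    using assms by (simp add: if_distrib[where f="\<lambda>f. f _"] prod.delta cong: if_cong)
  ultimately show ?thesis by simp
qed

lemma
  assumes I: "finite I"
  shows mlin_square_integrable: "integrable (samples I) (\<lambda>x. (mlin c I b x)\<^sup>2)"
    and mlin_square_integral: "(\<integral>x. (mlin c I b x)\<^sup>2 \<partial>samples I) = moment2 I b"
proof -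
  let ?e = "\<lambda>U x. b U * (\<Prod>i\<in>U. x i - c)"
  have orth: "integrable (samples I) (\<lambda>x. (\<Prod>k\<in>U. x k - c) * (\<Prod>k\<in>V. x k - c))"
    "(\<integral>x. (\<Prod>k\<in>U. x k - c) * (\<Prod>k\<in>V. x k - c) \<partial>samples I) = (if U = V then v ^ card U else 0)"
    if "U \<in> Pow I" "V \<in> Pow I" for U V
    using product_orthogonal[of I U V "\<lambda>_ t. t - c" "\<lambda>_ t. t - c"] that I centred_square_integrable centred_mean
    by (simp_all add: v_def power2_eq_square[symmetric])
  have int: "integrable (samples I) (\<lambda>x. ?e U x * ?e V x)"
    and val: "(\<integral>x. ?e U x * ?e V x \<partial>samples I) = b U * b V * (if U = V then v ^ card U else 0)"
    if "U \<in> Pow I" "V \<in> Pow I" for U V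
  proof -
    have *: "?e U x * ?e V x = (b U * b V) * ((\<Prod>k\<in>U. x k - c) * (\<Prod>k\<in>V. x k - c))" for x
      by simp
    show "integrable (samples I) (\<lambda>x. ?e U x * ?e V x)"
      unfolding * using orth(1)[OF that] by (intro integrable_mult_right) 
    show "(\<integral>x. ?e U x * ?e V x \<partial>samples I) = b U * b V * (if U = V then v ^ card U else 0)"
      unfolding * integral_mult_right_zero orth(2)[OF that] by simp
  qed
  have fin: "finite (Pow I)" using I by simp
  have orth0: "(\<integral>x. ?e U x * ?e V x \<partial>samples I) = 0" if "U \<in> Pow I" "V \<in> Pow I" "U \<noteq> V" for U V
    using val[OF that(1,2)] that(3) by simp
  show "integrable (samples I) (\<lambda>x. (mlin c I b x)\<^sup>2)"
    unfolding mlin_def by (rule orthogonal_expansion(1)[OF fin int orth0])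
  show "(\<integral>x. (mlin c I b x)\<^sup>2 \<partial>samples I) = moment2 I b"
  proof -
    have "(\<integral>x. (mlin c I b x)\<^sup>2 \<partial>samples I) = (\<Sum>U\<in>Pow I. \<integral>x. (?e U x)\<^sup>2 \<partial>samples I)"
      unfolding mlin_def by (rule orthogonal_expansion(2)[OF fin int orth0])
    also have "\<dots> = moment2 I b"
      unfolding moment2_def
    proof (rule sum.cong[OF refl])
      fix U assume "U \<in> Pow I"
      from val[OF this this] show "(\<integral>x. (?e U x)\<^sup>2 \<partial>samples I) = (b U)\<^sup>2 * v ^ card U"
        by (simp add: power2_eq_square)
    qed
    finally show ?thesis .
  qed
qed

lemma mlin_centred:
  "finite I \<Longrightarrow> mlin c I b x - b {} = mlin c I (b({} := 0)) x"
  by (simp add: mlin_def sum.remove[of "Pow I" "{}"])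

lemma
  assumes I: "finite I"
  shows mlin_variance_integrable: "integrable (samples I) (\<lambda>x. (mlin c I b x - b {})\<^sup>2)"
    and mlin_variance: "(\<integral>x. (mlin c I b x - b {})\<^sup>2 \<partial>samples I) = mlin_var I b"
  using mlin_square_integrable[OF I] mlin_square_integral[OF I] 
  by (simp_all add: mlin_centred[OF I] moment2_eq[OF I] mlin_var_def)

lemma sum_moment2_der:
  assumes "finite I"
  shows "(\<Sum>i\<in>I. moment2 I (der i b)) = (\<Sum>U\<in>Pow I. real (card U) * ((b U)\<^sup>2 * v ^ (card U - 1)))"
proof -
  have "(\<Sum>i\<in>I. moment2 I (der i b))
      = (\<Sum>i\<in>I. \<Sum>S\<in>Pow I. if i \<in> S then 0 else (b (insert i S))\<^sup>2 * v ^ (card (insert i S) - 1))"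
    unfolding moment2_def
  proof (rule sum.cong[OF refl], rule sum.cong[OF refl])
    fix i S assume "S \<in> Pow I"
    then have "finite S" using assms finite_subset by auto
    then show "(der i b S)\<^sup>2 * v ^ card S = (if i \<in> S then 0 else (b (insert i S))\<^sup>2 * v ^ (card (insert i S) - 1))"
      by (simp add: der_def)
  qed
  also have "\<dots> = (\<Sum>U\<in>Pow I. real (card U) * ((b U)\<^sup>2 * v ^ (card U - 1)))"
    by (subst sum_der_reindex[OF assms]) simp
  finally show ?thesis .
qed

lemma v_times_sum_moment2_der:
  assumes "finite I"
  shows "v * (\<Sum>i\<in>I. moment2 I (der i b)) = (\<Sum>U\<in>Pow I - {{}}. real (card U) * ((b U)\<^sup>2 * v ^ card U))"
proof -
  have "v * (\<Sum>i\<in>I. moment2 I (der i b)) = (\<Sum>U\<in>Pow I. v * (real (card U) * ((b U)\<^sup>2 * v ^ (card U - 1))))"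
    by (simp only: sum_moment2_der[OF assms] sum_distrib_left)
  also have "\<dots> = (\<Sum>U\<in>Pow I. real (card U) * ((b U)\<^sup>2 * v ^ card U))"
  proof (intro sum.cong refl)
    fix U show "v * (real (card U) * ((b U)\<^sup>2 * v ^ (card U - 1))) = real (card U) * ((b U)\<^sup>2 * v ^ card U)"
      by (cases "card U") auto
  qed
  finally show ?thesis using assms by (simp add: sum.remove[of "Pow I" "{}"])
qed

text \<open>
  A Poincare inequality. It and the reverse inequality below hold because a monomial over $U$ has
  $|U|$ partial derivatives, and $1 \leq |U| \leq d$ for the non-constant ones.
\<close>

lemma mlin_var_le_sum_moment2_der:
  assumes "finite I"
  shows "mlin_var I b \<le> v * (\<Sum>i\<in>I. moment2 I (der i b))"
  unfolding v_times_sum_moment2_der[OF assms] mlin_var_def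
proof (intro sum_mono)
  fix U assume "U \<in> Pow I - {{}}"
  then have "1 \<le> card U" using assms by (metis DiffE PowD card_0_eq finite_subset less_one not_le singletonI)
  then show "(b U)\<^sup>2 * v ^ card U \<le> real (card U) * ((b U)\<^sup>2 * v ^ card U)"
    using v_pos mult_right_mono[of 1 "real (card U)" "(b U)\<^sup>2 * v ^ card U"] by simp
qed

lemma sum_moment2_der_le:
  assumes "finite I" "deg_le d b"
  shows "v * (\<Sum>i\<in>I. moment2 I (der i b)) \<le> real d * mlin_var I b"
  unfolding v_times_sum_moment2_der[OF assms(1)] mlin_var_def sum_distrib_left[of "real d"]
proof (intro sum_mono)
  fix U assume "U \<in> Pow I - {{}}"
  show "real (card U) * ((b U)\<^sup>2 * v ^ card U) \<le> real d * ((b U)\<^sup>2 * v ^ card U)"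
  proof (cases "d < card U")
    case True
    then show ?thesis using assms(2) by (simp add: deg_le_def)
  next
    case False
    then show ?thesis using v_pos by (intro mult_right_mono) auto
  qed
qed

lemma deg_le_der': "deg_le d b \<Longrightarrow> deg_le d (der i b)"
  using deg_le_der[of d b i] by (auto simp: deg_le_def)

lemma sum_moment2_der_der_le:
  assumes "finite I" "deg_le d b"
  shows "v\<^sup>2 * (\<Sum>i\<in>I. \<Sum>j\<in>I. moment2 I (der j (der i b))) \<le> (real d)\<^sup>2 * mlin_var I b"
proof -
  have "v\<^sup>2 * (\<Sum>i\<in>I. \<Sum>j\<in>I. moment2 I (der j (der i b)))
      = v * (\<Sum>i\<in>I. v * (\<Sum>j\<in>I. moment2 I (der j (der i b))))"
    by (simp add: sum_distrib_left power2_eq_square mult.assoc)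
  also have "\<dots> \<le> v * (\<Sum>i\<in>I. real d * moment2 I (der i b))"
  proof (intro mult_left_mono sum_mono)
    fix i assume "i \<in> I"
    have "v * (\<Sum>j\<in>I. moment2 I (der j (der i b))) \<le> real d * mlin_var I (der i b)"
      by (rule sum_moment2_der_le) (use assms deg_le_der' in auto)
    also have "\<dots> \<le> real d * moment2 I (der i b)"
      using moment2_eq[OF assms(1), of "der i b"] by (intro mult_left_mono) auto
    finally show "v * (\<Sum>j\<in>I. moment2 I (der j (der i b))) \<le> real d * moment2 I (der i b)" .
  qed (use v_pos in simp)
  also have "\<dots> = real d * (v * (\<Sum>i\<in>I. moment2 I (der i b)))"
    by (simp add: sum_distrib_left mult_ac)
  also have "\<dots> \<le> real d * (real d * mlin_var I b)"
    by (intro mult_left_mono sum_moment2_der_le assms) auto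
  finally show ?thesis by (simp add: power2_eq_square)
qed

text \<open>
  In this form the summand of each $U$ is again a sum of products over $U$ of mean zero functions, one
  of them $\tau$ instead of $x - c$, so that different $U$ are still orthogonal.
\<close>

lemma divergence_eq:
  assumes "finite I"
  shows "divergence I b x = (\<Sum>U\<in>Pow I. b U * (\<Sum>i\<in>U. \<Prod>k\<in>U. if k = i then \<tau> (x k) else x k - c))"
proof -
  have "divergence I b x = (\<Sum>i\<in>I. \<Sum>S\<in>Pow I. if i \<in> S then 0 else
      b (insert i S) * (\<Prod>k\<in>insert i S. if k = i then \<tau> (x k) else x k - c))"
    unfolding divergence_def mlin_def sum_distrib_left
  proof (rule sum.cong[OF refl], rule sum.cong[OF refl])
    fix i S assume S: "S \<in> Pow I"
    have fin: "finite S" using S assms finite_subset by auto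
    have "(\<Prod>k\<in>insert i S. if k = i then \<tau> (x k) else x k - c) = \<tau> (x i) * (\<Prod>k\<in>S. x k - c)" if "i \<notin> S"
    proof -
      have "(\<Prod>k\<in>S. if k = i then \<tau> (x k) else x k - c) = (\<Prod>k\<in>S. x k - c)"
        using that by (intro prod.cong) auto
      then show ?thesis using that fin by simp
    qed
    then show "\<tau> (x i) * (der i b S * (\<Prod>k\<in>S. x k - c)) = (if i \<in> S then 0 else
      b (insert i S) * (\<Prod>k\<in>insert i S. if k = i then \<tau> (x k) else x k - c))"
      by (simp add: der_def)
  qed
  also have "\<dots> = (\<Sum>U\<in>Pow I. \<Sum>i\<in>U. b U * (\<Prod>k\<in>U. if k = i then \<tau> (x k) else x k - c))"
    by (rule sum_der_reindex[OF assms])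
  finally show ?thesis by (simp only: sum_distrib_left)
qed

lemma
  assumes I: "finite I" and deg: "deg_le d b"
  shows divergence_square_integrable: "integrable (samples I) (\<lambda>x. (divergence I b x)\<^sup>2)"
    and divergence_square_integral: "v * (\<integral>x. (divergence I b x)\<^sup>2 \<partial>samples I) \<le> tau_norm2 * (real d)\<^sup>2 * mlin_var I b"
proof -
  define f where "f i k = (if k = i then \<tau> else (\<lambda>t. t - c))" for i k :: nat
  define p where "p U i x = (\<Prod>k\<in>U. f i k (x k))" for U i and x :: "nat \<Rightarrow> real"
  define e where "e U x = b U * (\<Sum>i\<in>U. p U i x)" for U x
  have divergence: "divergence I b x = (\<Sum>U\<in>Pow I. e U x)" for x
    unfolding divergence_eq[OF I] e_def p_def f_def
    by (intro sum.cong refl arg_cong2[where f="(*)"] prod.cong) auto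
  have f: "f i k \<in> borel_measurable borel" "integrable \<mu> (\<lambda>t. (f i k t)\<^sup>2)" "(\<integral>t. f i k t \<partial>\<mu>) = 0" for i k
    by (auto simp: f_def tau_square_integrable centred_square_integrable tau_mean centred_mean)
  have p_int: "integrable (samples I) (\<lambda>x. p U i x * p V j x)"
    and p_val: "(\<integral>x. p U i x * p V j x \<partial>samples I) = (if U = V then \<Prod>k\<in>U. \<integral>t. f i k t * f j k t \<partial>\<mu> else 0)"
    if "U \<in> Pow I" "V \<in> Pow I" for U V i j
    using product_orthogonal[of I U V "f i" "f j"] f that I by (simp_all add: p_def)
  have e_int: "integrable (samples I) (\<lambda>x. e U x * e V x)"
    and e_val: "(\<integral>x. e U x * e V x \<partial>samples I) = b U * b V * (\<Sum>i\<in>U. \<Sum>j\<in>V. \<integral>x. p U i x * p V j x \<partial>samples I)"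
    if "U \<in> Pow I" "V \<in> Pow I" for U V
  proof -
    have *: "e U x * e V x = (b U * b V) * (\<Sum>i\<in>U. \<Sum>j\<in>V. p U i x * p V j x)" for x
      by (simp add: e_def sum_product[symmetric])
    show "integrable (samples I) (\<lambda>x. e U x * e V x)"
      unfolding * using p_int[OF that] by auto
    show "(\<integral>x. e U x * e V x \<partial>samples I) = b U * b V * (\<Sum>i\<in>U. \<Sum>j\<in>V. \<integral>x. p U i x * p V j x \<partial>samples I)"
      unfolding * integral_mult_right_zero using p_int[OF that] by simp
  qed
  have e_orth: "(\<integral>x. e U x * e V x \<partial>samples I) = 0" if "U \<in> Pow I" "V \<in> Pow I" "U \<noteq> V" for U V
    using e_val[OF that(1,2)] p_val[OF that(1,2)] that(3) by simp
  have fin: "finite (Pow I)" using I by simp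
  show "integrable (samples I) (\<lambda>x. (divergence I b x)\<^sup>2)"
    unfolding divergence by (rule orthogonal_expansion(1)[OF fin e_int e_orth])
  have e_sq: "v * (\<integral>x. (e U x)\<^sup>2 \<partial>samples I) \<le> tau_norm2 * (real d)\<^sup>2 * ((b U)\<^sup>2 * v ^ card U)"
    if U: "U \<in> Pow I" and ne: "U \<noteq> {}" for U
  proof -
    have finU: "finite U" using U I finite_subset by auto
    have p_sq: "v * (\<integral>x. (p U i x)\<^sup>2 \<partial>samples I) = tau_norm2 * v ^ card U" if i: "i \<in> U" for i
    proof -
      have "(\<integral>x. (p U i x)\<^sup>2 \<partial>samples I) = (\<Prod>k\<in>U. \<integral>t. (f i k t)\<^sup>2 \<partial>\<mu>)"
        using p_val[OF U U, of i i] by (simp add: power2_eq_square)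
      also have "\<dots> = (\<integral>t. (f i i t)\<^sup>2 \<partial>\<mu>) * (\<Prod>k\<in>U - {i}. \<integral>t. (f i k t)\<^sup>2 \<partial>\<mu>)"
        using finU i by (rule prod.remove)
      also have "(\<Prod>k\<in>U - {i}. \<integral>t. (f i k t)\<^sup>2 \<partial>\<mu>) = (\<Prod>k\<in>U - {i}. v)"
        by (intro prod.cong) (auto simp: f_def v_def)
      also have "\<dots> = v ^ (card U - 1)" using i finU by simp
      also have "(\<integral>t. (f i i t)\<^sup>2 \<partial>\<mu>) = tau_norm2" by (simp add: f_def tau_norm2_def)
      finally show ?thesis using finU ne by (cases "card U") auto
    qed
    have "(\<integral>x. (e U x)\<^sup>2 \<partial>samples I) \<le> (\<integral>x. (b U)\<^sup>2 * (real (card U) * (\<Sum>i\<in>U. (p U i x)\<^sup>2)) \<partial>samples I)"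
    proof (rule integral_mono)
      show "integrable (samples I) (\<lambda>x. (e U x)\<^sup>2)"
        using e_int[OF U U] by (simp add: power2_eq_square)
      show "integrable (samples I) (\<lambda>x. (b U)\<^sup>2 * (real (card U) * (\<Sum>i\<in>U. (p U i x)\<^sup>2)))"
        using p_int[OF U U] by (simp add: power2_eq_square)
      show "(e U x)\<^sup>2 \<le> (b U)\<^sup>2 * (real (card U) * (\<Sum>i\<in>U. (p U i x)\<^sup>2))" for x
        unfolding e_def power_mult_distrib using sum_square_le_card[OF finU]
        by (intro mult_left_mono) auto
    qed
    also have "\<dots> = (b U)\<^sup>2 * (real (card U) * (\<Sum>i\<in>U. \<integral>x. (p U i x)\<^sup>2 \<partial>samples I))"
      using p_int[OF U U] by (simp add: power2_eq_square)
    finally have "v * (\<integral>x. (e U x)\<^sup>2 \<partial>samples I)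
        \<le> v * ((b U)\<^sup>2 * (real (card U) * (\<Sum>i\<in>U. \<integral>x. (p U i x)\<^sup>2 \<partial>samples I)))"
      using v_pos by simp
    also have "\<dots> = (b U)\<^sup>2 * (real (card U) * (\<Sum>i\<in>U. v * (\<integral>x. (p U i x)\<^sup>2 \<partial>samples I)))"
      by (simp add: sum_distrib_left[symmetric] mult_ac)
    also have "(\<Sum>i\<in>U. v * (\<integral>x. (p U i x)\<^sup>2 \<partial>samples I)) = real (card U) * (tau_norm2 * v ^ card U)"
      by (simp add: p_sq)
    also have "(b U)\<^sup>2 * (real (card U) * (real (card U) * (tau_norm2 * v ^ card U)))
        = tau_norm2 * (real (card U))\<^sup>2 * ((b U)\<^sup>2 * v ^ card U)"
      by (simp add: power2_eq_square mult_ac)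
    also have "\<dots> \<le> tau_norm2 * (real d)\<^sup>2 * ((b U)\<^sup>2 * v ^ card U)"
    proof (cases "d < card U")
      case True
      then show ?thesis using deg by (simp add: deg_le_def)
    next
      case False
      then show ?thesis using v_pos tau_norm2_nonneg by (intro mult_right_mono mult_left_mono power_mono) auto
    qed
    finally show ?thesis .
  qed
  have "v * (\<integral>x. (divergence I b x)\<^sup>2 \<partial>samples I) = (\<Sum>U\<in>Pow I. v * (\<integral>x. (e U x)\<^sup>2 \<partial>samples I))"
    using orthogonal_expansion(2)[OF fin e_int e_orth] by (simp add: divergence sum_distrib_left)
  also have "\<dots> = (\<Sum>U\<in>Pow I - {{}}. v * (\<integral>x. (e U x)\<^sup>2 \<partial>samples I))"
    using fin by (intro sum.mono_neutral_right) (auto simp: e_def)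
  also have "\<dots> \<le> (\<Sum>U\<in>Pow I - {{}}. tau_norm2 * (real d)\<^sup>2 * ((b U)\<^sup>2 * v ^ card U))"
    using e_sq by (intro sum_mono) auto
  finally show "v * (\<integral>x. (divergence I b x)\<^sup>2 \<partial>samples I) \<le> tau_norm2 * (real d)\<^sup>2 * mlin_var I b"
    by (simp add: mlin_var_def sum_distrib_left)
qed

section \<open>The weighted gradient and integration by parts in many variables\<close>

text \<open>
  Fubini reduces this to the one-dimensional formula in the $i$-th coordinate. The bounds
  along a line may depend on the remaining coordinates.
\<close>

lemma ibp_product:
  fixes g g' :: "(nat \<Rightarrow> real) \<Rightarrow> real"
  assumes I: "finite I" "i \<in> I"
    and deriv: "\<And>x t. ((\<lambda>t. g (x(i := t))) has_real_derivative g' (x(i := t))) (at t)"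
    and cont: "\<And>x. continuous_on UNIV (\<lambda>t. g' (x(i := t)))"
    and bnd: "\<And>x. \<exists>C. \<forall>t. \<bar>g (x(i := t))\<bar> \<le> C \<and> \<bar>g' (x(i := t))\<bar> \<le> C"
    and int: "integrable (samples I) (\<lambda>x. g' x * w (x i))" "integrable (samples I) (\<lambda>x. g x * \<tau> (x i))"
  shows "(\<integral>x. g' x * w (x i) \<partial>samples I) = - (\<integral>x. g x * \<tau> (x i) \<partial>samples I)"
proof -
  obtain J where J: "I = insert i J" "i \<notin> J" "finite J"
    using I(2,1) by (rule finite_insertE)
  have "(\<integral>x. g' x * w (x i) \<partial>samples I) = (\<integral>x. (\<integral>t. g' (x(i := t)) * w ((x(i := t)) i) \<partial>\<mu>) \<partial>samples J)"
    unfolding J(1) using int(1) by (intro smp.product_integral_insert[OF J(3,2)]) (simp add: J(1))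
  also have "\<dots> = (\<integral>x. - (\<integral>t. g (x(i := t)) * \<tau> ((x(i := t)) i) \<partial>\<mu>) \<partial>samples J)"
  proof (rule Bochner_Integration.integral_cong[OF refl])
    fix x
    obtain C where "\<forall>t. \<bar>g (x(i := t))\<bar> \<le> C \<and> \<bar>g' (x(i := t))\<bar> \<le> C" using bnd by blast
    then show "(\<integral>t. g' (x(i := t)) * w ((x(i := t)) i) \<partial>\<mu>) = - (\<integral>t. g (x(i := t)) * \<tau> ((x(i := t)) i) \<partial>\<mu>)"
      using ibp[of "\<lambda>t. g (x(i := t))" "\<lambda>t. g' (x(i := t))" C] deriv cont by simp
  qed
  also have "\<dots> = - (\<integral>x. g x * \<tau> (x i) \<partial>samples I)"
    unfolding J(1) using int(2) by (subst smp.product_integral_insert[OF J(3,2)]) (simp_all add: J(1))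
  finally show ?thesis .
qed

text \<open>
  The weighted squared gradient $\Gamma$, and its partial derivatives. In the latter the terms from
  $\partial_i (\partial_j F)^2$ with $j = i$ vanish, as $\partial_i F$ does not depend on $x_i$.
\<close>

definition wgrad2 :: "nat set \<Rightarrow> (nat set \<Rightarrow> real) \<Rightarrow> (nat \<Rightarrow> real) \<Rightarrow> real" where
  "wgrad2 I b x = (\<Sum>i\<in>I. w (x i) * (mlin c I (der i b) x)\<^sup>2)"

definition wgrad2_partial :: "nat set \<Rightarrow> (nat set \<Rightarrow> real) \<Rightarrow> nat \<Rightarrow> (nat \<Rightarrow> real) \<Rightarrow> real" where
  "wgrad2_partial I b i x = w' (x i) * (mlin c I (der i b) x)\<^sup>2
     + (\<Sum>j\<in>I. 2 * (w (x j) * mlin c I (der j b) x * mlin c I (der i (der j b)) x))"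

definition grad2 :: "nat set \<Rightarrow> (nat set \<Rightarrow> real) \<Rightarrow> (nat \<Rightarrow> real) \<Rightarrow> real" where
  "grad2 I b x = (\<Sum>i\<in>I. (mlin c I (der i b) x)\<^sup>2)"

definition hess2 :: "nat set \<Rightarrow> (nat set \<Rightarrow> real) \<Rightarrow> (nat \<Rightarrow> real) \<Rightarrow> real" where
  "hess2 I b x = (\<Sum>i\<in>I. \<Sum>j\<in>I. (mlin c I (der j (der i b)) x)\<^sup>2)"

lemma wgrad2_nonneg: "0 \<le> wgrad2 I b x"
  unfolding wgrad2_def using w_bounds by (intro sum_nonneg) simp

lemma grad2_nonneg: "0 \<le> grad2 I b x"
  unfolding grad2_def by (intro sum_nonneg) simp

lemma hess2_nonneg: "0 \<le> hess2 I b x"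
  unfolding hess2_def by (intro sum_nonneg) simp

lemma w_cont: "continuous_on A w"
  using w_deriv by (meson DERIV_isCont continuous_at_imp_continuous_on)

lemma w_measurable [measurable]: "w \<in> borel_measurable borel"
  using w_cont by (intro borel_measurable_continuous_onI) 

lemma w'_measurable [measurable]: "w' \<in> borel_measurable borel"
  using w'_cont by (intro borel_measurable_continuous_onI) 

lemma component_fun_measurable:
  "i \<in> I \<Longrightarrow> h \<in> borel_measurable borel \<Longrightarrow> (\<lambda>x. h (x i)) \<in> borel_measurable (samples I)"
  by (rule measurable_compose[OF component_measurable])

lemma wgrad2_measurable [measurable]: "wgrad2 I b \<in> borel_measurable (samples I)"
  unfolding wgrad2_def[abs_def]
  by (intro borel_measurable_sum borel_measurable_times borel_measurable_power component_fun_measurable mlin_measurable w_measurable)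

lemma wgrad2_partial_measurable: "i \<in> I \<Longrightarrow> wgrad2_partial I b i \<in> borel_measurable (samples I)"
  unfolding wgrad2_partial_def[abs_def]
  by (intro borel_measurable_sum borel_measurable_times borel_measurable_add borel_measurable_const
      borel_measurable_power component_fun_measurable mlin_measurable w_measurable w'_measurable)

lemma divergence_measurable [measurable]: "divergence I b \<in> borel_measurable (samples I)"
  unfolding divergence_def[abs_def]
  by (intro borel_measurable_sum borel_measurable_times component_fun_measurable mlin_measurable tau_measurable)

lemma mlin_deriv:
  assumes "finite I" "i \<in> I"
  shows "((\<lambda>t. mlin c I b (x(i := t))) has_real_derivative mlin c I (der i b) (x(i := t))) (at t)"
  unfolding mlin_upd[OF assms, of c b] mlin_der_upd[OF assms]
  by (auto intro!: derivative_eq_intros)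

lemma mlin_cont:
  assumes "finite I" "i \<in> I"
  shows "continuous_on A (\<lambda>t. mlin c I b (x(i := t)))"
  unfolding mlin_upd[OF assms] by (intro continuous_intros)

lemma w_upd_cont: "continuous_on A (\<lambda>t. w ((x(i := t)) j))"
  by (cases "j = i") (auto intro: w_cont)

lemma wgrad2_has_derivative:
  assumes I: "finite I" "i \<in> I"
  shows "((\<lambda>t. wgrad2 I b (x(i := t))) has_real_derivative wgrad2_partial I b i (x(i := t))) (at t)"
proof -
  let ?B = "\<lambda>j. mlin c I (der j b)" and ?D = "\<lambda>j. mlin c I (der i (der j b))"
  let ?d = "\<lambda>j. (if j = i then w' t * (?B i x)\<^sup>2 else 0)
      + 2 * (w ((x(i := t)) j) * ?B j (x(i := t)) * ?D j (x(i := t)))"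
  have "((\<lambda>t. w ((x(i := t)) j) * (?B j (x(i := t)))\<^sup>2) has_real_derivative ?d j) (at t)" for j
  proof (cases "j = i")
    case True
    then show ?thesis
      by (auto intro!: derivative_eq_intros w_deriv simp: mlin_der_upd[OF I] mlin_der_der_same)
  next
    case False
    then show ?thesis
      by (auto intro!: derivative_eq_intros mlin_deriv[OF I])
  qed
  then have "((\<lambda>t. wgrad2 I b (x(i := t))) has_real_derivative (\<Sum>j\<in>I. ?d j)) (at t)"
    unfolding wgrad2_def by (intro DERIV_sum)
  moreover have "(\<Sum>j\<in>I. ?d j) = wgrad2_partial I b i (x(i := t))"
    using I by (simp add: wgrad2_partial_def sum.distrib mlin_der_upd[OF I])
  ultimately show ?thesis by simp
qed

lemma wgrad2_cont:
  assumes I: "finite I" "i \<in> I"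
  shows "continuous_on A (\<lambda>t. wgrad2 I b (x(i := t)))"
  unfolding wgrad2_def using I by (intro continuous_intros w_upd_cont mlin_cont)

lemma wgrad2_partial_cont:
  assumes I: "finite I" "i \<in> I"
  shows "continuous_on A (\<lambda>t. wgrad2_partial I b i (x(i := t)))"
  unfolding wgrad2_partial_def using I continuous_on_subset[OF w'_cont subset_UNIV]
  by (auto intro!: continuous_intros w_upd_cont[unfolded fun_upd_def] mlin_cont[unfolded fun_upd_def] simp: fun_upd_def)

text \<open>
  Along a line in direction $i$ the first and second derivatives of $F$ on the right are constant, so
  the derivative of $\Gamma$ is bounded by a constant plus $\Gamma$; after division by
  $(\Gamma + e)^2$ it is bounded.
\<close>

lemma wgrad2_partial_bound:
  assumes "finite I"
  shows "\<bar>wgrad2_partial I b i x\<bar> \<le> 2 * (mlin c I (der i b) x)\<^sup>2 + (\<Sum>j\<in>I. (mlin c I (der i (der j b)) x)\<^sup>2) + wgrad2 I b x"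
proof -
  let ?B = "\<lambda>j. mlin c I (der j b) x" and ?D = "\<lambda>j. mlin c I (der i (der j b)) x"
  have trm: "\<bar>2 * (w (x j) * ?B j * ?D j)\<bar> \<le> (?D j)\<^sup>2 + w (x j) * (?B j)\<^sup>2" for j
  proof -
    have "2 * \<bar>?B j * ?D j\<bar> \<le> (?B j)\<^sup>2 + (?D j)\<^sup>2"
      using sum_squares_bound[of "\<bar>?B j\<bar>" "\<bar>?D j\<bar>"] by (simp add: abs_mult)
    then have "w (x j) * (2 * \<bar>?B j * ?D j\<bar>) \<le> w (x j) * ((?B j)\<^sup>2 + (?D j)\<^sup>2)"
      using w_bounds by (intro mult_left_mono) auto
    moreover have "w (x j) * (?D j)\<^sup>2 \<le> 1 * (?D j)\<^sup>2"
      using w_bounds by (intro mult_right_mono) auto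
    ultimately show ?thesis using w_bounds(1)[of "x j"] by (simp add: abs_mult algebra_simps)
  qed
  have "\<bar>wgrad2_partial I b i x\<bar> \<le> \<bar>w' (x i) * (?B i)\<^sup>2\<bar> + (\<Sum>j\<in>I. \<bar>2 * (w (x j) * ?B j * ?D j)\<bar>)"
    unfolding wgrad2_partial_def by (rule order_trans[OF abs_triangle_ineq]) (intro add_left_mono sum_abs)
  also have "\<dots> \<le> 2 * (?B i)\<^sup>2 + (\<Sum>j\<in>I. (?D j)\<^sup>2 + w (x j) * (?B j)\<^sup>2)"
    using w'_bound trm by (intro add_mono sum_mono) (auto simp: abs_mult intro!: mult_right_mono)
  finally show ?thesis by (simp add: sum.distrib wgrad2_def)
qed

text \<open>
  This is the derivative of $\Gamma$ along the field $w(x_i) \partial_i F$. The bound has only one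
  factor $\Gamma + e$, so that a division by $(\Gamma + e)^2$ leaves $1/e$ times squared first and
  second derivatives, and no moments above the second are ever needed.
\<close>

lemma sum_wgrad2_partial_bound:
  assumes "finite I" and e: "0 < e"
  shows "(\<Sum>i\<in>I. \<bar>w (x i) * mlin c I (der i b) x * wgrad2_partial I b i x\<bar>)
    \<le> (wgrad2 I b x + e) * (2 + grad2 I b x + hess2 I b x)"
proof -
  let ?B = "\<lambda>j. mlin c I (der j b) x" and ?D = "\<lambda>i j. mlin c I (der i (der j b)) x"
  let ?g = "wgrad2 I b x + e"
  define W where "W i = w (x i) * (?B i)\<^sup>2" for i
  have g: "0 < ?g" using wgrad2_nonneg[of I b x] e by simp
  have W: "0 \<le> W i" for i using w_bounds by (simp add: W_def)
  have wgrad2_W: "wgrad2 I b x = (\<Sum>i\<in>I. W i)" by (simp add: wgrad2_def W_def)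
  have first: "\<bar>w (x i) * ?B i * (w' (x i) * (?B i)\<^sup>2)\<bar> \<le> W i * (1 + grad2 I b x)" if "i \<in> I" for i
  proof -
    have "\<bar>?B i\<bar> * \<bar>w' (x i)\<bar> \<le> \<bar>?B i\<bar> * 2"
      using w'_bound by (intro mult_left_mono) auto
    also have "\<dots> \<le> 1 + (?B i)\<^sup>2"
      using sum_squares_bound[of 1 "\<bar>?B i\<bar>"] by simp
    also have "(?B i)\<^sup>2 \<le> grad2 I b x"
      unfolding grad2_def using assms(1) that by (intro member_le_sum) auto
    finally have "W i * (\<bar>?B i\<bar> * \<bar>w' (x i)\<bar>) \<le> W i * (1 + grad2 I b x)"
      using W by (intro mult_left_mono) auto
    then show ?thesis using w_bounds(1)[of "x i"] by (simp add: W_def abs_mult mult_ac)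
  qed
  have second: "\<bar>w (x i) * ?B i * (2 * (w (x j) * ?B j * ?D i j))\<bar> \<le> W i * W j / ?g + ?g * (?D i j)\<^sup>2" for i j
  proof -
    let ?p = "\<bar>?B i * ?B j\<bar>" and ?ww = "w (x i) * w (x j)"
    have ww: "0 \<le> ?ww" "?ww \<le> 1" using w_bounds mult_mono[of "w (x i)" 1 "w (x j)" 1] by auto
    (* The product of two first derivatives and a second one is split so that the first order part is
       divided by Gamma + e: its sum over i and j is then at most Gamma + e again. *)
    have sq: "2 * (?p / sqrt ?g) * (sqrt ?g * \<bar>?D i j\<bar>) \<le> (?p / sqrt ?g)\<^sup>2 + (sqrt ?g * \<bar>?D i j\<bar>)\<^sup>2"
      by (rule sum_squares_bound)
    have "2 * ?p * \<bar>?D i j\<bar> \<le> (?B i * ?B j)\<^sup>2 / ?g + ?g * (?D i j)\<^sup>2"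
      using sq g by (simp add: power_mult_distrib power_divide)
    then have "?ww * (2 * ?p * \<bar>?D i j\<bar>) \<le> ?ww * ((?B i * ?B j)\<^sup>2 / ?g + ?g * (?D i j)\<^sup>2)"
      using ww by (intro mult_left_mono) auto
    also have "\<dots> = W i * W j / ?g + ?ww * (?g * (?D i j)\<^sup>2)"
      by (simp add: W_def algebra_simps power_mult_distrib)
    finally have "?ww * (2 * ?p * \<bar>?D i j\<bar>) \<le> W i * W j / ?g + ?ww * (?g * (?D i j)\<^sup>2)" .
    moreover have "?ww * (?g * (?D i j)\<^sup>2) \<le> 1 * (?g * (?D i j)\<^sup>2)"
      using ww g by (intro mult_right_mono) auto
    ultimately have "?ww * (2 * ?p * \<bar>?D i j\<bar>) \<le> W i * W j / ?g + ?g * (?D i j)\<^sup>2" by linarith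
    then show ?thesis using w_bounds(1)[of "x i"] w_bounds(1)[of "x j"] by (simp add: abs_mult mult_ac)
  qed
  have "(\<Sum>i\<in>I. \<bar>w (x i) * ?B i * wgrad2_partial I b i x\<bar>)
      \<le> (\<Sum>i\<in>I. W i * (1 + grad2 I b x) + (\<Sum>j\<in>I. W i * W j / ?g + ?g * (?D i j)\<^sup>2))"
  proof (rule sum_mono)
    fix i assume i: "i \<in> I"
    have eq: "w (x i) * ?B i * wgrad2_partial I b i x = w (x i) * ?B i * (w' (x i) * (?B i)\<^sup>2)
        + (\<Sum>j\<in>I. w (x i) * ?B i * (2 * (w (x j) * ?B j * ?D i j)))"
      unfolding wgrad2_partial_def by (simp add: distrib_left sum_distrib_left)
    have "\<bar>w (x i) * ?B i * wgrad2_partial I b i x\<bar> \<le> \<bar>w (x i) * ?B i * (w' (x i) * (?B i)\<^sup>2)\<bar>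
        + (\<Sum>j\<in>I. \<bar>w (x i) * ?B i * (2 * (w (x j) * ?B j * ?D i j))\<bar>)"
      unfolding eq by (rule order_trans[OF abs_triangle_ineq]) (intro add_left_mono sum_abs)
    also have "\<dots> \<le> W i * (1 + grad2 I b x) + (\<Sum>j\<in>I. W i * W j / ?g + ?g * (?D i j)\<^sup>2)"
      using first[OF i] second by (intro add_mono sum_mono) auto
    finally show "\<bar>w (x i) * ?B i * wgrad2_partial I b i x\<bar> \<le> W i * (1 + grad2 I b x) + (\<Sum>j\<in>I. W i * W j / ?g + ?g * (?D i j)\<^sup>2)" .
  qed
  also have "\<dots> = wgrad2 I b x * (1 + grad2 I b x) + (wgrad2 I b x * wgrad2 I b x / ?g
       + ?g * (\<Sum>i\<in>I. \<Sum>j\<in>I. (?D i j)\<^sup>2))"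
  proof -
    have "wgrad2 I b x * wgrad2 I b x / ?g = (\<Sum>i\<in>I. \<Sum>j\<in>I. W i * W j / ?g)"
      by (simp add: wgrad2_W sum_product sum_divide_distrib)
    moreover have "wgrad2 I b x * (1 + grad2 I b x) = (\<Sum>i\<in>I. W i * (1 + grad2 I b x))"
      by (simp only: wgrad2_W sum_distrib_right)
    ultimately show ?thesis by (simp only: sum.distrib sum_distrib_left)
  qed
  finally have main: "(\<Sum>i\<in>I. \<bar>w (x i) * ?B i * wgrad2_partial I b i x\<bar>) \<le> wgrad2 I b x * (1 + grad2 I b x)
      + (wgrad2 I b x * wgrad2 I b x / ?g + ?g * (\<Sum>i\<in>I. \<Sum>j\<in>I. (?D i j)\<^sup>2))" .
  have h: "(\<Sum>i\<in>I. \<Sum>j\<in>I. (?D i j)\<^sup>2) = hess2 I b x"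
    unfolding hess2_def by (rule sum.swap)
  have "wgrad2 I b x * wgrad2 I b x / ?g \<le> ?g"
    using g e wgrad2_nonneg[of I b x] mult_mono[of "wgrad2 I b x" ?g "wgrad2 I b x" ?g] by (simp add: divide_le_eq)
  moreover have "wgrad2 I b x * (1 + grad2 I b x) \<le> ?g * (1 + grad2 I b x)"
    using e grad2_nonneg[of I b x] by (intro mult_right_mono) auto
  ultimately have "(\<Sum>i\<in>I. \<bar>w (x i) * ?B i * wgrad2_partial I b i x\<bar>) \<le> ?g * (1 + grad2 I b x) + (?g + ?g * hess2 I b x)"
    using main unfolding h by linarith
  then show ?thesis by (simp add: algebra_simps)
qed

lemma
  assumes "finite I"
  shows grad2_integrable: "integrable (samples I) (grad2 I b)"
    and grad2_integral: "(\<integral>x. grad2 I b x \<partial>samples I) = (\<Sum>i\<in>I. moment2 I (der i b))"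
    and hess2_integrable: "integrable (samples I) (hess2 I b)"
    and hess2_integral: "(\<integral>x. hess2 I b x \<partial>samples I) = (\<Sum>i\<in>I. \<Sum>j\<in>I. moment2 I (der j (der i b)))"
  using mlin_square_integrable[OF assms] mlin_square_integral[OF assms]
  by (simp_all add: grad2_def[abs_def] hess2_def[abs_def])

text \<open>
  The function $\varphi(F)\, \partial_i F / (\Gamma + e)$, called \<open>g i\<close> in the proof, has partial
  derivative \<open>h i\<close>. Weighting with $w(x_i)$ and summing over $i$ produces the left-hand integrand,
  apart from the term $\varphi(F) R$ in which the derivative hits $\Gamma$. On the other side of the
  integration by parts stands the divergence.
\<close>

lemma weighted_test_bound:
  fixes \<phi> f :: "real \<Rightarrow> real"
  assumes I: "finite I" and deg: "deg_le d b" and e: "0 < e"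
    and \<phi>: "\<And>y. (\<phi> has_real_derivative f y) (at y)" and f_cont: "continuous_on UNIV f"
    and \<phi>_bound: "\<And>y. \<bar>\<phi> y\<bar> \<le> C" and f_bound: "\<And>y. \<bar>f y\<bar> \<le> 1"
  shows "\<bar>\<integral>x. f (mlin c I b x) * (wgrad2 I b x / (wgrad2 I b x + e)) \<partial>samples I\<bar>
    \<le> C / e * (3 + (\<integral>x. (divergence I b x)\<^sup>2 \<partial>samples I) + (\<Sum>i\<in>I. moment2 I (der i b))
        + (\<Sum>i\<in>I. \<Sum>j\<in>I. moment2 I (der j (der i b))))"
proof -
  interpret S: prob_space "samples I" by (rule prob_space_Pi)
  let ?F = "mlin c I b" and ?B = "\<lambda>i. mlin c I (der i b)" and ?G = "wgrad2 I b"
  define h where "h i x = f (?F x) * (?B i x)\<^sup>2 / (?G x + e) - \<phi> (?F x) * ?B i x * wgrad2_partial I b i x / (?G x + e)\<^sup>2" for i x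
  define g where "g i x = \<phi> (?F x) * ?B i x / (?G x + e)" for i x
  define R where "R x = (\<Sum>i\<in>I. w (x i) * ?B i x * wgrad2_partial I b i x) / (?G x + e)\<^sup>2" for x
  define Q where "Q x = 2 + grad2 I b x + hess2 I b x" for x
  have C: "0 \<le> C" using \<phi>_bound[of 0] by linarith
  have Ge: "0 < ?G x + e" "e \<le> ?G x + e" for x using wgrad2_nonneg[of I b x] e by auto
  have Q: "0 \<le> Q x" for x using grad2_nonneg[of I b x] hess2_nonneg[of I b x] by (simp add: Q_def)
  have Q_int: "integrable (samples I) Q"
    unfolding Q_def[abs_def] using grad2_integrable[OF I] hess2_integrable[OF I] by auto
  have \<phi>_cont: "continuous_on A \<phi>" for A
    using \<phi> by (meson DERIV_isCont continuous_at_imp_continuous_on)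
  have [measurable]: "\<phi> \<in> borel_measurable borel" "f \<in> borel_measurable borel"
    using \<phi>_cont f_cont by (auto intro: borel_measurable_continuous_onI)
  have quot: "Q x * (?G x + e) / (?G x + e)\<^sup>2 \<le> Q x / e" for x
    using Ge[of x] Q[of x] e by (simp add: power2_eq_square frac_le)
  have comp[measurable]: "(\<lambda>x. w (x i)) \<in> borel_measurable (samples I)"
    "(\<lambda>x. \<tau> (x i)) \<in> borel_measurable (samples I)"
    "wgrad2_partial I b i \<in> borel_measurable (samples I)" if "i \<in> I" for i
    using that by (auto intro: component_fun_measurable wgrad2_partial_measurable)
  have R_meas [measurable]: "R \<in> borel_measurable (samples I)"
    unfolding R_def[abs_def] by measurable
  have R_bound: "\<bar>R x\<bar> \<le> Q x / e" for x
  proof -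
    have "\<bar>R x\<bar> \<le> (\<Sum>i\<in>I. \<bar>w (x i) * ?B i x * wgrad2_partial I b i x\<bar>) / (?G x + e)\<^sup>2"
      unfolding R_def abs_divide using sum_abs by (auto intro!: divide_right_mono)
    also have "\<dots> \<le> (Q x * (?G x + e)) / (?G x + e)\<^sup>2"
      using sum_wgrad2_partial_bound[OF I e, of x b] by (intro divide_right_mono) (auto simp: Q_def mult.commute)
    finally show ?thesis using quot[of x] by linarith
  qed
  have h_int: "integrable (samples I) (\<lambda>x. h i x * w (x i))" if i: "i \<in> I" for i
  proof (rule Bochner_Integration.integrable_bound)
    show "integrable (samples I) (\<lambda>x. 1 + C * (Q x / e))" using Q_int by auto
    show "(\<lambda>x. h i x * w (x i)) \<in> borel_measurable (samples I)"
      unfolding h_def using i by measurable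
    show "AE x in samples I. norm (h i x * w (x i)) \<le> norm (1 + C * (Q x / e))"
    proof (rule AE_I2)
      fix x
      have "w (x i) * (?B i x)\<^sup>2 \<le> ?G x"
        unfolding wgrad2_def using i I w_bounds by (intro member_le_sum) auto
      then have "w (x i) * (?B i x)\<^sup>2 / (?G x + e) \<le> 1"
        using Ge[of x] e by simp
      then have 1: "\<bar>f (?F x)\<bar> * (w (x i) * (?B i x)\<^sup>2 / (?G x + e)) \<le> 1 * 1"
        using f_bound w_bounds Ge[of x] by (intro mult_mono) auto
      have "\<bar>w (x i) * ?B i x * wgrad2_partial I b i x\<bar> \<le> (\<Sum>i\<in>I. \<bar>w (x i) * ?B i x * wgrad2_partial I b i x\<bar>)"
        using i I by (intro member_le_sum) auto
      also have "\<dots> \<le> Q x * (?G x + e)"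
        using sum_wgrad2_partial_bound[OF I e, of x b] by (simp add: Q_def mult.commute)
      finally have "\<bar>w (x i) * ?B i x * wgrad2_partial I b i x\<bar> / (?G x + e)\<^sup>2 \<le> Q x / e"
        using quot[of x] divide_right_mono[of _ _ "(?G x + e)\<^sup>2"] by (meson order_trans zero_le_power2)
      then have 2: "\<bar>\<phi> (?F x)\<bar> * (\<bar>w (x i) * ?B i x * wgrad2_partial I b i x\<bar> / (?G x + e)\<^sup>2) \<le> C * (Q x / e)"
        using \<phi>_bound C by (intro mult_mono) auto
      have "\<bar>h i x * w (x i)\<bar> \<le> \<bar>f (?F x)\<bar> * (w (x i) * (?B i x)\<^sup>2 / (?G x + e))
          + \<bar>\<phi> (?F x)\<bar> * (\<bar>w (x i) * ?B i x * wgrad2_partial I b i x\<bar> / (?G x + e)\<^sup>2)"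
      proof -
        have eq: "h i x * w (x i) = f (?F x) * (w (x i) * (?B i x)\<^sup>2 / (?G x + e))
          - \<phi> (?F x) * (w (x i) * ?B i x * wgrad2_partial I b i x / (?G x + e)\<^sup>2)"
          by (simp add: h_def algebra_simps)
        have "\<bar>h i x * w (x i)\<bar> \<le> \<bar>f (?F x) * (w (x i) * (?B i x)\<^sup>2 / (?G x + e))\<bar>
          + \<bar>\<phi> (?F x) * (w (x i) * ?B i x * wgrad2_partial I b i x / (?G x + e)\<^sup>2)\<bar>"
          unfolding eq by (rule abs_triangle_ineq4)
        then show ?thesis using w_bounds(1)[of "x i"] Ge[of x] by (simp add: abs_mult)
      qed
      then show "norm (h i x * w (x i)) \<le> norm (1 + C * (Q x / e))"
        using 1 2 by simp
    qed
  qed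
  have tau_B_int: "integrable (samples I) (\<lambda>x. \<tau> (x i) * ?B i x)" if "i \<in> I" for i
    using that mlin_square_integrable[OF I] integrable_component[OF that I tau_square_integrable]
    by (intro integrable_mult_of_squares) auto
  have g_int: "integrable (samples I) (\<lambda>x. g i x * \<tau> (x i))" if i: "i \<in> I" for i
  proof (rule Bochner_Integration.integrable_bound)
    show "integrable (samples I) (\<lambda>x. C / e * (\<tau> (x i) * ?B i x))" using tau_B_int[OF i] by auto
    show "(\<lambda>x. g i x * \<tau> (x i)) \<in> borel_measurable (samples I)"
      unfolding g_def using i by measurable
    show "AE x in samples I. norm (g i x * \<tau> (x i)) \<le> norm (C / e * (\<tau> (x i) * ?B i x))"
    proof (rule AE_I2)
      fix x
      have "\<bar>\<phi> (?F x)\<bar> / (?G x + e) \<le> C / e"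
        using \<phi>_bound C Ge[of x] e by (intro frac_le) auto
      then have "\<bar>\<phi> (?F x)\<bar> / (?G x + e) * \<bar>\<tau> (x i) * ?B i x\<bar> \<le> C / e * \<bar>\<tau> (x i) * ?B i x\<bar>"
        by (intro mult_right_mono) auto
      then show "norm (g i x * \<tau> (x i)) \<le> norm (C / e * (\<tau> (x i) * ?B i x))"
        using Ge[of x] C e by (simp add: g_def abs_mult mult_ac)
    qed
  qed
  have parts: "(\<integral>x. h i x * w (x i) \<partial>samples I) = - (\<integral>x. g i x * \<tau> (x i) \<partial>samples I)" if i: "i \<in> I" for i
  proof (rule ibp_product[OF I i _ _ _ h_int[OF i] g_int[OF i]])
    fix x t
    show "((\<lambda>t. g i (x(i := t))) has_real_derivative h i (x(i := t))) (at t)"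
    proof -
      have "((\<lambda>t. \<phi> (?F (x(i := t)))) has_real_derivative f (?F (x(i := t))) * ?B i (x(i := t))) (at t)"
        by (rule DERIV_chain2[OF \<phi> mlin_deriv[OF I i]])
      note d = DERIV_divide[OF DERIV_mult[OF this DERIV_const[of "?B i x"]]
          DERIV_add[OF wgrad2_has_derivative[OF I i, of b x t] DERIV_const[of e]]]
      have "?G (x(i := t)) + e \<noteq> 0" using Ge[of "x(i := t)"] by simp
      from d[OF this] show ?thesis
        using Ge[of "x(i := t)"]
        by (simp add: g_def h_def mlin_der_upd[OF I i] power2_eq_square diff_divide_distrib mult_ac)
    qed
  next
    fix x
    have "?G (x(i := t)) + e \<noteq> 0" for t using Ge[of "x(i := t)"] by simp
    then show "continuous_on UNIV (\<lambda>t. h i (x(i := t)))"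
      unfolding h_def
      by (intro continuous_intros continuous_on_compose2[OF f_cont] continuous_on_compose2[OF \<phi>_cont[of UNIV]]
          mlin_cont[OF I i] wgrad2_cont[OF I i] wgrad2_partial_cont[OF I i]) auto
  next
    fix x
    let ?a = "\<bar>?B i x\<bar>" and ?D = "2 * (?B i x)\<^sup>2 + (\<Sum>j\<in>I. (mlin c I (der i (der j b)) x)\<^sup>2)"
    have D: "0 \<le> ?D" by (intro add_nonneg_nonneg sum_nonneg) auto
    let ?K = "?a\<^sup>2 / e + C * ?a * (?D / e\<^sup>2 + 1 / e)"
    have "\<bar>g i (x(i := t))\<bar> \<le> C * ?a / e" for t
      unfolding g_def abs_divide abs_mult mlin_der_upd[OF I i]
      using Ge[of "x(i := t)"] e \<phi>_bound C by (intro frac_le mult_mono) auto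
    moreover have "\<bar>h i (x(i := t))\<bar> \<le> ?K" for t
    proof -
      let ?y = "x(i := t)"
      have "\<bar>wgrad2_partial I b i ?y\<bar> \<le> ?D + ?G ?y"
        using wgrad2_partial_bound[OF I, of b i ?y] by (simp add: mlin_der_upd[OF I i])
      then have "\<bar>wgrad2_partial I b i ?y\<bar> / (?G ?y + e)\<^sup>2 \<le> (?D + (?G ?y + e)) / (?G ?y + e)\<^sup>2"
        using e by (intro divide_right_mono) auto
      also have "\<dots> = ?D / (?G ?y + e)\<^sup>2 + 1 / (?G ?y + e)"
      proof -
        have "(a + y) / y\<^sup>2 = a / y\<^sup>2 + 1 / y" if "0 < y" for a y :: real
          using that by (simp add: field_simps power2_eq_square)
        then show ?thesis using Ge(1)[of ?y] by blast
      qed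
      also have "\<dots> \<le> ?D / e\<^sup>2 + 1 / e"
        using Ge[of ?y] e D by (intro add_mono frac_le power_mono) auto
      finally have dg: "\<bar>wgrad2_partial I b i ?y\<bar> / (?G ?y + e)\<^sup>2 \<le> ?D / e\<^sup>2 + 1 / e" .
      have "\<bar>h i ?y\<bar> \<le> \<bar>f (?F ?y) * (?B i ?y)\<^sup>2 / (?G ?y + e)\<bar> + \<bar>\<phi> (?F ?y) * ?B i ?y * wgrad2_partial I b i ?y / (?G ?y + e)\<^sup>2\<bar>"
        unfolding h_def by (rule abs_triangle_ineq4)
      moreover have "\<bar>f (?F ?y) * (?B i ?y)\<^sup>2 / (?G ?y + e)\<bar> \<le> 1 * ?a\<^sup>2 / e"
        unfolding abs_divide abs_mult mlin_der_upd[OF I i]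
        using Ge[of ?y] e f_bound by (intro frac_le mult_mono) auto
      moreover have "\<bar>\<phi> (?F ?y) * ?B i ?y * wgrad2_partial I b i ?y / (?G ?y + e)\<^sup>2\<bar>
          = (\<bar>\<phi> (?F ?y)\<bar> * ?a) * (\<bar>wgrad2_partial I b i ?y\<bar> / (?G ?y + e)\<^sup>2)"
        unfolding abs_divide abs_mult mlin_der_upd[OF I i] by simp
      moreover have "(\<bar>\<phi> (?F ?y)\<bar> * ?a) * (\<bar>wgrad2_partial I b i ?y\<bar> / (?G ?y + e)\<^sup>2) \<le> (C * ?a) * (?D / e\<^sup>2 + 1 / e)"
        using dg \<phi>_bound C by (intro mult_mono) auto
      ultimately show ?thesis by linarith
    qed
    ultimately show "\<exists>C. \<forall>t. \<bar>g i (x(i := t))\<bar> \<le> C \<and> \<bar>h i (x(i := t))\<bar> \<le> C"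
      by (intro exI[of _ "max (C * ?a / e) ?K"]) (auto simp: le_max_iff_disj)
  qed
  have split: "f (?F x) * (?G x / (?G x + e)) = (\<Sum>i\<in>I. h i x * w (x i)) + \<phi> (?F x) * R x" for x
  proof -
    have "(\<Sum>i\<in>I. h i x * w (x i)) = (\<Sum>i\<in>I. f (?F x) * (w (x i) * (?B i x)\<^sup>2) / (?G x + e)
       - \<phi> (?F x) * (w (x i) * ?B i x * wgrad2_partial I b i x) / (?G x + e)\<^sup>2)"
    proof (rule sum.cong[OF refl])
      have alg: "(p * q / r - p' * b' * q' / r') * u = p * (u * q) / r - p' * (u * b' * q') / r'" for p q r p' b' q' r' u :: real
        by (simp add: algebra_simps)
      show "h i x * w (x i) = f (?F x) * (w (x i) * (?B i x)\<^sup>2) / (?G x + e)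
       - \<phi> (?F x) * (w (x i) * ?B i x * wgrad2_partial I b i x) / (?G x + e)\<^sup>2" for i
        unfolding h_def by (rule alg)
    qed
    also have "\<dots> = f (?F x) * (\<Sum>i\<in>I. w (x i) * (?B i x)\<^sup>2) / (?G x + e) - \<phi> (?F x) * R x"
      by (simp add: R_def sum_subtractf sum_distrib_left sum_divide_distrib)
    finally show ?thesis by (simp add: wgrad2_def)
  qed
  have \<phi>R_int: "integrable (samples I) (\<lambda>x. \<phi> (?F x) * R x)"
  proof (rule Bochner_Integration.integrable_bound)
    show "integrable (samples I) (\<lambda>x. C * (Q x / e))" using Q_int by auto
    show "AE x in samples I. norm (\<phi> (?F x) * R x) \<le> norm (C * (Q x / e))"
    proof (rule AE_I2)
      fix x
      have "\<bar>\<phi> (?F x)\<bar> * \<bar>R x\<bar> \<le> C * (Q x / e)"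
        using \<phi>_bound R_bound C by (intro mult_mono) auto
      then show "norm (\<phi> (?F x) * R x) \<le> norm (C * (Q x / e))"
        using C Q[of x] e by (simp add: abs_mult)
    qed
  qed measurable
  have divergence_int: "integrable (samples I) (\<lambda>x. \<bar>divergence I b x\<bar>)"
    using integrable_mult_of_squares[of "divergence I b" "samples I" "\<lambda>_. 1"] divergence_square_integrable[OF I deg] by auto
  have g_sum: "(\<Sum>i\<in>I. g i x * \<tau> (x i)) = \<phi> (?F x) * divergence I b x / (?G x + e)" for x
    by (simp add: g_def divergence_def sum_distrib_left sum_divide_distrib mult_ac)
  have "(\<integral>x. f (?F x) * (?G x / (?G x + e)) \<partial>samples I)
      = (\<Sum>i\<in>I. \<integral>x. h i x * w (x i) \<partial>samples I) + (\<integral>x. \<phi> (?F x) * R x \<partial>samples I)"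
    unfolding split using h_int \<phi>R_int by simp
  moreover have "(\<Sum>i\<in>I. \<integral>x. h i x * w (x i) \<partial>samples I) = - (\<integral>x. (\<Sum>i\<in>I. g i x * \<tau> (x i)) \<partial>samples I)"
    using parts g_int by (simp add: sum_negf)
  ultimately have main: "\<bar>\<integral>x. f (?F x) * (?G x / (?G x + e)) \<partial>samples I\<bar>
      \<le> \<bar>\<integral>x. (\<Sum>i\<in>I. g i x * \<tau> (x i)) \<partial>samples I\<bar> + \<bar>\<integral>x. \<phi> (?F x) * R x \<partial>samples I\<bar>"
    by linarith
  have b1: "\<bar>\<integral>x. (\<Sum>i\<in>I. g i x * \<tau> (x i)) \<partial>samples I\<bar> \<le> (\<integral>x. C / e * (1 + (divergence I b x)\<^sup>2) \<partial>samples I)"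
  proof (rule integral_abs_bound[THEN order_trans], rule integral_mono)
    show "integrable (samples I) (\<lambda>x. \<bar>\<Sum>i\<in>I. g i x * \<tau> (x i)\<bar>)" using g_int by auto
    show "integrable (samples I) (\<lambda>x. C / e * (1 + (divergence I b x)\<^sup>2))"
      using divergence_square_integrable[OF I deg] by auto
    fix x
    have "\<bar>\<phi> (?F x)\<bar> / (?G x + e) \<le> C / e"
      using \<phi>_bound C Ge[of x] e by (intro frac_le) auto
    moreover have "\<bar>divergence I b x\<bar> \<le> 1 + (divergence I b x)\<^sup>2"
      using sum_squares_bound[of 1 "\<bar>divergence I b x\<bar>"] by simp
    ultimately have "\<bar>\<phi> (?F x)\<bar> / (?G x + e) * \<bar>divergence I b x\<bar> \<le> C / e * (1 + (divergence I b x)\<^sup>2)"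
      using C e by (intro mult_mono) auto
    then show "\<bar>\<Sum>i\<in>I. g i x * \<tau> (x i)\<bar> \<le> C / e * (1 + (divergence I b x)\<^sup>2)"
      unfolding g_sum using Ge[of x] by (simp add: abs_mult)
  qed
  have b2: "(\<integral>x. C / e * (1 + (divergence I b x)\<^sup>2) \<partial>samples I) = C / e * (1 + (\<integral>x. (divergence I b x)\<^sup>2 \<partial>samples I))"
    using divergence_square_integrable[OF I deg] by (simp add: S.prob_space)
  have b3: "\<bar>\<integral>x. \<phi> (?F x) * R x \<partial>samples I\<bar> \<le> (\<integral>x. C / e * Q x \<partial>samples I)"
  proof (rule integral_abs_bound[THEN order_trans], rule integral_mono)
    show "integrable (samples I) (\<lambda>x. \<bar>\<phi> (?F x) * R x\<bar>)" using \<phi>R_int by auto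
    show "integrable (samples I) (\<lambda>x. C / e * Q x)" using Q_int by auto
    fix x
    have "\<bar>\<phi> (?F x)\<bar> * \<bar>R x\<bar> \<le> C * (Q x / e)"
      using \<phi>_bound R_bound C by (intro mult_mono) auto
    then show "\<bar>\<phi> (?F x) * R x\<bar> \<le> C / e * Q x" by (simp add: abs_mult)
  qed
  have b4: "(\<integral>x. C / e * Q x \<partial>samples I) = C / e * (2 + (\<Sum>i\<in>I. moment2 I (der i b))
        + (\<Sum>i\<in>I. \<Sum>j\<in>I. moment2 I (der j (der i b))))"
    using grad2_integrable[OF I, of b] hess2_integrable[OF I, of b] grad2_integral[OF I, of b] hess2_integral[OF I, of b]
    by (simp add: Q_def S.prob_space)
  have alg: "q * (3 + A + B + D) = q * (1 + A) + q * (2 + B + D)" for q A B D :: real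
    by (simp add: algebra_simps)
  from main b1 b3 show ?thesis unfolding b2 b4 alg by linarith
qed

section \<open>Small balls and smooth laws by induction on the degree\<close>

text \<open>
  In both bounds the constant depends on the degree but not on the number of variables.
\<close>

definition small_ball_bound :: "nat \<Rightarrow> real \<Rightarrow> real \<Rightarrow> bool" where
  "small_ball_bound d \<kappa> \<eta> \<longleftrightarrow> (\<forall>I b. finite I \<longrightarrow> deg_le d b \<longrightarrow> 0 < moment2 I b \<longrightarrow>
     measure (samples I) {x \<in> space (samples I). (mlin c I b x)\<^sup>2 \<le> \<kappa> * moment2 I b} \<le> \<eta>)"

definition small_balls :: "nat \<Rightarrow> bool" where
  "small_balls d \<longleftrightarrow> (\<forall>\<eta>>0. \<exists>\<kappa>>0. small_ball_bound d \<kappa> \<eta>)"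

definition smooth_law_bound :: "nat \<Rightarrow> real \<Rightarrow> real \<Rightarrow> bool" where
  "smooth_law_bound d K \<eta> \<longleftrightarrow> (\<forall>I b. finite I \<longrightarrow> deg_le d b \<longrightarrow> mlin_var I b = 1 \<longrightarrow>
     almost_smooth K \<eta> (distr (samples I) borel (mlin c I b)))"

definition smooth_laws :: "nat \<Rightarrow> bool" where
  "smooth_laws d \<longleftrightarrow> (\<forall>\<eta>>0. \<exists>K\<ge>0. smooth_law_bound d K \<eta>)"

lemma integral_mlin_law:
  "continuous_on UNIV f \<Longrightarrow> (\<integral>x. f x \<partial>distr (samples I) borel (mlin c I b)) = (\<integral>x. f (mlin c I b x) \<partial>samples I)"
  for f :: "real \<Rightarrow> real"
  by (intro integral_distr borel_measurable_continuous_onI) auto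

text \<open>
  A polynomial of degree 0 is a constant, whose square is its second moment.
\<close>

lemma small_balls_0: "small_balls 0"
  unfolding small_balls_def small_ball_bound_def
proof (intro allI impI exI[of _ "1/2"] conjI)
  fix \<eta> :: real and I b
  assume "0 < \<eta>" and I: "finite I" and deg: "deg_le 0 b" and pos: "0 < moment2 I b"
  have b0: "b U = 0" if "U \<in> Pow I - {{}}" for U
  proof -
    have "finite U" using that I finite_subset by auto
    then have "0 < card U" using that by (auto simp: card_gt_0_iff)
    then show ?thesis using deg by (simp add: deg_le_def)
  qed
  have "mlin_var I b = 0" unfolding mlin_var_def using b0 by (intro sum.neutral) auto
  then have en: "moment2 I b = (b {})\<^sup>2" using moment2_eq[OF I, of b] by simp
  have "mlin c I b x = b {}" for x
  proof -
    have "mlin c I b x = b {} + (\<Sum>S\<in>Pow I - {{}}. b S * (\<Prod>i\<in>S. x i - c))"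
      using I by (simp add: mlin_def sum.remove[of "Pow I" "{}"])
    also have "(\<Sum>S\<in>Pow I - {{}}. b S * (\<Prod>i\<in>S. x i - c)) = 0"
      using b0 by (intro sum.neutral) auto
    finally show ?thesis by simp
  qed
  then have "{x \<in> space (samples I). (mlin c I b x)\<^sup>2 \<le> 1/2 * moment2 I b} = {}"
    using pos en by auto
  then show "measure (samples I) {x \<in> space (samples I). (mlin c I b x)\<^sup>2 \<le> 1/2 * moment2 I b} \<le> \<eta>"
    using \<open>0 < \<eta>\<close> by (metis less_imp_le measure_empty)
qed simp

lemma small_weight:
  assumes "0 < \<eta>"
  obtains s where "0 < s" "measure \<mu> {t. w t \<le> s} \<le> \<eta>"
proof -
  let ?A = "\<lambda>n::nat. {t. w t \<le> 1 / real (Suc n)}"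
  have dec: "decseq ?A"
    by (intro decseq_SucI Collect_mono impI) (erule order_trans, simp add: frac_le)
  have int: "(\<Inter>n. ?A n) = {t. w t \<le> 0}"
  proof safe
    fix t assume *: "t \<in> (\<Inter>n. ?A n)"
    show "w t \<le> 0"
    proof (rule ccontr)
      assume "\<not> w t \<le> 0"
      then obtain n where "inverse (real (Suc n)) < w t" using reals_Archimedean[of "w t"] by auto
      moreover have "w t \<le> 1 / real (Suc n)" using * by blast
      ultimately show False by (simp add: inverse_eq_divide)
    qed
  next
    fix t n assume "w t \<le> 0"
    moreover have "0 \<le> 1 / real (Suc n)" by simp
    ultimately show "w t \<le> 1 / real (Suc n)" by linarith
  qed
  have "(\<lambda>n. measure \<mu> (?A n)) \<longlonglongrightarrow> measure \<mu> (\<Inter>n. ?A n)"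
    using dec by (intro finite_Lim_measure_decseq) auto
  also have "measure \<mu> (\<Inter>n. ?A n) = 0"
  proof -
    have "AE t in \<mu>. t \<notin> {t. w t \<le> 0}" using w_pos by auto
    then show ?thesis unfolding int by (subst prob_eq_0) auto
  qed
  finally have "eventually (\<lambda>n. measure \<mu> (?A n) < \<eta>) sequentially"
    using assms by (rule order_tendstoD(2))
  then obtain n where "measure \<mu> (?A n) < \<eta>" by (auto simp: eventually_sequentially)
  then show thesis by (intro that[of "1 / real (Suc n)"]) auto
qed

lemma measure_component:
  assumes "i \<in> I" "finite I" and A: "A \<in> sets borel"
  shows "measure (samples I) {x \<in> space (samples I). x i \<in> A} = measure \<mu> A"
proof -
  have "measure \<mu> A = (\<integral>t. indicator A t \<partial>\<mu>)" using A by simp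
  also have "\<dots> = (\<integral>x. indicator A (x i) \<partial>samples I)"
  proof -
    have "(\<integral>x. (\<Prod>k\<in>I. (if k = i then indicator A else (\<lambda>_. 1)) (x k)) \<partial>samples I)
        = (\<Prod>k\<in>I. \<integral>t. (if k = i then indicator A else (\<lambda>_. 1)) t \<partial>\<mu> :: real)"
      using A assms by (intro smp.product_integral_prod) (auto simp: emeasure_eq_measure)
    moreover have "(\<Prod>k\<in>I. (if k = i then indicator A else (\<lambda>_. 1)) (x k)) = (indicator A (x i) :: real)" for x :: "nat \<Rightarrow> real"
      using assms by (simp add: if_distrib[where f="\<lambda>f. f _"] prod.delta cong: if_cong)
    moreover have "(\<Prod>k\<in>I. \<integral>t. (if k = i then indicator A else (\<lambda>_. 1)) t \<partial>\<mu>) = (\<integral>t. indicator A t \<partial>\<mu> :: real)"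
    proof -
      have "(\<Prod>k\<in>I. \<integral>t. (if k = i then indicator A else (\<lambda>_. 1)) t \<partial>\<mu>) = (\<Prod>k\<in>I. if k = i then (\<integral>t. indicator A t \<partial>\<mu> :: real) else 1)"
        by (intro prod.cong refl) auto
      then show ?thesis using assms by (simp add: prod.delta)
    qed
    ultimately show ?thesis by simp
  qed
  also have "\<dots> = (\<integral>x. indicator {x \<in> space (samples I). x i \<in> A} x \<partial>samples I)"
    by (intro Bochner_Integration.integral_cong) (auto simp: indicator_def)
  also have "\<dots> = measure (samples I) {x \<in> space (samples I). x i \<in> A}"
  proof -
    have [measurable]: "(\<lambda>x. x i) \<in> borel_measurable (samples I)" by (rule component_measurable[OF assms(1)])
    have "{x \<in> space (samples I). x i \<in> A} \<in> sets (samples I)" using A by measurable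
    then show ?thesis by simp
  qed
  finally show ?thesis by simp
qed

text \<open>
  Give variable $i$ the weight $E_i = E(\partial_i F)^2$. A small value of $\Gamma$ means that the
  variables whose term $w(x_i) (\partial_i F)^2$ is small compared with $E_i$ carry at least half of
  the total weight. By Markov's inequality the probability of this is at most twice the largest
  probability that a single term is small, for which either $w(x_i)$ or the polynomial $\partial_i F$
  of lower degree must be small. The Poincare inequality keeps the total weight away from zero.
\<close>

lemma wgrad2_small_ball:
  assumes sb: "small_balls d" and \<eta>: "0 < \<eta>"
  obtains \<kappa> where "0 < \<kappa>"
    "\<And>I b. finite I \<Longrightarrow> deg_le (Suc d) b \<Longrightarrow> mlin_var I b = 1 \<Longrightarrow>
       measure (samples I) {x \<in> space (samples I). wgrad2 I b x \<le> \<kappa>} \<le> \<eta>"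
proof -
  have "0 < \<eta> / 4" using \<eta> by simp
  then obtain k where k: "0 < k" "small_ball_bound d k (\<eta> / 4)"
    using sb unfolding small_balls_def by blast
  obtain s where s: "0 < s" "measure \<mu> {t. w t \<le> s} \<le> \<eta> / 4"
    using small_weight[of "\<eta> / 4"] \<eta> by auto
  define \<kappa> where "\<kappa> = s * k / (2 * v)"
  have "measure (samples I) {x \<in> space (samples I). wgrad2 I b x \<le> \<kappa>} \<le> \<eta>"
    if I: "finite I" and deg: "deg_le (Suc d) b" and one: "mlin_var I b = 1" for I b
  proof -
    interpret S: prob_space "samples I" by (rule prob_space_Pi)
    define E where "E i = moment2 I (der i b)" for i
    define Et where "Et = (\<Sum>i\<in>I. E i)"
    define bad where "bad i = {x \<in> space (samples I). w (x i) * (mlin c I (der i b) x)\<^sup>2 \<le> s * (k * E i)}" for i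
    let ?A = "{x \<in> space (samples I). wgrad2 I b x \<le> \<kappa>}"
    have E: "0 \<le> E i" for i by (simp add: E_def moment2_nonneg)
    have Et: "1 / v \<le> Et" using mlin_var_le_sum_moment2_der[OF I, of b] one v_pos
      by (simp add: E_def Et_def divide_le_eq mult.commute)
    then have Et_pos: "0 < Et" using v_pos by (meson less_le_trans zero_less_divide_1_iff)
    have bad_sets: "bad i \<in> sets (samples I)" if "i \<in> I" for i
    proof -
      have [measurable]: "(\<lambda>x. w (x i)) \<in> borel_measurable (samples I)"
        using that by (intro component_fun_measurable) auto
      show ?thesis unfolding bad_def by measurable
    qed
    have A_sets: "?A \<in> sets (samples I)" by measurable
    have bad_prob: "E i * S.prob (bad i) \<le> E i * (\<eta> / 2)" if i: "i \<in> I" for i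
    proof (cases "E i = 0")
      case False
      then have Ei: "0 < E i" using E[of i] by simp
      let ?W = "{x \<in> space (samples I). x i \<in> {t. w t \<le> s}}"
      let ?B = "{x \<in> space (samples I). (mlin c I (der i b) x)\<^sup>2 \<le> k * E i}"
      have [measurable]: "(\<lambda>x. x i) \<in> borel_measurable (samples I)" by (rule component_measurable[OF i])
      have W: "?W \<in> sets (samples I)" by measurable
      have B: "?B \<in> sets (samples I)" by measurable
      have "bad i \<subseteq> ?W \<union> ?B"
      proof
        fix x assume x: "x \<in> bad i"
        show "x \<in> ?W \<union> ?B"
        proof (rule ccontr)
          assume "x \<notin> ?W \<union> ?B"
          then have "s < w (x i)" "k * E i < (mlin c I (der i b) x)\<^sup>2" using x by (auto simp: bad_def)
          then have "s * (k * E i) < w (x i) * (mlin c I (der i b) x)\<^sup>2"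
            using s k Ei by (intro mult_strict_mono) auto
          then show False using x by (simp add: bad_def)
        qed
      qed
      then have "S.prob (bad i) \<le> S.prob (?W \<union> ?B)"
        using W B by (intro S.finite_measure_mono) auto
      also have "\<dots> \<le> S.prob ?W + S.prob ?B"
        using W B by (rule measure_Un_le)
      also have "S.prob ?W \<le> \<eta> / 4"
        using measure_component[OF i I, of "{t. w t \<le> s}"] s(2) by simp
      also have "S.prob ?B \<le> \<eta> / 4"
        using k(2) I deg_le_der[OF deg] Ei unfolding small_ball_bound_def E_def by blast
      finally show ?thesis using E[of i] by (intro mult_left_mono) auto
    qed simp
    (* The indices outside the bad set contribute at least s k times their weight to Gamma. *)
    have point: "Et / 2 * indicator ?A x \<le> (\<Sum>i\<in>I. E i * indicator (bad i) x)" if x: "x \<in> space (samples I)" for x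
    proof (cases "x \<in> ?A")
      case True
      have "s * k * (\<Sum>i\<in>I. E i - E i * indicator (bad i) x) = (\<Sum>i\<in>I. s * k * (E i - E i * indicator (bad i) x))"
        by (rule sum_distrib_left)
      also have "\<dots> \<le> wgrad2 I b x"
        unfolding wgrad2_def
      proof (rule sum_mono)
        fix i assume "i \<in> I"
        show "s * k * (E i - E i * indicator (bad i) x) \<le> w (x i) * (mlin c I (der i b) x)\<^sup>2"
          using x w_bounds(1)[of "x i"] by (cases "x \<in> bad i") (auto simp: bad_def)
      qed
      also have "\<dots> \<le> s * k / (2 * v)" using True by (simp add: \<kappa>_def)
      also have "\<dots> = s * k * (1 / v / 2)" by simp
      also have "\<dots> \<le> s * k * (Et / 2)" using s k Et by (intro mult_left_mono) auto
      finally have "(\<Sum>i\<in>I. E i - E i * indicator (bad i) x) \<le> Et / 2"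
        using s k by (simp add: mult_le_cancel_left_pos)
      then show ?thesis using True by (simp add: sum_subtractf Et_def)
    next
      case False
      then show ?thesis using E by (auto intro!: sum_nonneg mult_nonneg_nonneg)
    qed
    have "Et / 2 * S.prob ?A = (\<integral>x. Et / 2 * indicator ?A x \<partial>samples I)"
      using A_sets by simp
    also have "\<dots> \<le> (\<integral>x. (\<Sum>i\<in>I. E i * indicator (bad i) x) \<partial>samples I)"
      using A_sets bad_sets point by (intro integral_mono) (auto simp: S.emeasure_eq_measure)
    also have "\<dots> = (\<Sum>i\<in>I. E i * S.prob (bad i))"
      using bad_sets by (subst Bochner_Integration.integral_sum) (auto simp: S.emeasure_eq_measure)
    also have "\<dots> \<le> (\<Sum>i\<in>I. E i * (\<eta> / 2))"
      by (intro sum_mono bad_prob)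
    also have "\<dots> = Et / 2 * \<eta>" unfolding Et_def sum_distrib_right[symmetric] by simp
    finally show ?thesis using Et_pos by (simp add: mult_le_cancel_left_pos)
  qed
  moreover have "0 < \<kappa>" using s k v_pos by (simp add: \<kappa>_def)
  ultimately show thesis using that by blast
qed

text \<open>
  Writing $1 = \Gamma/(\Gamma+e) + e/(\Gamma+e)$, integration by parts handles the first part. The
  second is at most $1$ where $\Gamma \leq \kappa$, which is a rare event, and at most $e/\kappa$
  elsewhere.
\<close>

lemma smooth_laws_Suc:
  assumes "small_balls d"
  shows "smooth_laws (Suc d)"
  unfolding smooth_laws_def
proof (intro allI impI)
  fix \<eta> :: real assume \<eta>: "0 < \<eta>"
  obtain \<kappa> where \<kappa>: "0 < \<kappa>" "\<And>I b. finite I \<Longrightarrow> deg_le (Suc d) b \<Longrightarrow> mlin_var I b = 1 \<Longrightarrow>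
       measure (samples I) {x \<in> space (samples I). wgrad2 I b x \<le> \<kappa>} \<le> \<eta> / 2"
    using wgrad2_small_ball[OF assms, of "\<eta> / 2"] \<eta> by auto
  define e where "e = \<kappa> * (\<eta> / 2)"
  define D where "D = real (Suc d)"
  define K where "K = (3 + tau_norm2 * D\<^sup>2 / v + D / v + D\<^sup>2 / v\<^sup>2) / e"
  have e: "0 < e" using \<kappa> \<eta> by (simp add: e_def)
  have K: "0 \<le> K" using tau_norm2_nonneg v_pos e by (simp add: K_def D_def)
  show "\<exists>K\<ge>0. smooth_law_bound (Suc d) K \<eta>"
    unfolding smooth_law_bound_def almost_smooth_def
  proof (intro exI[of _ K] conjI K allI impI)
    fix I b and \<phi> f :: "real \<Rightarrow> real" and C
    assume I: "finite I" and deg: "deg_le (Suc d) b" and one: "mlin_var I b = 1"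
      and \<phi>: "\<forall>y. (\<phi> has_real_derivative f y) (at y)" and f_cont: "continuous_on UNIV f"
      and \<phi>b: "\<forall>y. \<bar>\<phi> y\<bar> \<le> C" and fb: "\<forall>y. \<bar>f y\<bar> \<le> 1"
    interpret S: prob_space "samples I" by (rule prob_space_Pi)
    let ?F = "mlin c I b" and ?G = "wgrad2 I b"
    let ?A = "{x \<in> space (samples I). ?G x \<le> \<kappa>}"
    have [measurable]: "f \<in> borel_measurable borel" using f_cont by (rule borel_measurable_continuous_onI)
    have C: "0 \<le> C" using \<phi>b by (metis abs_ge_zero order_trans)
    have A_sets: "?A \<in> sets (samples I)" by measurable
    have Ge: "0 < ?G x + e" for x using wgrad2_nonneg[of I b x] e by simp
    have int1: "integrable (samples I) (\<lambda>x. f (?F x) * (?G x / (?G x + e)))"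
    proof (rule S.integrable_const_bound[where B=1])
      show "AE x in samples I. norm (f (?F x) * (?G x / (?G x + e))) \<le> 1"
      proof (rule AE_I2)
        fix x
        have "\<bar>f (?F x)\<bar> * (?G x / (?G x + e)) \<le> 1 * 1"
          using fb Ge[of x] wgrad2_nonneg[of I b x] e by (intro mult_mono) auto
        then show "norm (f (?F x) * (?G x / (?G x + e))) \<le> 1"
          using Ge[of x] wgrad2_nonneg[of I b x] by (simp add: abs_mult)
      qed
    qed measurable
    have int2: "integrable (samples I) (\<lambda>x. f (?F x) * (e / (?G x + e)))"
    proof (rule S.integrable_const_bound[where B=1])
      show "AE x in samples I. norm (f (?F x) * (e / (?G x + e))) \<le> 1"
      proof (rule AE_I2)
        fix x
        have "\<bar>f (?F x)\<bar> * (e / (?G x + e)) \<le> 1 * 1"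
          using fb Ge[of x] wgrad2_nonneg[of I b x] e by (intro mult_mono) auto
        then show "norm (f (?F x) * (e / (?G x + e))) \<le> 1"
          using Ge[of x] e by (simp add: abs_mult)
      qed
    qed measurable
    have "(\<integral>x. f (?F x) \<partial>samples I) = (\<integral>x. f (?F x) * (?G x / (?G x + e)) + f (?F x) * (e / (?G x + e)) \<partial>samples I)"
    proof (rule Bochner_Integration.integral_cong[OF refl])
      fix x
      have "?G x / (?G x + e) + e / (?G x + e) = 1" using Ge[of x] by (simp add: add_divide_distrib[symmetric])
      then show "f (?F x) = f (?F x) * (?G x / (?G x + e)) + f (?F x) * (e / (?G x + e))"
        by (metis distrib_left mult.right_neutral)
    qed
    also have "\<dots> = (\<integral>x. f (?F x) * (?G x / (?G x + e)) \<partial>samples I) + (\<integral>x. f (?F x) * (e / (?G x + e)) \<partial>samples I)"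
      using int1 int2 by simp
    finally have split: "\<bar>\<integral>x. f (?F x) \<partial>samples I\<bar> \<le> \<bar>\<integral>x. f (?F x) * (?G x / (?G x + e)) \<partial>samples I\<bar>
        + \<bar>\<integral>x. f (?F x) * (e / (?G x + e)) \<partial>samples I\<bar>" by simp
    have first: "\<bar>\<integral>x. f (?F x) * (?G x / (?G x + e)) \<partial>samples I\<bar> \<le> K * C"
    proof -
      have 1: "(\<integral>x. (divergence I b x)\<^sup>2 \<partial>samples I) \<le> tau_norm2 * D\<^sup>2 / v"
        using divergence_square_integral[OF I deg] one v_pos by (simp add: D_def pos_le_divide_eq mult.commute)
      have 2: "(\<Sum>i\<in>I. moment2 I (der i b)) \<le> D / v"
        using sum_moment2_der_le[OF I deg] one v_pos by (simp add: D_def pos_le_divide_eq mult.commute)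
      have 3: "(\<Sum>i\<in>I. \<Sum>j\<in>I. moment2 I (der j (der i b))) \<le> D\<^sup>2 / v\<^sup>2"
        using sum_moment2_der_der_le[OF I deg] one v_pos by (simp add: D_def pos_le_divide_eq mult.commute)
      have "\<bar>\<integral>x. f (?F x) * (?G x / (?G x + e)) \<partial>samples I\<bar> \<le> C / e * (3 + (\<integral>x. (divergence I b x)\<^sup>2 \<partial>samples I)
        + (\<Sum>i\<in>I. moment2 I (der i b)) + (\<Sum>i\<in>I. \<Sum>j\<in>I. moment2 I (der j (der i b))))"
        using \<phi> f_cont \<phi>b fb by (intro weighted_test_bound[OF I deg e]) auto
      also have "\<dots> \<le> C / e * (3 + tau_norm2 * D\<^sup>2 / v + D / v + D\<^sup>2 / v\<^sup>2)"
        using 1 2 3 C e by (intro mult_left_mono add_mono) auto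
      also have "\<dots> = K * C" by (simp add: K_def)
      finally show ?thesis .
    qed
    have second: "\<bar>\<integral>x. f (?F x) * (e / (?G x + e)) \<partial>samples I\<bar> \<le> \<eta>"
    proof -
      have "\<bar>\<integral>x. f (?F x) * (e / (?G x + e)) \<partial>samples I\<bar> \<le> (\<integral>x. indicator ?A x + \<eta> / 2 \<partial>samples I)"
      proof (rule integral_abs_bound[THEN order_trans], rule integral_mono)
        show "integrable (samples I) (\<lambda>x. \<bar>f (?F x) * (e / (?G x + e))\<bar>)" by (rule integrable_abs[OF int2])
        show "integrable (samples I) (\<lambda>x. indicator ?A x + \<eta> / 2)"
          using A_sets by (auto simp: S.emeasure_eq_measure)
        fix x assume x: "x \<in> space (samples I)"
        have "e / (?G x + e) \<le> indicator ?A x + \<eta> / 2"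
        proof (cases "?G x \<le> \<kappa>")
          case True
          have "e / (?G x + e) \<le> 1" using Ge[of x] wgrad2_nonneg[of I b x] by simp
          then show ?thesis using True x \<eta> by simp
        next
          case False
          then have "e / (?G x + e) \<le> e / \<kappa>" using e \<kappa> by (intro frac_le) auto
          also have "\<dots> = \<eta> / 2" using \<kappa> by (simp add: e_def)
          finally show ?thesis using False by simp
        qed
        moreover have "\<bar>f (?F x)\<bar> * (e / (?G x + e)) \<le> 1 * (e / (?G x + e))"
          using fb Ge[of x] e by (intro mult_right_mono) auto
        ultimately show "\<bar>f (?F x) * (e / (?G x + e))\<bar> \<le> indicator ?A x + \<eta> / 2"
          using Ge[of x] e by (simp add: abs_mult)
      qed
      also have "\<dots> = S.prob ?A + \<eta> / 2"
        using A_sets by (simp add: S.prob_space S.emeasure_eq_measure)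
      finally show ?thesis using \<kappa>(2)[OF I deg one] by linarith
    qed
    show "\<bar>\<integral>y. f y \<partial>distr (samples I) borel ?F\<bar> \<le> K * C + \<eta>"
      using split first second integral_mlin_law[OF f_cont, of I b] by linarith
  qed
qed

lemma mlin_scale: "mlin c I (\<lambda>S. a * b S) x = a * mlin c I b x"
  by (simp add: mlin_def sum_distrib_left mult_ac)

lemma mlin_var_scale: "mlin_var I (\<lambda>S. a * b S) = a\<^sup>2 * mlin_var I b"
  by (simp add: mlin_var_def sum_distrib_left power_mult_distrib mult_ac)

lemma mlin_var_normalise:
  assumes "0 < mlin_var I b"
  shows "mlin_var I (\<lambda>S. 1 / sqrt (mlin_var I b) * b S) = 1"
  using assms unfolding mlin_var_scale by (simp add: power_divide)

lemma deg_le_scale: "deg_le d b \<Longrightarrow> deg_le d (\<lambda>S. a * b S)"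
  by (simp add: deg_le_def)

lemma chebyshev_mlin:
  assumes I: "finite I" and "0 < s"
  shows "measure (samples I) {x \<in> space (samples I). s \<le> (mlin c I b x - b {})\<^sup>2} \<le> mlin_var I b / s"
  using integral_Markov_inequality_measure[of "samples I" "\<lambda>x. (mlin c I b x - b {})\<^sup>2" "space (samples I)" s]
    mlin_variance_integrable[OF I, of b] mlin_variance[OF I, of b] assms(2)
  by simp

text \<open>
  If the variance is a negligible part of the second moment, the polynomial is close to a large
  constant and Chebyshev's inequality applies. Otherwise it can be normalised to variance 1, and the
  primitive $r \arctan(y/r)$ of $1/(1 + (y/r)^2)$ shows that an interval of length of order $r$ has
  probability of order $K r + \eta$.
\<close>

lemma small_balls_of_smooth_laws:
  assumes "smooth_laws d"
  shows "small_balls d"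
  unfolding small_balls_def
proof (intro allI impI)
  fix \<eta> :: real assume \<eta>: "0 < \<eta>"
  have "0 < \<eta> / 4" using \<eta> by simp
  then obtain K where K: "0 \<le> K" "smooth_law_bound d K (\<eta> / 4)"
    using assms unfolding smooth_laws_def by blast
  define r where "r = \<eta> / (8 * (K + 1))"
  define \<beta> where "\<beta> = min (\<eta> / 16) 1 / 2"
  define \<kappa> where "\<kappa> = min (1 / 16) (\<beta> * r\<^sup>2)"
  have r: "0 < r" using \<eta> K by (simp add: r_def)
  have \<beta>: "0 < \<beta>" "\<beta> \<le> 1 / 2" "16 * \<beta> \<le> \<eta>" using \<eta> by (auto simp: \<beta>_def)
  have \<kappa>: "0 < \<kappa>" using \<beta> r by (simp add: \<kappa>_def)
  show "\<exists>\<kappa>>0. small_ball_bound d \<kappa> \<eta>"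
    unfolding small_ball_bound_def
  proof (intro exI[of _ \<kappa>] conjI \<kappa> allI impI)
    fix I b
    assume I: "finite I" and deg: "deg_le d b" and pos: "0 < moment2 I b"
    interpret S: prob_space "samples I" by (rule prob_space_Pi)
    let ?F = "mlin c I b" and ?E = "moment2 I b" and ?V = "mlin_var I b"
    let ?A = "{x \<in> space (samples I). (?F x)\<^sup>2 \<le> \<kappa> * ?E}"
    show "S.prob ?A \<le> \<eta>"
    proof (cases "?V < \<beta> * ?E")
      case True
      have "\<beta> * ?E \<le> 1 / 2 * ?E" using \<beta> pos by (intro mult_right_mono) auto
      with True have b0: "?E / 2 \<le> (b {})\<^sup>2" using moment2_eq[OF I, of b] by simp
      (* Here the constant term is at least half of the second moment in square, while kappa <= 1/16
         makes the polynomial itself small. *)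
      have sub: "?A \<subseteq> {x \<in> space (samples I). ?E / 16 \<le> (?F x - b {})\<^sup>2}"
      proof safe
        fix x assume "(?F x)\<^sup>2 \<le> \<kappa> * ?E"
        moreover have "\<kappa> * ?E \<le> 1 / 16 * ?E" using pos by (intro mult_right_mono) (auto simp: \<kappa>_def)
        ultimately have F: "16 * (?F x)\<^sup>2 \<le> ?E" by simp
        have "(b {})\<^sup>2 \<le> 2 * (?F x)\<^sup>2 + 2 * (?F x - b {})\<^sup>2"
        proof -
          have "0 \<le> (2 * ?F x - b {})\<^sup>2" by simp
          then show ?thesis by (simp add: power2_eq_square algebra_simps)
        qed
        then show "?E / 16 \<le> (?F x - b {})\<^sup>2" using F b0 pos by linarith
      qed
      have "S.prob ?A \<le> S.prob {x \<in> space (samples I). ?E / 16 \<le> (?F x - b {})\<^sup>2}"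
        by (rule S.finite_measure_mono[OF sub]) measurable
      also have "\<dots> \<le> ?V / (?E / 16)" using pos by (intro chebyshev_mlin I) auto
      also have "\<dots> \<le> (\<beta> * ?E) / (?E / 16)" using True pos by (intro divide_right_mono) auto
      also have "\<dots> = 16 * \<beta>" using pos by simp
      finally show ?thesis using \<beta> by linarith
    next
      case False
      then have V: "0 < ?V" using \<beta> pos by (meson less_le_trans mult_pos_pos not_less)
      define a where "a = 1 / sqrt ?V"
      define b' where "b' S = a * b S" for S
      define \<phi> where "\<phi> y = r * arctan (y / r)" for y :: real
      define f where "f y = 1 / (1 + (y / r)\<^sup>2)" for y :: real
      have one: "mlin_var I b' = 1" unfolding b'_def a_def using V by (rule mlin_var_normalise)
      have deg': "deg_le d b'" unfolding b'_def using deg by (rule deg_le_scale)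
      have F': "mlin c I b' x = a * ?F x" for x unfolding b'_def by (rule mlin_scale)
      have nz: "1 + (y / r)\<^sup>2 \<noteq> 0" for y by (metis add.commute add_nonneg_pos less_numeral_extra(1,3) zero_le_power2)
      have \<phi>: "(\<phi> has_real_derivative f y) (at y)" for y
        unfolding \<phi>_def f_def using r by (auto intro!: derivative_eq_intros simp: inverse_eq_divide)
      have f_cont: "continuous_on UNIV f"
        unfolding f_def using nz r by (intro continuous_intros) auto
      have [measurable]: "f \<in> borel_measurable borel" using f_cont by (rule borel_measurable_continuous_onI)
      have \<phi>b: "\<bar>\<phi> y\<bar> \<le> 2 * r" for y
      proof -
        have "r * \<bar>arctan (y / r)\<bar> \<le> r * 2" using r abs_arctan_le_2 by (intro mult_left_mono) auto
        then show ?thesis using r by (simp add: \<phi>_def abs_mult)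
      qed
      have f: "0 \<le> f y" "f y \<le> 1" for y
      proof -
        have "0 < 1 + (y / r)\<^sup>2" by (intro add_pos_nonneg) auto
        then show "0 \<le> f y" "f y \<le> 1" unfolding f_def by (auto simp: divide_le_eq_1)
      qed
      have point: "indicator ?A x \<le> 2 * f (mlin c I b' x)" if x: "x \<in> space (samples I)" for x
      proof (cases "x \<in> ?A")
        case True
        have "(mlin c I b' x)\<^sup>2 = (?F x)\<^sup>2 / ?V" using V by (simp add: F' a_def power_mult_distrib power_divide)
        also have "\<dots> \<le> (\<beta> * r\<^sup>2 * ?E) / ?V"
        proof (intro divide_right_mono)
          have "\<kappa> * ?E \<le> \<beta> * r\<^sup>2 * ?E" using pos by (intro mult_right_mono) (auto simp: \<kappa>_def)
          then show "(?F x)\<^sup>2 \<le> \<beta> * r\<^sup>2 * ?E" using True by simp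
        qed (use V in simp)
        also have "\<dots> = r\<^sup>2 * ((\<beta> * ?E) / ?V)" by simp
        also have "\<dots> \<le> r\<^sup>2 * 1" using False V by (intro mult_left_mono) auto
        finally have "(mlin c I b' x / r)\<^sup>2 \<le> 1" using r by (simp add: power_divide)
        then have "1 / 2 \<le> f (mlin c I b' x)" unfolding f_def by (intro frac_le) (auto intro: add_pos_nonneg)
        then show ?thesis using True by simp
      qed (use f in simp)
      have "S.prob ?A = (\<integral>x. indicator ?A x \<partial>samples I)" by simp
      also have "\<dots> \<le> (\<integral>x. 2 * f (mlin c I b' x) \<partial>samples I)"
      proof (rule integral_mono)
        show "integrable (samples I) (indicator ?A :: _ \<Rightarrow> real)"
          by (auto simp: S.emeasure_eq_measure)
        have "integrable (samples I) (\<lambda>x. f (mlin c I b' x))"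
          using f by (intro S.integrable_const_bound[where B=1]) auto
        then show "integrable (samples I) (\<lambda>x. 2 * f (mlin c I b' x))" by simp
      qed (rule point)
      also have "\<dots> = 2 * (\<integral>x. f (mlin c I b' x) \<partial>samples I)" by simp
      also have "\<dots> \<le> 2 * (K * (2 * r) + \<eta> / 4)"
      proof -
        have "\<bar>f y\<bar> \<le> 1" for y using f[of y] by simp
        then have "\<bar>\<integral>x. f (mlin c I b' x) \<partial>samples I\<bar> \<le> K * (2 * r) + \<eta> / 4"
          using K(2)[unfolded smooth_law_bound_def almost_smooth_def, rule_format, OF I deg' one \<phi> f_cont \<phi>b]
          by (simp add: integral_mlin_law[OF f_cont])
        then have "(\<integral>x. f (mlin c I b' x) \<partial>samples I) \<le> K * (2 * r) + \<eta> / 4" by (rule abs_le_D1)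
        then show ?thesis by (rule mult_left_mono) simp
      qed
      also have "\<dots> = 4 * (K * r) + \<eta> / 2" by simp
      also have "K * r \<le> \<eta> / 8"
      proof -
        have "K * r \<le> (K + 1) * r" using r by simp
        also have "\<dots> = \<eta> / 8" using K(1) by (simp add: r_def field_simps)
        finally show ?thesis .
      qed
      finally show ?thesis by simp
    qed
  qed
qed

lemma small_balls: "small_balls d"
  by (induction d) (auto intro: small_balls_0 small_balls_of_smooth_laws smooth_laws_Suc)

lemma smooth_laws: "1 \<le> d \<Longrightarrow> smooth_laws d"
  using smooth_laws_Suc[OF small_balls, of "d - 1"] by simp

text \<open>
  Dividing the polynomial by its standard deviation $s$ replaces $\varphi(y)$ by $\varphi(sy)/s$, so
  the constant improves as the variance grows.
\<close>

lemma smooth_laws_unnormalised: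
  assumes d: "1 \<le> d" and v0: "0 < v0" and \<eta>: "0 < \<eta>"
  shows "\<exists>K\<ge>0. \<forall>I b. finite I \<longrightarrow> deg_le d b \<longrightarrow> v0 \<le> mlin_var I b \<longrightarrow>
     almost_smooth K \<eta> (distr (samples I) borel (mlin c I b))"
proof -
  obtain K where K: "0 \<le> K" "smooth_law_bound d K \<eta>"
    using smooth_laws[OF d] \<eta> unfolding smooth_laws_def by blast
  show ?thesis
    unfolding almost_smooth_def
  proof (intro exI[of _ "K / sqrt v0"] conjI allI impI)
    show "0 \<le> K / sqrt v0" using K v0 by simp
    fix I b and \<phi> f :: "real \<Rightarrow> real" and C
    assume I: "finite I" and deg: "deg_le d b" and V: "v0 \<le> mlin_var I b"
      and \<phi>: "\<forall>y. (\<phi> has_real_derivative f y) (at y)" and f_cont: "continuous_on UNIV f"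
      and \<phi>b: "\<forall>y. \<bar>\<phi> y\<bar> \<le> C" and fb: "\<forall>y. \<bar>f y\<bar> \<le> 1"
    define s where "s = sqrt (mlin_var I b)"
    have s: "0 < s" "sqrt v0 \<le> s" using V v0 by (simp_all add: s_def)
    have C: "0 \<le> C" using \<phi>b by (metis abs_ge_zero order_trans)
    let ?b = "\<lambda>S. 1 / s * b S"
    have f_cont': "continuous_on UNIV (\<lambda>y. f (s * y))"
      by (intro continuous_on_compose2[OF f_cont] continuous_intros) auto
    have "\<bar>\<integral>y. f (s * y) \<partial>distr (samples I) borel (mlin c I ?b)\<bar> \<le> K * (C / s) + \<eta>"
    proof (rule K(2)[unfolded smooth_law_bound_def almost_smooth_def, rule_format, where f="\<lambda>y. f (s * y)" and \<phi>="\<lambda>y. \<phi> (s * y) / s"])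
      show "finite I" by (rule I)
      show "deg_le d ?b" by (rule deg_le_scale[OF deg])
      show "mlin_var I ?b = 1" unfolding s_def using V v0 by (intro mlin_var_normalise) auto
      show "((\<lambda>y. \<phi> (s * y) / s) has_real_derivative f (s * y)) (at y)" for y
      proof -
        have "((\<lambda>y. \<phi> (s * y)) has_real_derivative f (s * y) * s) (at y)"
          by (rule DERIV_chain2[OF \<phi>[rule_format]]) (auto intro!: derivative_eq_intros)
        from DERIV_cdivide[OF this, of s] show ?thesis using s by simp
      qed
      show "continuous_on UNIV (\<lambda>y. f (s * y))" by (rule f_cont')
      show "\<bar>\<phi> (s * y) / s\<bar> \<le> C / s" for y
        using \<phi>b s by (simp add: divide_right_mono)
      show "\<bar>f (s * y)\<bar> \<le> 1" for y using fb by simp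
    qed
    moreover have "s * mlin c I ?b x = mlin c I b x" for x
      using s by (simp only: mlin_scale) simp
    moreover have "K * (C / s) \<le> K / sqrt v0 * C"
    proof -
      have "K * C / s \<le> K * C / sqrt v0" using s v0 K C by (intro frac_le) auto
      then show ?thesis by simp
    qed
    ultimately show "\<bar>\<integral>y. f y \<partial>distr (samples I) borel (mlin c I b)\<bar> \<le> K / sqrt v0 * C + \<eta>"
      by (simp add: integral_mlin_law[OF f_cont'] integral_mlin_law[OF f_cont])
  qed
qed

end

section \<open>Normal, gamma and beta laws\<close>

text \<open>
  Pearson's differential equation $y p' = (\alpha + \beta x) p$ makes
  $\tau = w' + w p'/p = w' + y (\alpha + \beta x) / (1 + y^2)$ for the weight $w = y^2/(1 + y^2)$. This
  is bounded by a constant plus a multiple of $|x|$, so second moments suffice. The usual weight $y$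
  of the Pearson diffusion would be unbounded for the gamma law; the chosen one is bounded on the whole
  line.
\<close>

lemma pearson_ibp_law:
  fixes p p' y y' :: "real \<Rightarrow> real" and l u :: ereal and \<alpha> \<beta> :: real
  assumes lu: "l < u" and p_meas [measurable]: "p \<in> borel_measurable borel"
    and p_nonneg: "\<And>x. 0 \<le> p x" and prob: "prob_space (density lborel p)"
    and p_zero: "\<And>x. x \<notin> einterval l u \<Longrightarrow> p x = 0"
    and p_deriv: "\<And>x. x \<in> einterval l u \<Longrightarrow> (p has_real_derivative p' x) (at x)"
    and pearson: "\<And>x. x \<in> einterval l u \<Longrightarrow> y x * p' x = (\<alpha> + \<beta> * x) * p x"
    and y_deriv: "\<And>x. (y has_real_derivative y' x) (at x)" and y'_cont: "continuous_on UNIV y'"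
    and y_nz: "\<And>x. x \<in> einterval l u \<Longrightarrow> y x \<noteq> 0"
    and bound: "\<And>x. \<bar>y x * y' x\<bar> \<le> (1 + (y x)\<^sup>2)\<^sup>2"
    and sq: "integrable lborel (\<lambda>x. p x * x\<^sup>2)"
    and lim_l: "(((\<lambda>x. (y x)\<^sup>2 / (1 + (y x)\<^sup>2) * p x) \<circ> real_of_ereal) \<longlongrightarrow> 0) (at_right l)"
    and lim_u: "(((\<lambda>x. (y x)\<^sup>2 / (1 + (y x)\<^sup>2) * p x) \<circ> real_of_ereal) \<longlongrightarrow> 0) (at_left u)"
  shows "ibp_law (density lborel p) (\<lambda>x. (y x)\<^sup>2 / (1 + (y x)\<^sup>2)) (\<lambda>x. 2 * (y x * y' x) / (1 + (y x)\<^sup>2)\<^sup>2)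
     (\<lambda>x. 2 * (y x * y' x) / (1 + (y x)\<^sup>2)\<^sup>2 + y x * (\<alpha> + \<beta> * x) / (1 + (y x)\<^sup>2))"
proof -
  let ?\<mu> = "density lborel p"
  interpret D: prob_space ?\<mu> by (rule prob)
  define w where "w x = (y x)\<^sup>2 / (1 + (y x)\<^sup>2)" for x
  define w' where "w' x = 2 * (y x * y' x) / (1 + (y x)\<^sup>2)\<^sup>2" for x
  define \<tau> where "\<tau> x = w' x + y x * (\<alpha> + \<beta> * x) / (1 + (y x)\<^sup>2)" for x
  have pos: "0 < 1 + (y x)\<^sup>2" for x by (intro add_pos_nonneg) auto
  then have nz: "1 + (y x)\<^sup>2 \<noteq> 0" for x by (metis less_irrefl)
  have y_cont: "continuous_on A y" for A
    using y_deriv by (meson DERIV_isCont continuous_at_imp_continuous_on)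
  have y'_cont': "continuous_on A y'" for A
    using y'_cont by (rule continuous_on_subset) simp
  have w_cont: "continuous_on UNIV w" and w'_cont: "continuous_on UNIV w'" and \<tau>_cont: "continuous_on UNIV \<tau>"
    unfolding w_def \<tau>_def w'_def using nz by (auto intro!: continuous_intros y_cont y'_cont')
  have meas [measurable]: "w \<in> borel_measurable borel" "w' \<in> borel_measurable borel" "\<tau> \<in> borel_measurable borel"
    using w_cont w'_cont \<tau>_cont by (auto intro: borel_measurable_continuous_onI)
  have w_bounds: "0 \<le> w x" "w x \<le> 1" for x using pos[of x] by (simp_all add: w_def)
  have w'_bound: "\<bar>w' x\<bar> \<le> 2" for x
    using bound[of x] pos[of x] by (simp add: w'_def abs_mult pos_divide_le_eq)
  have w_deriv: "(w has_real_derivative w' x) (at x)" for x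
  proof -
    have "(w has_real_derivative ((2 * y x * y' x) * (1 + (y x)\<^sup>2) - (y x)\<^sup>2 * (2 * y x * y' x)) / ((1 + (y x)\<^sup>2) * (1 + (y x)\<^sup>2))) (at x)"
      unfolding w_def by (rule DERIV_divide) (use nz in \<open>auto intro!: derivative_eq_intros y_deriv\<close>)
    also have "(2 * y x * y' x) * (1 + (y x)\<^sup>2) - (y x)\<^sup>2 * (2 * y x * y' x) = 2 * (y x * y' x)"
      by (simp add: algebra_simps)
    finally show ?thesis by (simp add: w'_def power2_eq_square)
  qed
  have sq': "integrable ?\<mu> (\<lambda>x. x\<^sup>2)"
    using sq p_nonneg by (subst integrable_real_density) auto
  have tau_sq: "integrable ?\<mu> (\<lambda>x. (\<tau> x)\<^sup>2)"
  proof (rule Bochner_Integration.integrable_bound)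
    show "integrable ?\<mu> (\<lambda>x. 8 + (4 * \<alpha>\<^sup>2 + 4 * \<beta>\<^sup>2 * x\<^sup>2))" using sq' by auto
    show "AE x in ?\<mu>. norm ((\<tau> x)\<^sup>2) \<le> norm (8 + (4 * \<alpha>\<^sup>2 + 4 * \<beta>\<^sup>2 * x\<^sup>2))"
    proof (rule AE_I2)
      fix x
      have sq2: "(s + t)\<^sup>2 \<le> 2 * s\<^sup>2 + 2 * t\<^sup>2" for s t :: real
        using sum_squares_bound[of s t] by (simp add: power2_sum)
      define z where "z = y x * (\<alpha> + \<beta> * x) / (1 + (y x)\<^sup>2)"
      have "\<bar>y x\<bar> / (1 + (y x)\<^sup>2) \<le> 1"
        using sum_squares_bound[of 1 "\<bar>y x\<bar>"] pos[of x] by simp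
      then have "\<bar>y x\<bar> / (1 + (y x)\<^sup>2) * \<bar>\<alpha> + \<beta> * x\<bar> \<le> 1 * \<bar>\<alpha> + \<beta> * x\<bar>"
        by (intro mult_right_mono) auto
      then have "\<bar>z\<bar> \<le> \<bar>\<alpha> + \<beta> * x\<bar>" using pos[of x] by (simp add: z_def abs_mult)
      then have "z\<^sup>2 \<le> (\<alpha> + \<beta> * x)\<^sup>2" by (simp add: abs_le_square_iff)
      also have "\<dots> \<le> 2 * \<alpha>\<^sup>2 + 2 * (\<beta> * x)\<^sup>2" by (rule sq2)
      finally have z: "z\<^sup>2 \<le> 2 * \<alpha>\<^sup>2 + 2 * (\<beta>\<^sup>2 * x\<^sup>2)" by (simp add: power_mult_distrib)
      have "(w' x)\<^sup>2 \<le> 2\<^sup>2" using w'_bound[of x] abs_le_square_iff[of "w' x" 2] by simp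
      moreover have "(\<tau> x)\<^sup>2 = (w' x + z)\<^sup>2" by (simp only: \<tau>_def z_def)
      ultimately have "(\<tau> x)\<^sup>2 \<le> 8 + (4 * \<alpha>\<^sup>2 + 4 * \<beta>\<^sup>2 * x\<^sup>2)"
        using sq2[of "w' x" z] z by simp
      then show "norm ((\<tau> x)\<^sup>2) \<le> norm (8 + (4 * \<alpha>\<^sup>2 + 4 * \<beta>\<^sup>2 * x\<^sup>2))" by simp
    qed
  qed measurable
  have tau_int: "integrable ?\<mu> \<tau>"
    using integrable_mult_of_squares[of \<tau> ?\<mu> "\<lambda>_. 1"] tau_sq by simp
  have AE_in: "AE x in ?\<mu>. x \<in> einterval l u"
  proof (subst AE_density)
    show "AE x in lborel. 0 < ennreal (p x) \<longrightarrow> x \<in> einterval l u"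
      using p_zero by (intro AE_I2 impI) (metis ennreal_0 less_irrefl)
  qed simp
  have ibp: "(\<integral>x. g' x * w x \<partial>?\<mu>) = - (\<integral>x. g x * \<tau> x \<partial>?\<mu>)"
    if g: "\<And>x. (g has_real_derivative g' x) (at x)" and g'_cont: "continuous_on UNIV g'"
      and gb: "\<And>x. \<bar>g x\<bar> \<le> C" and g'b: "\<And>x. \<bar>g' x\<bar> \<le> C" for g g' C
  proof -
    let ?h = "\<lambda>x. p x * (g' x * w x + g x * \<tau> x)"
    have g_cont: "continuous_on UNIV g"
      using g by (meson DERIV_isCont continuous_at_imp_continuous_on)
    have [measurable]: "g \<in> borel_measurable borel" "g' \<in> borel_measurable borel"
      using g_cont g'_cont by (auto intro: borel_measurable_continuous_onI)
    have int1: "integrable ?\<mu> (\<lambda>x. g' x * w x)"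
    proof (rule D.integrable_const_bound[where B=C])
      show "AE x in ?\<mu>. norm (g' x * w x) \<le> C"
      proof (rule AE_I2)
        fix x
        have "\<bar>g' x\<bar> * \<bar>w x\<bar> \<le> C * 1" using g'b[of x] w_bounds[of x] by (intro mult_mono) auto
        then show "norm (g' x * w x) \<le> C" by (simp add: abs_mult)
      qed
    qed measurable
    have int2: "integrable ?\<mu> (\<lambda>x. g x * \<tau> x)"
    proof (rule Bochner_Integration.integrable_bound)
      show "integrable ?\<mu> (\<lambda>x. C * \<tau> x)" using tau_int by simp
      show "AE x in ?\<mu>. norm (g x * \<tau> x) \<le> norm (C * \<tau> x)"
      proof (rule AE_I2)
        fix x
        have "\<bar>g x\<bar> \<le> \<bar>C\<bar>" using gb[of x] by simp
        then show "norm (g x * \<tau> x) \<le> norm (C * \<tau> x)" by (simp add: abs_mult mult_right_mono)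
      qed
    qed measurable
    have int: "integrable lborel ?h"
      using int1 int2 p_nonneg by (subst integrable_real_density[symmetric]) auto
    have "(LBINT x=l..u. ?h x) = 0 - 0"
    proof (rule interval_integral_FTC_integrable[where F="\<lambda>x. g x * (w x * p x)", OF lu])
      fix x :: real assume x: "l < ereal x" "ereal x < u"
      then have x': "x \<in> einterval l u" by (simp add: einterval_def)
      have "((\<lambda>x. g x * (w x * p x)) has_real_derivative g' x * (w x * p x) + (w' x * p x + p' x * w x) * g x) (at x)"
        by (intro DERIV_mult g w_deriv p_deriv x')
      moreover have "w x * p' x = y x * (\<alpha> + \<beta> * x) / (1 + (y x)\<^sup>2) * p x"
      proof -
        have "w x * p' x = y x * (y x * p' x) / (1 + (y x)\<^sup>2)" by (simp add: w_def power2_eq_square)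
        then show ?thesis by (simp add: pearson[OF x'])
      qed
      then have "g' x * (w x * p x) + (w' x * p x + p' x * w x) * g x = ?h x"
        by (simp add: \<tau>_def algebra_simps)
      ultimately show "((\<lambda>x. g x * (w x * p x)) has_vector_derivative ?h x) (at x)"
        by (simp add: has_real_derivative_iff_has_vector_derivative)
      show "isCont ?h x"
        using DERIV_isCont[OF p_deriv[OF x']] g'_cont g_cont w_cont \<tau>_cont
        by (simp add: continuous_on_eq_continuous_at)
    next
      show "set_integrable lborel (einterval l u) ?h"
        unfolding set_integrable_def using int by (intro integrable_mult_indicator) auto
    next
      have lim0: "(((\<lambda>x. g x * (w x * p x)) \<circ> real_of_ereal) \<longlongrightarrow> 0) F"
        if "(((\<lambda>x. (y x)\<^sup>2 / (1 + (y x)\<^sup>2) * p x) \<circ> real_of_ereal) \<longlongrightarrow> 0) F" for F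
      proof (rule Lim_null_comparison[where g="\<lambda>x. C * ((\<lambda>x. w x * p x) \<circ> real_of_ereal) x"])
        show "((\<lambda>x. C * ((\<lambda>x. w x * p x) \<circ> real_of_ereal) x) \<longlongrightarrow> 0) F"
          using that unfolding w_def by (rule tendsto_mult_right_zero)
        show "\<forall>\<^sub>F x in F. norm (((\<lambda>x. g x * (w x * p x)) \<circ> real_of_ereal) x) \<le> C * ((\<lambda>x. w x * p x) \<circ> real_of_ereal) x"
          using gb w_bounds p_nonneg by (auto simp: abs_mult intro!: always_eventually mult_right_mono mult_nonneg_nonneg)
      qed
      show "(((\<lambda>x. g x * (w x * p x)) \<circ> real_of_ereal) \<longlongrightarrow> 0) (at_right l)" by (rule lim0[OF lim_l])
      show "(((\<lambda>x. g x * (w x * p x)) \<circ> real_of_ereal) \<longlongrightarrow> 0) (at_left u)" by (rule lim0[OF lim_u])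
    qed
    moreover have "(LBINT x=l..u. ?h x) = (\<integral>x. ?h x \<partial>lborel)"
    proof -
      have "(LBINT x=l..u. ?h x) = (\<integral>x. indicator (einterval l u) x *\<^sub>R ?h x \<partial>lborel)"
        using lu by (simp add: interval_lebesgue_integral_def set_lebesgue_integral_def)
      also have "\<dots> = (\<integral>x. ?h x \<partial>lborel)"
        using p_zero by (intro Bochner_Integration.integral_cong) (auto simp: indicator_def)
      finally show ?thesis .
    qed
    moreover have "(\<integral>x. ?h x \<partial>lborel) = (\<integral>x. g' x * w x + g x * \<tau> x \<partial>?\<mu>)"
      using p_nonneg by (subst integral_real_density) auto
    ultimately show ?thesis using int1 int2 by simp
  qed
  have "ibp_law ?\<mu> w w' \<tau>"
  proof (intro ibp_law.intro ibp_law_axioms.intro)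
    show "\<not> (AE x in ?\<mu>. x = a)" for a
    proof
      assume "AE x in ?\<mu>. x = a"
      moreover have "AE x in ?\<mu>. x \<noteq> a"
        using AE_lborel_singleton[of a] by (subst AE_density) auto
      ultimately have "AE x in ?\<mu>. False" by eventually_elim simp
      then show False by (simp add: D.AE_False)
    qed
    show "AE x in ?\<mu>. 0 < w x"
      using AE_in
    proof eventually_elim
      case (elim x)
      then show ?case using y_nz[of x] pos[of x] by (simp add: w_def zero_less_divide_iff)
    qed
  next
    fix g g' C
    assume "\<And>x. (g has_real_derivative g' x) (at x)" "continuous_on UNIV g'" "\<And>x. \<bar>g x\<bar> \<le> C" "\<And>x. \<bar>g' x\<bar> \<le> C"
    then show "(\<integral>x. g' x * w x \<partial>?\<mu>) = - (\<integral>x. g x * \<tau> x \<partial>?\<mu>)" by (rule ibp)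
  qed (use prob sq' w_bounds w_deriv w'_cont w'_bound tau_sq in \<open>simp_all\<close>)
  then show ?thesis
    by (simp add: w_def[abs_def] w'_def[abs_def] \<tau>_def[abs_def])
qed

text \<open>
  The Pearson equation with $y = 1$.
\<close>

lemma std_normal_ibp_law:
  "\<exists>w w' \<tau>. ibp_law (density lborel std_normal_density) w w' \<tau>"
proof -
  have ball: "x \<in> einterval (-\<infinity>) \<infinity>" for x by (simp add: einterval_def)
  have deriv: "(std_normal_density has_real_derivative - x * std_normal_density x) (at x)" for x
  proof -
    have "((\<lambda>x. 1 / sqrt (2 * pi) * exp (- x\<^sup>2 / 2)) has_real_derivative 1 / sqrt (2 * pi) * (exp (- x\<^sup>2 / 2) * (- x))) (at x)"
      by (rule DERIV_cmult) (auto intro!: derivative_eq_intros)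
    then show ?thesis by (simp add: std_normal_density_def[abs_def] mult_ac)
  qed
  have top: "((\<lambda>x. exp (- x\<^sup>2 / 2)) \<longlongrightarrow> (0::real)) at_top"
  proof -
    have "filterlim (\<lambda>x::real. x\<^sup>2 / 2) at_top at_top"
    proof (rule filterlim_at_top_mono[OF filterlim_ident])
      show "\<forall>\<^sub>F x::real in at_top. x \<le> x\<^sup>2 / 2"
        using eventually_ge_at_top[of 2] by eventually_elim (simp add: power2_eq_square)
    qed
    then have "((\<lambda>x::real. exp (- (x\<^sup>2 / 2))) \<longlongrightarrow> 0) at_top"
      by (intro filterlim_compose[OF exp_at_bot] filterlim_compose[OF filterlim_uminus_at_bot_at_top])
    then show ?thesis by simp
  qed
  have bot: "((\<lambda>x. exp (- x\<^sup>2 / 2)) \<longlongrightarrow> (0::real)) at_bot"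
    using top by (simp add: filterlim_at_bot_mirror)
  show ?thesis
    by (intro exI, rule pearson_ibp_law[of "-\<infinity>" \<infinity> std_normal_density "\<lambda>x. - x * std_normal_density x" "\<lambda>_. 1" 0 "-1" "\<lambda>_. 0"])
      (use ball deriv top bot prob_space_normal_density[of 1 0] integrable_std_normal_moment[of 2] in
        \<open>auto simp: ereal_tendsto_simps std_normal_density_def intro!: tendsto_divide_zero\<close>)
qed

lemma powr_has_derivative:
  "0 < t \<Longrightarrow> ((\<lambda>t. t powr s) has_real_derivative s / t * t powr s) (at (t::real))"
  by (auto intro!: derivative_eq_intros simp: powr_diff)

text \<open>
  The Pearson equation with $y = x$. Near 0 the density is bounded, because $r \geq 1$, and near
  infinity the exponential wins.
\<close>

lemma gamma_ibp_law:
  assumes r: "1 \<le> r" and prob: "prob_space (density lborel (\<lambda>t. ennreal (gamma_density r t)))"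
  shows "\<exists>w w' \<tau>. ibp_law (density lborel (gamma_density r)) w w' \<tau>"
proof -
  let ?p = "gamma_density r"
  have G: "0 < Gamma r" using r by (intro Gamma_real_pos) auto
  have p_nonneg: "0 \<le> ?p x" for x using G by (simp add: gamma_density_def)
  have zero: "?p x = 0" if "x \<notin> einterval (ereal 0) \<infinity>" for x
    using that by (cases "x = 0") (auto simp: gamma_density_def einterval_def)
  have deriv: "(?p has_real_derivative ((r - 1) / x - 1) * ?p x) (at x)" if "x \<in> einterval (ereal 0) \<infinity>" for x
  proof -
    have x: "0 < x" using that by (simp add: einterval_def)
    have "((\<lambda>t. t powr (r - 1) * exp (- t) / Gamma r) has_real_derivative
        ((r - 1) / x * x powr (r - 1) * exp (- x) + - exp (- x) * x powr (r - 1)) / Gamma r) (at x)"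
      by (intro DERIV_cdivide DERIV_mult powr_has_derivative x) (auto intro!: derivative_eq_intros)
    then have "((\<lambda>t. t powr (r - 1) * exp (- t) / Gamma r) has_real_derivative ((r - 1) / x - 1) * ?p x) (at x)"
      using x by (simp add: gamma_density_def algebra_simps diff_divide_distrib add_divide_distrib)
    then show ?thesis
      by (rule has_field_derivative_transform_within_open[where S="{0<..}"]) (use x in \<open>auto simp: gamma_density_def\<close>)
  qed
  have sq: "integrable lborel (\<lambda>x. ?p x * x\<^sup>2)"
  proof -
    have "integrable lborel (\<lambda>t. indicator {0..} t * t powr (r + 2 - 1) / exp t)"
    proof (rule integrableI_nonneg)
      have "(\<integral>\<^sup>+ t. ennreal (indicator {0..} t * t powr (r + 2 - 1) / exp t) \<partial>lborel) = ennreal (Gamma (r + 2))"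
        using Gamma_conv_nn_integral_real[of "r + 2"] r by simp
      then show "(\<integral>\<^sup>+ t. ennreal (indicator {0..} t * t powr (r + 2 - 1) / exp t) \<partial>lborel) < \<infinity>"
        by (metis ennreal_less_top infinity_ennreal_def)
    qed (auto simp: indicator_def)
    then have "integrable lborel (\<lambda>t. indicator {0..} t * t powr (r + 2 - 1) / exp t * (1 / Gamma r))"
      by (rule integrable_mult_left)
    also have "(\<lambda>t. indicator {0..} t * t powr (r + 2 - 1) / exp t * (1 / Gamma r)) = (\<lambda>x. ?p x * x\<^sup>2)"
    proof
      fix t :: real
      have "t powr (r + 1) = t powr (r - 1) * t\<^sup>2" if "0 < t"
        using that powr_add[of t "r - 1" 2] by (simp add: add.commute)
      then show "indicator {0..} t * t powr (r + 2 - 1) / exp t * (1 / Gamma r) = ?p t * t\<^sup>2"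
        by (cases "t = 0"; cases "0 < t") (auto simp: gamma_density_def exp_minus field_simps)
    qed
    finally show ?thesis .
  qed
  have lim0: "((\<lambda>x. x\<^sup>2 / (1 + x\<^sup>2) * ?p x) \<longlongrightarrow> 0) (at_right 0)"
  proof (rule Lim_null_comparison)
    show "\<forall>\<^sub>F x in at_right 0. norm (x\<^sup>2 / (1 + x\<^sup>2) * ?p x) \<le> x\<^sup>2 * (1 / Gamma r)"
      using eventually_at_right_less[of 0] order_tendstoD(2)[OF tendsto_ident_at zero_less_one, of "{0<..}"]
    proof eventually_elim
      case (elim x)
      have "x powr (r - 1) \<le> 1" using elim r by (intro powr_le1) auto
      then have "x powr (r - 1) * exp (- x) \<le> 1 * 1" using elim by (intro mult_mono) auto
      then have p: "?p x \<le> 1 / Gamma r" using elim G by (simp add: gamma_density_def divide_right_mono)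
      have "x\<^sup>2 / (1 + x\<^sup>2) \<le> x\<^sup>2 / 1" by (intro frac_le) auto
      then have "x\<^sup>2 / (1 + x\<^sup>2) * ?p x \<le> x\<^sup>2 * (1 / Gamma r)"
        using p p_nonneg by (intro mult_mono) auto
      then show ?case using p_nonneg[of x] by (simp add: abs_mult)
    qed
    show "((\<lambda>x. x\<^sup>2 * (1 / Gamma r)) \<longlongrightarrow> 0) (at_right 0)"
      by (rule tendsto_eq_intros refl)+ simp
  qed
  have lim_top: "((\<lambda>x. x\<^sup>2 / (1 + x\<^sup>2) * ?p x) \<longlongrightarrow> 0) at_top"
  proof (rule Lim_null_comparison)
    define k where "k = nat \<lceil>r\<rceil>"
    show "((\<lambda>x. 1 / Gamma r * (x ^ k / exp x)) \<longlongrightarrow> 0) at_top"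
      by (intro tendsto_mult_right_zero tendsto_power_div_exp_0)
    show "\<forall>\<^sub>F x in at_top. norm (x\<^sup>2 / (1 + x\<^sup>2) * ?p x) \<le> 1 / Gamma r * (x ^ k / exp x)"
      using eventually_ge_at_top[of 1]
    proof eventually_elim
      case (elim x)
      have "x powr (r - 1) \<le> x powr (real k)"
        using elim r by (intro powr_mono) (auto simp: k_def, linarith)
      also have "\<dots> = x ^ k" using elim by (intro powr_realpow) auto
      finally have "x powr (r - 1) * exp (- x) / Gamma r \<le> x ^ k * exp (- x) / Gamma r"
        using G by (intro divide_right_mono mult_right_mono) auto
      then have p: "?p x \<le> 1 / Gamma r * (x ^ k / exp x)"
        using elim by (simp add: gamma_density_def exp_minus field_simps)
      have "x\<^sup>2 / (1 + x\<^sup>2) \<le> 1" by (simp add: divide_le_eq_1 add_pos_nonneg)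
      then have "x\<^sup>2 / (1 + x\<^sup>2) * ?p x \<le> 1 * ?p x" using p_nonneg by (intro mult_right_mono) auto
      then show ?case using p p_nonneg[of x] by (simp add: abs_mult)
    qed
  qed
  have bound: "\<bar>x * 1\<bar> \<le> (1 + x\<^sup>2)\<^sup>2" for x :: real
  proof -
    have "\<bar>x\<bar> \<le> 1 + x\<^sup>2" using sum_squares_bound[of 1 "\<bar>x\<bar>"] by simp
    also have "\<dots> \<le> (1 + x\<^sup>2)\<^sup>2" by (rule self_le_power) auto
    finally show ?thesis by simp
  qed
  show ?thesis
    by (intro exI, rule pearson_ibp_law[of "ereal 0" \<infinity> ?p "\<lambda>x. ((r - 1) / x - 1) * ?p x" "\<lambda>x. x" "r - 1" "-1" "\<lambda>_. 1"])
      (use prob p_nonneg zero deriv sq lim0 lim_top bound in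
        \<open>auto simp: ereal_tendsto_simps einterval_def field_simps simp del: zero_ereal_def\<close>)
qed

text \<open>
  The Pearson equation with $y = x (1 - x)$, which vanishes at both ends of the support, where the
  density stays bounded because $a, b \geq 1$.
\<close>

lemma beta_ibp_law:
  assumes ab: "1 \<le> a" "1 \<le> b" and prob: "prob_space (density lborel (\<lambda>t. ennreal (beta_density a b t)))"
  shows "\<exists>w w' \<tau>. ibp_law (density lborel (beta_density a b)) w w' \<tau>"
proof -
  let ?p = "beta_density a b"
  define Z where "Z = integral {0..1} (\<lambda>u::real. u powr (a - 1) * (1 - u) powr (b - 1))"
  define y where "y x = x * (1 - x)" for x :: real
  have p: "?p t = (if t \<in> {0..1} then t powr (a - 1) * (1 - t) powr (b - 1) / Z else 0)" for t
    by (simp add: beta_density_def Z_def)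
  have Z: "0 \<le> Z"
  proof (cases "(\<lambda>u::real. u powr (a - 1) * (1 - u) powr (b - 1)) integrable_on {0..1}")
    case True
    then show ?thesis unfolding Z_def by (rule Henstock_Kurzweil_Integration.integral_nonneg) auto
  qed (simp add: Z_def not_integrable_integral)
  have p_nonneg: "0 \<le> ?p x" for x using Z by (simp add: p)
  have zero: "?p x = 0" if "x \<notin> einterval (ereal 0) (ereal 1)" for x
    using that by (cases "x = 0 \<or> x = 1") (auto simp: p einterval_def)
  have deriv: "(?p has_real_derivative ((a - 1) / x - (b - 1) / (1 - x)) * ?p x) (at x)"
    if "x \<in> einterval (ereal 0) (ereal 1)" for x
  proof -
    have x: "0 < x" "x < 1" using that by (simp_all add: einterval_def)
    have "((\<lambda>t. (1 - t) powr (b - 1)) has_real_derivative (b - 1) / (1 - x) * (1 - x) powr (b - 1) * (- 1)) (at x)"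
      by (rule DERIV_chain2[OF powr_has_derivative]) (use x in \<open>auto intro!: derivative_eq_intros\<close>)
    then have d: "((\<lambda>t. t powr (a - 1) * (1 - t) powr (b - 1) / Z) has_real_derivative
        ((a - 1) / x * x powr (a - 1) * (1 - x) powr (b - 1)
          + (b - 1) / (1 - x) * (1 - x) powr (b - 1) * (- 1) * x powr (a - 1)) / Z) (at x)"
      by (intro DERIV_cdivide DERIV_mult powr_has_derivative x)
    have eq: "((a - 1) / x * x powr (a - 1) * (1 - x) powr (b - 1)
          + (b - 1) / (1 - x) * (1 - x) powr (b - 1) * (- 1) * x powr (a - 1)) / Z
        = ((a - 1) / x - (b - 1) / (1 - x)) * ?p x"
    proof -
      have "(A * P * R + B * R * (- 1) * P) / Z = (A - B) * (P * R / Z)" for A B P R :: real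
        by (simp add: algebra_simps diff_divide_distrib)
      then show ?thesis using x by (simp only: p) simp
    qed
    have "((\<lambda>t. t powr (a - 1) * (1 - t) powr (b - 1) / Z) has_real_derivative
        ((a - 1) / x - (b - 1) / (1 - x)) * ?p x) (at x)"
      by (rule DERIV_cong[OF d eq])
    then show ?thesis
      by (rule has_field_derivative_transform_within_open[where S="{0<..<1}"]) (use x in \<open>auto simp: p\<close>)
  qed
  have p_bound: "?p x \<le> 1 / Z" for x
  proof (cases "x \<in> {0..1}")
    case True
    then have "x powr (a - 1) \<le> 1" "(1 - x) powr (b - 1) \<le> 1" using ab by (auto intro!: powr_le1)
    then have "x powr (a - 1) * (1 - x) powr (b - 1) \<le> 1 * 1" by (intro mult_mono) auto
    then show ?thesis using True Z by (simp add: p divide_right_mono)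
  next
    case False
    then have "?p x = 0" unfolding p by (rule if_not_P)
    then show ?thesis using Z by simp
  qed
  interpret D: prob_space "density lborel ?p" using prob by simp
  have sq: "integrable lborel (\<lambda>x. ?p x * x\<^sup>2)"
  proof -
    have "AE x in density lborel ?p. x \<in> {0..1}"
      by (subst AE_density) (auto intro!: AE_I2 simp: p)
    then have "integrable (density lborel ?p) (\<lambda>x. x\<^sup>2)"
    proof (intro D.integrable_const_bound[where B=1])
      assume "AE x in density lborel ?p. x \<in> {0..1}"
      then show "AE x in density lborel ?p. norm (x\<^sup>2) \<le> 1"
        by eventually_elim (auto simp: power_le_one)
    qed auto
    then show ?thesis using p_nonneg by (subst (asm) integrable_real_density) auto
  qed
  have y_cont: "isCont y x" for x unfolding y_def by (intro continuous_intros)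
  have lim: "((\<lambda>x. (y x)\<^sup>2 / (1 + (y x)\<^sup>2) * ?p x) \<longlongrightarrow> 0) (at x within A)" if "y x = 0" for x A
  proof (rule Lim_null_comparison)
    show "\<forall>\<^sub>F x in at x within A. norm ((y x)\<^sup>2 / (1 + (y x)\<^sup>2) * ?p x) \<le> (y x)\<^sup>2 * (1 / Z)"
    proof (intro always_eventually allI)
      fix x
      have "(y x)\<^sup>2 / (1 + (y x)\<^sup>2) \<le> (y x)\<^sup>2 / 1" by (intro frac_le) auto
      then have "(y x)\<^sup>2 / (1 + (y x)\<^sup>2) * ?p x \<le> (y x)\<^sup>2 * (1 / Z)"
        using p_bound[of x] p_nonneg by (intro mult_mono) auto
      then show "norm ((y x)\<^sup>2 / (1 + (y x)\<^sup>2) * ?p x) \<le> (y x)\<^sup>2 * (1 / Z)"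
        using p_nonneg[of x] by (simp add: abs_mult)
    qed
    have "(y \<longlongrightarrow> y x) (at x within A)"
      using y_cont[of x] unfolding isCont_def by (rule tendsto_within_subset) simp
    then have "((\<lambda>x. (y x)\<^sup>2 * (1 / Z)) \<longlongrightarrow> (y x)\<^sup>2 * (1 / Z)) (at x within A)"
      by (intro tendsto_intros)
    then show "((\<lambda>x. (y x)\<^sup>2 * (1 / Z)) \<longlongrightarrow> 0) (at x within A)" using that by simp
  qed
  have bound: "\<bar>y x * (1 - 2 * x)\<bar> \<le> (1 + (y x)\<^sup>2)\<^sup>2" for x
  proof -
    let ?y = "\<bar>y x\<bar>"
    (* This identity is what makes the bound global: the factor 1 - 2 x is controlled by y even off the support. *)
    have "(1 - 2 * x)\<^sup>2 = 1 - 4 * y x" by (simp add: y_def power2_eq_square algebra_simps)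
    also have "\<dots> \<le> 1 + 4 * ?y" by simp
    also have "\<dots> \<le> (1 + 2 * ?y)\<^sup>2" by (simp add: power2_sum power_mult_distrib)
    finally have "\<bar>1 - 2 * x\<bar> \<le> 1 + 2 * ?y" by (simp add: abs_le_square_iff[symmetric])
    then have "?y * \<bar>1 - 2 * x\<bar> \<le> ?y * (1 + 2 * ?y)" by (intro mult_left_mono) auto
    also have "\<dots> = ?y + 2 * (y x)\<^sup>2" by (simp add: power2_eq_square algebra_simps)
    also have "\<dots> \<le> (1 + (y x)\<^sup>2)\<^sup>2"
    proof -
      have "2 * ?y \<le> 1 + (y x)\<^sup>2" using sum_squares_bound[of 1 ?y] by simp
      moreover have "2 * (y x)\<^sup>2 \<le> 1 + ((y x)\<^sup>2)\<^sup>2" using sum_squares_bound[of 1 "(y x)\<^sup>2"] by simp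
      moreover have "0 \<le> ((y x)\<^sup>2)\<^sup>2" by simp
      ultimately have "?y \<le> 1 + ((y x)\<^sup>2)\<^sup>2" by linarith
      then show ?thesis by (simp add: power2_sum)
    qed
    finally show ?thesis by (simp add: abs_mult)
  qed
  have y_deriv: "(y has_real_derivative 1 - 2 * x) (at x)" for x
    unfolding y_def by (auto intro!: derivative_eq_intros)
  have pearson: "y x * (((a - 1) / x - (b - 1) / (1 - x)) * ?p x) = ((a - 1) + (2 - a - b) * x) * ?p x"
    if "x \<in> einterval (ereal 0) (ereal 1)" for x
  proof -
    have "y x * ((a - 1) / x - (b - 1) / (1 - x)) = (a - 1) + (2 - a - b) * x"
      using that by (simp add: einterval_def y_def field_simps)
    then show ?thesis by (metis mult.assoc)
  qed
  show ?thesis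
    by (intro exI, rule pearson_ibp_law[of "ereal 0" "ereal 1" ?p "\<lambda>x. ((a - 1) / x - (b - 1) / (1 - x)) * ?p x" y "a - 1" "2 - a - b" "\<lambda>x. 1 - 2 * x"])
      (use prob p_nonneg zero deriv sq lim[of 0] lim[of 1] bound y_deriv pearson in
        \<open>auto simp: ereal_tendsto_simps einterval_def y_def intro!: continuous_intros\<close>)
qed

section \<open>From smoothness and weak convergence to total variation\<close>

text \<open>
  The density of $Y + U$ where $Y$ has law $\rho$ and $U$ is independent and uniform on
  $[0, \delta]$.
\<close>

definition window_density :: "real measure \<Rightarrow> real \<Rightarrow> real \<Rightarrow> real" where
  "window_density \<rho> \<delta> x = (cdf \<rho> x - cdf \<rho> (x - \<delta>)) / \<delta>"

lemma (in real_distribution) cdf_measurable [measurable]: "cdf M \<in> borel_measurable borel"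
  by (rule borel_measurable_mono) (simp add: monoI cdf_nondecreasing)

lemma (in real_distribution) window_density_measurable [measurable]:
  "window_density M \<delta> \<in> borel_measurable borel"
  unfolding window_density_def[abs_def] by measurable

lemma (in real_distribution) window_density_eq:
  assumes "0 < \<delta>"
  shows "window_density M \<delta> x = prob {x - \<delta><..x} / \<delta>"
  using cdf_diff_eq[of "x - \<delta>" x] assms by (simp add: window_density_def)

lemma (in real_distribution) window_density_nonneg: "0 < \<delta> \<Longrightarrow> 0 \<le> window_density M \<delta> x"
  by (simp add: window_density_eq)

context real_distribution
begin

lemma window_pair:
  assumes "0 < \<delta>"
  defines "S \<equiv> {z::real \<times> real. fst z \<le> snd z \<and> snd z < fst z + \<delta>}"
  shows "S \<in> sets (M \<Otimes>\<^sub>M lborel)" and "emeasure (M \<Otimes>\<^sub>M lborel) S = ennreal \<delta>"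
proof -
  have "S = {z \<in> space (borel \<Otimes>\<^sub>M borel). fst z \<le> snd z \<and> snd z < fst z + \<delta>}"
    by (auto simp: S_def space_pair_measure)
  also have "\<dots> \<in> sets (borel \<Otimes>\<^sub>M borel)" by measurable
  finally have S: "S \<in> sets (borel \<Otimes>\<^sub>M borel :: (real \<times> real) measure)" .
  then show S': "S \<in> sets (M \<Otimes>\<^sub>M lborel)"
    by (simp add: sets_pair_measure_cong[of M borel lborel borel])
  have "Pair y -` S = {y..<y + \<delta>}" for y by (auto simp: S_def)
  then have "emeasure (M \<Otimes>\<^sub>M lborel) S = (\<integral>\<^sup>+ y. emeasure lborel {y..<y + \<delta>} \<partial>M)"
    using lborel.emeasure_pair_measure_alt[OF S'] by simp
  also have "\<dots> = (\<integral>\<^sup>+ y. ennreal \<delta> \<partial>M)" using assms by simp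
  also have "\<dots> = ennreal \<delta>" using emeasure_space_1 by simp
  finally show "emeasure (M \<Otimes>\<^sub>M lborel) S = ennreal \<delta>" .
qed

text \<open>
  Fubini on the strip $\{(y, x) : y \leq x < y + \delta\}$: integrating $f(x)$ first over $x$ gives the
  increment of the primitive, first over $y$ it gives the mass of a window.
\<close>

lemma window_density_test:
  assumes \<delta>: "0 < \<delta>" and f: "continuous_on UNIV f" and fb: "\<And>x. \<bar>f x\<bar> \<le> 1"
    and \<Phi>: "\<And>x. (\<Phi> has_real_derivative f x) (at x)"
  shows "(\<integral>y. (\<Phi> (y + \<delta>) - \<Phi> y) / \<delta> \<partial>M) = (\<integral>x. f x * window_density M \<delta> x \<partial>lborel)"
    and "integrable lborel (\<lambda>x. f x * window_density M \<delta> x)"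
proof -
  interpret P: pair_sigma_finite M lborel
    by (simp add: pair_sigma_finite_def sigma_finite_measure_axioms lborel.sigma_finite_measure_axioms)
  have [measurable]: "f \<in> borel_measurable borel" using f by (rule borel_measurable_continuous_onI)
  define S where "S = {z::real \<times> real. fst z \<le> snd z \<and> snd z < fst z + \<delta>}"
  have S: "S \<in> sets (M \<Otimes>\<^sub>M lborel)" "emeasure (M \<Otimes>\<^sub>M lborel) S = ennreal \<delta>"
    using window_pair[OF \<delta>] by (simp_all add: S_def)
  have int: "integrable (M \<Otimes>\<^sub>M lborel) (\<lambda>(y, x). indicator S (y, x) * f x)"
  proof (rule Bochner_Integration.integrable_bound)
    show "integrable (M \<Otimes>\<^sub>M lborel) (indicator S :: _ \<Rightarrow> real)"
      using S by (intro integrable_real_indicator) auto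
    have "(\<lambda>z. indicator S z * f (snd z)) \<in> borel_measurable (M \<Otimes>\<^sub>M lborel)"
      using S(1) by measurable
    then show "(\<lambda>(y, x). indicator S (y, x) * f x) \<in> borel_measurable (M \<Otimes>\<^sub>M lborel)"
      by (simp add: case_prod_beta')
    show "AE z in M \<Otimes>\<^sub>M lborel. norm (case z of (y, x) \<Rightarrow> indicator S (y, x) * f x) \<le> norm (indicator S z :: real)"
      using fb by (auto simp: indicator_def)
  qed
  have inner1: "(\<integral>y. indicator S (y, x) * f x \<partial>M) = \<delta> * (f x * window_density M \<delta> x)" for x
  proof -
    have "indicator S (y, x) = (indicator {x - \<delta><..x} y :: real)" for y
      by (auto simp: S_def indicator_def)
    then have "(\<integral>y. indicator S (y, x) * f x \<partial>M) = prob {x - \<delta><..x} * f x"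
      by simp
    then show ?thesis using \<delta> by (simp add: window_density_eq)
  qed
  have inner2: "(\<integral>x. indicator S (y, x) * f x \<partial>lborel) = \<Phi> (y + \<delta>) - \<Phi> y" for y
  proof -
    have "(\<integral>x. indicator S (y, x) * f x \<partial>lborel) = (\<integral>x. f x * indicator {y..y + \<delta>} x \<partial>lborel)"
    proof (rule integral_cong_AE)
      have "AE x in lborel. x \<noteq> y + \<delta>" by (rule AE_lborel_singleton)
      then show "AE x in lborel. indicator S (y, x) * f x = f x * indicator {y..y + \<delta>} x"
        by eventually_elim (auto simp: S_def indicator_def)
      have "(\<lambda>x. indicator S (y, x) * f x) = (\<lambda>x. indicator {y..<y + \<delta>} x * f x)"
        by (auto simp: fun_eq_iff S_def indicator_def)
      then show "(\<lambda>x. indicator S (y, x) * f x) \<in> borel_measurable lborel" by simp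
    qed measurable
    also have "\<dots> = \<Phi> (y + \<delta>) - \<Phi> y"
      using \<delta> \<Phi> f by (intro integral_FTC_Icc_real) (auto simp: continuous_on_eq_continuous_at)
    finally show ?thesis .
  qed
  have "integrable lborel (\<lambda>x. \<integral>y. indicator S (y, x) * f x \<partial>M)"
    by (rule P.integrable_snd[OF int])
  then show "integrable lborel (\<lambda>x. f x * window_density M \<delta> x)"
    unfolding inner1 using \<delta> by simp
  have "(\<integral>x. (\<integral>y. indicator S (y, x) * f x \<partial>M) \<partial>lborel) = (\<integral>y. (\<integral>x. indicator S (y, x) * f x \<partial>lborel) \<partial>M)"
    by (rule P.Fubini_integral[OF int])
  then have "\<delta> * (\<integral>x. f x * window_density M \<delta> x \<partial>lborel) = (\<integral>y. \<Phi> (y + \<delta>) - \<Phi> y \<partial>M)"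
    unfolding inner1 inner2 by simp
  then show "(\<integral>y. (\<Phi> (y + \<delta>) - \<Phi> y) / \<delta> \<partial>M) = (\<integral>x. f x * window_density M \<delta> x \<partial>lborel)"
    using \<delta> by (simp add: field_simps)
qed

lemma
  assumes \<delta>: "0 < \<delta>"
  shows window_density_integrable: "integrable lborel (window_density M \<delta>)"
    and window_density_integral: "(\<integral>x. window_density M \<delta> x \<partial>lborel) = 1"
proof -
  have d: "((\<lambda>x. x) has_real_derivative 1) (at x)" for x :: real by (rule DERIV_ident)
  have c: "continuous_on UNIV (\<lambda>x::real. 1::real)" by simp
  note * = window_density_test[OF \<delta> c _ d]
  show "integrable lborel (window_density M \<delta>)" "(\<integral>x. window_density M \<delta> x \<partial>lborel) = 1"
    using * \<delta> prob_space by simp_all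
qed

end

text \<open>
  The distribution functions converge off the countably many atoms of the limit and their translates
  by $\delta$, so the densities converge almost everywhere; as all have mass 1, Scheffe's lemma
  applies.
\<close>

lemma window_density_converges:
  assumes "\<And>n. real_distribution (\<mu>s n)" "real_distribution \<mu>" and conv: "weak_conv_m \<mu>s \<mu>" and \<delta>: "0 < \<delta>"
  shows "(\<lambda>n. \<integral>x. \<bar>window_density (\<mu>s n) \<delta> x - window_density \<mu> \<delta> x\<bar> \<partial>lborel) \<longlonglongrightarrow> 0"
proof -
  interpret L: real_distribution \<mu> by fact
  let ?q = "\<lambda>\<rho>. window_density \<rho> \<delta>"
  define A where "A = {x. measure \<mu> {x} > 0}"
  have cont: "x \<notin> A \<Longrightarrow> isCont (cdf \<mu>) x" for x
    using measure_nonneg[of \<mu> "{x}"] unfolding L.isCont_cdf A_def by auto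
  have "countable (A \<union> (\<lambda>x. x + \<delta>) ` A)"
    using L.countable_atoms by (simp add: A_def)
  then have "AE x in lborel. x \<notin> A \<union> (\<lambda>x. x + \<delta>) ` A"
    by (intro AE_not_in countable_imp_null_set_lborel)
  then have ae: "AE x in lborel. (\<lambda>n. ?q (\<mu>s n) x) \<longlonglongrightarrow> ?q \<mu> x"
  proof eventually_elim
    case (elim x)
    then have "x \<notin> A" "x - \<delta> \<notin> A" by (auto simp: image_iff)
    then have "(\<lambda>n. cdf (\<mu>s n) x) \<longlonglongrightarrow> cdf \<mu> x" "(\<lambda>n. cdf (\<mu>s n) (x - \<delta>)) \<longlonglongrightarrow> cdf \<mu> (x - \<delta>)"
      using conv cont by (auto simp: weak_conv_m_def weak_conv_def)
    then show ?case unfolding window_density_def using \<delta> by (intro tendsto_intros) auto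
  qed
  have mass: "(\<integral>\<^sup>+ x. norm (?q \<rho> x) \<partial>lborel) = 1" if "real_distribution \<rho>" for \<rho>
  proof -
    interpret R: real_distribution \<rho> by fact
    have "(\<integral>\<^sup>+ x. norm (?q \<rho> x) \<partial>lborel) = (\<integral>\<^sup>+ x. ennreal (?q \<rho> x) \<partial>lborel)"
      using R.window_density_nonneg[OF \<delta>] by simp
    also have "\<dots> = ennreal (\<integral>x. ?q \<rho> x \<partial>lborel)"
      using R.window_density_nonneg[OF \<delta>] R.window_density_integrable[OF \<delta>] by (intro nn_integral_eq_integral) auto
    finally show ?thesis using R.window_density_integral[OF \<delta>] by simp
  qed
  have int: "integrable lborel (?q \<rho>)" if "real_distribution \<rho>" for \<rho>
    using real_distribution.window_density_integrable[OF that \<delta>] .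
  have "(\<lambda>n. \<integral>\<^sup>+ x. norm (?q (\<mu>s n) x - ?q \<mu> x) \<partial>lborel) \<longlonglongrightarrow> 0"
    using int assms(1,2) mass ae by (intro Scheffe_lemma2) auto
  moreover have "(\<integral>\<^sup>+ x. norm (?q (\<mu>s n) x - ?q \<mu> x) \<partial>lborel) = ennreal (\<integral>x. \<bar>?q (\<mu>s n) x - ?q \<mu> x\<bar> \<partial>lborel)" for n
    using int[OF assms(1)[of n]] int[OF assms(2)] by (subst nn_integral_eq_integral) auto
  ultimately have "(\<lambda>n. ennreal (\<integral>x. \<bar>?q (\<mu>s n) x - ?q \<mu> x\<bar> \<partial>lborel)) \<longlonglongrightarrow> ennreal 0"
    by simp
  then show ?thesis by (subst (asm) tendsto_ennreal_iff) auto
qed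

text \<open>
  The indicator of a compact set is the limit of the continuous functions $\max(0, 1 - n\,d(x, K))$.
\<close>

lemma compact_measure_le_of_tests:
  assumes "real_distribution \<rho>" "real_distribution \<sigma>"
    and test: "\<And>f. continuous_on UNIV f \<Longrightarrow> (\<And>x. 0 \<le> f x) \<Longrightarrow> (\<And>x. f x \<le> 1) \<Longrightarrow>
      (\<integral>x. f x \<partial>\<rho>) - (\<integral>x. f x \<partial>\<sigma>) \<le> e"
    and K: "compact K"
  shows "measure \<rho> K - measure \<sigma> K \<le> (e::real)"
proof (cases "K = {}")
  case True
  then show ?thesis using test[of "\<lambda>_. 0"] by simp
next
  case False
  define f where "f n x = max 0 (1 - real n * infdist x K)" for n and x :: real
  have cont: "continuous_on UNIV (f n)" for n
    unfolding f_def by (intro continuous_intros)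
  have [measurable]: "f n \<in> borel_measurable borel" for n
    using cont by (rule borel_measurable_continuous_onI)
  have bounds: "0 \<le> f n x" "f n x \<le> 1" for n x
    using infdist_nonneg[of x K] by (auto simp: f_def)
  have closed: "closed K" using K by (rule compact_imp_closed)
  have K_sets: "K \<in> sets borel" using closed by auto
  have lim: "(\<lambda>n. f n x) \<longlonglongrightarrow> indicator K x" for x
  proof (cases "x \<in> K")
    case True
    then show ?thesis by (simp add: f_def)
  next
    case out: False
    then have pos: "0 < infdist x K"
      using closed False infdist_pos_not_in_closed by blast
    obtain N where "1 / infdist x K < real N" using reals_Archimedean2 by blast
    then have "f n x = 0" if "N \<le> n" for n
    proof -
      have "1 / infdist x K < real n" using \<open>1 / infdist x K < real N\<close> that by simp
      then have "1 < real n * infdist x K" using pos by (simp add: divide_less_eq)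
      then show ?thesis by (simp add: f_def)
    qed
    then have "(\<lambda>n. f n x) \<longlonglongrightarrow> 0"
      by (intro tendsto_eventually) (auto simp: eventually_sequentially)
    then show ?thesis using out by simp
  qed
  have conv: "(\<lambda>n. \<integral>x. f n x \<partial>\<nu>) \<longlonglongrightarrow> measure \<nu> K" if "real_distribution \<nu>" for \<nu>
  proof -
    interpret real_distribution \<nu> by fact
    have "(\<lambda>n. \<integral>x. f n x \<partial>\<nu>) \<longlonglongrightarrow> (\<integral>x. indicator K x \<partial>\<nu>)"
      using lim bounds K_sets by (intro integral_dominated_convergence[where w="\<lambda>_. 1"]) auto
    then show ?thesis using K_sets by simp
  qed
  have "(\<lambda>n. (\<integral>x. f n x \<partial>\<rho>) - (\<integral>x. f n x \<partial>\<sigma>)) \<longlonglongrightarrow> measure \<rho> K - measure \<sigma> K"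
    using assms(1,2) by (intro tendsto_diff conv)
  then show ?thesis
    using test[OF cont] bounds by (intro LIMSEQ_le_const2) auto
qed

text \<open>
  Inner regularity of the first measure lets a compact subset replace \<open>A\<close>; shrinking the set in the
  second measure only helps.
\<close>

lemma measure_le_of_tests:
  assumes \<rho>: "real_distribution \<rho>" and \<sigma>: "real_distribution \<sigma>"
    and test: "\<And>f. continuous_on UNIV f \<Longrightarrow> (\<And>x. 0 \<le> f x) \<Longrightarrow> (\<And>x. f x \<le> 1) \<Longrightarrow>
      (\<integral>x. f x \<partial>\<rho>) - (\<integral>x. f x \<partial>\<sigma>) \<le> e"
    and A: "A \<in> sets borel"
  shows "measure \<rho> A - measure \<sigma> A \<le> (e::real)"
proof (rule field_le_epsilon)
  fix \<epsilon> :: real assume \<epsilon>: "0 < \<epsilon>"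
  interpret R: real_distribution \<rho> by fact
  interpret S: real_distribution \<sigma> by fact
  have "emeasure \<rho> A = (SUP K \<in> {K. K \<subseteq> A \<and> compact K}. emeasure \<rho> K)"
    using A by (intro inner_regular) (auto simp: R.emeasure_eq_measure)
  moreover have "ennreal (measure \<rho> A - \<epsilon>) < emeasure \<rho> A \<or> measure \<rho> A - \<epsilon> < 0"
    using \<epsilon> by (cases "measure \<rho> A - \<epsilon> < 0") (auto simp: R.emeasure_eq_measure ennreal_less_iff)
  ultimately obtain K where K: "K \<subseteq> A" "compact K" "measure \<rho> A - \<epsilon> \<le> measure \<rho> K"
  proof (elim disjE)
    assume "ennreal (measure \<rho> A - \<epsilon>) < emeasure \<rho> A" "emeasure \<rho> A = (SUP K \<in> {K. K \<subseteq> A \<and> compact K}. emeasure \<rho> K)"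
    then obtain K where K: "K \<subseteq> A" "compact K" "ennreal (measure \<rho> A - \<epsilon>) < emeasure \<rho> K"
      by (auto simp: less_SUP_iff)
    then have "measure \<rho> A - \<epsilon> \<le> measure \<rho> K"
      by (cases "measure \<rho> A - \<epsilon> < 0") (auto simp: R.emeasure_eq_measure ennreal_less_iff intro: order_trans[of _ 0])
    with K that show thesis by blast
  next
    assume "measure \<rho> A - \<epsilon> < 0"
    then show thesis using that[of "{}"] by simp
  qed
  have "measure \<rho> A - \<epsilon> - measure \<sigma> A \<le> measure \<rho> K - measure \<sigma> K"
    using K A S.finite_measure_mono[of K A] by simp
  also have "\<dots> \<le> e" by (rule compact_measure_le_of_tests[OF \<rho> \<sigma> test K(2)])
  finally show "measure \<rho> A - measure \<sigma> A \<le> e + \<epsilon>" by simp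
qed

lemma measure_diff_le_of_tests:
  assumes \<rho>: "real_distribution \<rho>" and \<sigma>: "real_distribution \<sigma>"
    and test: "\<And>f. continuous_on UNIV f \<Longrightarrow> (\<And>x. 0 \<le> f x) \<Longrightarrow> (\<And>x. f x \<le> 1) \<Longrightarrow>
      \<bar>(\<integral>x. f x \<partial>\<rho>) - (\<integral>x. f x \<partial>\<sigma>)\<bar> \<le> e"
    and A: "A \<in> sets borel"
  shows "\<bar>measure \<rho> A - measure \<sigma> A\<bar> \<le> (e::real)"
proof -
  have "measure \<rho> A - measure \<sigma> A \<le> e"
    by (rule measure_le_of_tests[OF \<rho> \<sigma> _ A]) (use test in \<open>simp add: abs_le_iff\<close>)
  moreover have "measure \<sigma> A - measure \<rho> A \<le> e"
    by (rule measure_le_of_tests[OF \<sigma> \<rho> _ A]) (use test in \<open>simp add: abs_le_iff\<close>)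
  ultimately show ?thesis by linarith
qed

text \<open>
  Everything is proved for continuous test functions $0 \leq f \leq 1$ first. With
  $\Phi' = f$ and $\Psi' = \Phi$, the window average $(\Phi(y + \delta) - \Phi(y))/\delta$ minus
  $f$ has the primitive $(\Psi(y + \delta) - \Psi(y))/\delta - \Phi(y)$, whose modulus is at most
  $\delta$ by the mean value theorem.
  Passing to the limit, $\mu$ itself is close to its window average, uniformly in $f$. As the average
  has a density, the limit gives arbitrarily small mass to each null set.
\<close>

theorem weak_convergence_in_total_variation:
  assumes dist: "\<And>n. real_distribution (\<mu>s n)" "real_distribution \<mu>" and conv: "weak_conv_m \<mu>s \<mu>"
    and smooth: "\<And>\<eta>. 0 < \<eta> \<Longrightarrow> \<exists>K\<ge>0. \<forall>\<^sub>F n in sequentially. almost_smooth K \<eta> (\<mu>s n)"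
  shows "absolutely_continuous lborel \<mu>" and "(\<lambda>n. tv_dist (\<mu>s n) \<mu>) \<longlonglongrightarrow> 0"
proof -
  interpret L: real_distribution \<mu> by fact
  have window: "\<exists>\<delta>>0. (\<forall>\<^sub>F n in sequentially. \<forall>f. continuous_on UNIV f \<longrightarrow> (\<forall>x. 0 \<le> f x \<and> f x \<le> 1) \<longrightarrow>
      \<bar>(\<integral>x. f x \<partial>\<mu>s n) - (\<integral>x. f x * window_density (\<mu>s n) \<delta> x \<partial>lborel)\<bar> \<le> \<eta>)"
    if \<eta>: "0 < \<eta>" for \<eta> :: real
  proof -
    obtain K where K: "0 \<le> K" "\<forall>\<^sub>F n in sequentially. almost_smooth K (\<eta> / 2) (\<mu>s n)"
      using smooth[of "\<eta> / 2"] \<eta> by auto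
    (* Adding 1 to K makes the choice work for K = 0 as well. *)
    define \<delta> where "\<delta> = \<eta> / (2 * (K + 1))"
    have \<delta>: "0 < \<delta>" using \<eta> K by (simp add: \<delta>_def)
    have K\<delta>: "K * \<delta> \<le> \<eta> / 2"
    proof -
      have "K * \<delta> \<le> (K + 1) * \<delta>" using \<delta> by simp
      also have "\<dots> = \<eta> / 2" using K(1) by (simp add: \<delta>_def field_simps)
      finally show ?thesis .
    qed
    have "\<forall>\<^sub>F n in sequentially. \<forall>f. continuous_on UNIV f \<longrightarrow> (\<forall>x. 0 \<le> f x \<and> f x \<le> 1) \<longrightarrow>
      \<bar>(\<integral>x. f x \<partial>\<mu>s n) - (\<integral>x. f x * window_density (\<mu>s n) \<delta> x \<partial>lborel)\<bar> \<le> \<eta>"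
      using K(2)
    proof eventually_elim
      case (elim n)
      interpret R: real_distribution "\<mu>s n" by (rule dist)
      show ?case
      proof (intro allI impI)
        fix f :: "real \<Rightarrow> real" assume f: "continuous_on UNIV f" and fb: "\<forall>x. 0 \<le> f x \<and> f x \<le> 1"
        have fb': "\<bar>f x\<bar> \<le> 1" for x using fb[rule_format, of x] by simp
        obtain \<Phi> where \<Phi>: "\<And>x. (\<Phi> has_real_derivative f x) (at x)"
          using einterval_antiderivative[of "-\<infinity>" \<infinity> f] f
          by (auto simp: continuous_on_eq_continuous_at has_real_derivative_iff_has_vector_derivative)
        have \<Phi>_cont: "continuous_on UNIV \<Phi>"
          using \<Phi> by (meson DERIV_isCont continuous_at_imp_continuous_on)
        obtain \<Psi> where \<Psi>: "\<And>x. (\<Psi> has_real_derivative \<Phi> x) (at x)"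
          using einterval_antiderivative[of "-\<infinity>" \<infinity> \<Phi>] \<Phi>_cont
          by (auto simp: continuous_on_eq_continuous_at has_real_derivative_iff_has_vector_derivative)
        define f\<delta> where "f\<delta> y = (\<Phi> (y + \<delta>) - \<Phi> y) / \<delta>" for y
        define \<phi> where "\<phi> y = (\<Psi> (y + \<delta>) - \<Psi> y) / \<delta> - \<Phi> y" for y
        have mvt\<Phi>: "\<exists>z. \<Phi> y2 - \<Phi> y = (y2 - y) * f z" if "y < y2" for y y2
          using MVT2[OF that, of \<Phi> f] \<Phi> by auto
        have f\<delta>: "0 \<le> f\<delta> y" "f\<delta> y \<le> 1" for y
        proof -
          obtain z where z: "\<Phi> (y + \<delta>) - \<Phi> y = (y + \<delta> - y) * f z" using mvt\<Phi>[of y "y + \<delta>"] \<delta> by auto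
          then have "f\<delta> y = f z" using \<delta> by (simp add: f\<delta>_def)
          then show "0 \<le> f\<delta> y" "f\<delta> y \<le> 1" using fb by auto
        qed
        have \<phi>_deriv: "(\<phi> has_real_derivative f\<delta> y - f y) (at y)" for y
        proof -
          have "((\<lambda>y. \<Psi> (y + \<delta>)) has_real_derivative \<Phi> (y + \<delta>)) (at y)"
            using \<Psi>[of "y + \<delta>"] by (simp add: DERIV_shift)
          then show ?thesis unfolding \<phi>_def f\<delta>_def
            by (intro DERIV_diff DERIV_cdivide \<Psi> \<Phi>)
        qed
        have \<phi>_bound: "\<bar>\<phi> y\<bar> \<le> \<delta>" for y
        proof -
          obtain z where z: "y < z" "z < y + \<delta>" "\<Psi> (y + \<delta>) - \<Psi> y = (y + \<delta> - y) * \<Phi> z"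
            using MVT2[of y "y + \<delta>" \<Psi> \<Phi>] \<delta> \<Psi> by auto
          then have "\<phi> y = \<Phi> z - \<Phi> y" using \<delta> by (simp add: \<phi>_def)
          moreover obtain u where "\<Phi> z - \<Phi> y = (z - y) * f u" using mvt\<Phi>[OF z(1)] by auto
          moreover have "\<bar>(z - y) * f u\<bar> \<le> \<delta> * 1"
            unfolding abs_mult using z fb'[of u] by (intro mult_mono) auto
          ultimately show ?thesis by simp
        qed
        have f\<delta>_cont: "continuous_on UNIV f\<delta>"
          unfolding f\<delta>_def using \<delta> by (intro continuous_intros continuous_on_compose2[OF \<Phi>_cont]) auto
        have [measurable]: "f \<in> borel_measurable borel" "f\<delta> \<in> borel_measurable borel"
          using f f\<delta>_cont by (auto intro: borel_measurable_continuous_onI)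
        have int: "integrable (\<mu>s n) f" "integrable (\<mu>s n) f\<delta>"
          using fb' f\<delta> by (auto intro!: R.integrable_const_bound[where B=1])
        have "\<bar>f\<delta> y - f y\<bar> \<le> 1" for y using f\<delta>[of y] fb[rule_format, of y] by linarith
        then have "\<bar>\<integral>x. f\<delta> x - f x \<partial>\<mu>s n\<bar> \<le> K * \<delta> + \<eta> / 2"
          by (intro elim[unfolded almost_smooth_def, rule_format, of \<phi>] \<phi>_deriv \<phi>_bound continuous_on_diff[OF f\<delta>_cont f])
        moreover have "(\<integral>x. f\<delta> x - f x \<partial>\<mu>s n) = (\<integral>x. f x * window_density (\<mu>s n) \<delta> x \<partial>lborel) - (\<integral>x. f x \<partial>\<mu>s n)"
          using int R.window_density_test(1)[OF \<delta> f fb' \<Phi>] by (simp add: f\<delta>_def[symmetric])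
        ultimately show "\<bar>(\<integral>x. f x \<partial>\<mu>s n) - (\<integral>x. f x * window_density (\<mu>s n) \<delta> x \<partial>lborel)\<bar> \<le> \<eta>"
          using K\<delta> by linarith
      qed
    qed
    then show ?thesis using \<delta> by blast
  qed
  have close: "\<exists>\<delta>>0. (\<forall>f. continuous_on UNIV f \<longrightarrow> (\<forall>x. 0 \<le> f x \<and> f x \<le> 1) \<longrightarrow>
        \<bar>(\<integral>x. f x \<partial>\<mu>) - (\<integral>x. f x * window_density \<mu> \<delta> x \<partial>lborel)\<bar> \<le> \<eta>) \<and>
      (\<forall>\<^sub>F n in sequentially. \<forall>f. continuous_on UNIV f \<longrightarrow> (\<forall>x. 0 \<le> f x \<and> f x \<le> 1) \<longrightarrow>
        \<bar>(\<integral>x. f x \<partial>\<mu>s n) - (\<integral>x. f x \<partial>\<mu>)\<bar> \<le> 3 * \<eta>)"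
    if \<eta>: "0 < \<eta>" for \<eta> :: real
  proof -
    obtain \<delta> where \<delta>: "0 < \<delta>" and ev: "\<forall>\<^sub>F n in sequentially. \<forall>f. continuous_on UNIV f \<longrightarrow> (\<forall>x. 0 \<le> f x \<and> f x \<le> 1) \<longrightarrow>
      \<bar>(\<integral>x. f x \<partial>\<mu>s n) - (\<integral>x. f x * window_density (\<mu>s n) \<delta> x \<partial>lborel)\<bar> \<le> \<eta>"
      using window[OF \<eta>] by blast
    let ?q = "\<lambda>\<rho>. window_density \<rho> \<delta>"
    let ?d = "\<lambda>n. \<integral>x. \<bar>?q (\<mu>s n) x - ?q \<mu> x\<bar> \<partial>lborel"
    have d: "?d \<longlonglongrightarrow> 0" by (rule window_density_converges[OF dist conv \<delta>])
    have int: "integrable lborel (\<lambda>x. f x * ?q \<rho> x)" "integrable lborel (?q \<rho>)"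
      if "real_distribution \<rho>" and f: "continuous_on UNIV f" "\<forall>x. 0 \<le> f x \<and> f x \<le> 1" for \<rho> f
    proof -
      interpret R: real_distribution \<rho> by fact
      show q: "integrable lborel (?q \<rho>)" by (rule R.window_density_integrable[OF \<delta>])
      have [measurable]: "f \<in> borel_measurable borel" using f(1) by (rule borel_measurable_continuous_onI)
      show "integrable lborel (\<lambda>x. f x * ?q \<rho> x)"
        by (rule Bochner_Integration.integrable_bound[OF q])
          (use f(2) in \<open>auto simp: abs_mult intro!: mult_left_le_one_le\<close>)
    qed
    have diff: "\<bar>(\<integral>x. f x * ?q (\<mu>s n) x \<partial>lborel) - (\<integral>x. f x * ?q \<mu> x \<partial>lborel)\<bar> \<le> ?d n"
      if f: "continuous_on UNIV f" "\<forall>x. 0 \<le> f x \<and> f x \<le> 1" for f n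
    proof -
      note i1 = int[OF dist(1)[of n] f] and i2 = int[OF dist(2) f]
      have "(\<integral>x. f x * ?q (\<mu>s n) x \<partial>lborel) - (\<integral>x. f x * ?q \<mu> x \<partial>lborel)
          = (\<integral>x. f x * ?q (\<mu>s n) x - f x * ?q \<mu> x \<partial>lborel)"
        using i1 i2 by simp
      also have "\<bar>\<dots>\<bar> \<le> ?d n"
      proof (rule integral_abs_bound[THEN order_trans], rule integral_mono)
        show "integrable lborel (\<lambda>x. \<bar>f x * ?q (\<mu>s n) x - f x * ?q \<mu> x\<bar>)"
          using i1 i2 by (intro integrable_abs) auto
        show "integrable lborel (\<lambda>x. \<bar>?q (\<mu>s n) x - ?q \<mu> x\<bar>)"
          using i1 i2 by (intro integrable_abs) auto
        fix x
        have "\<bar>f x\<bar> * \<bar>?q (\<mu>s n) x - ?q \<mu> x\<bar> \<le> 1 * \<bar>?q (\<mu>s n) x - ?q \<mu> x\<bar>"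
          using f(2) by (intro mult_right_mono) auto
        then show "\<bar>f x * ?q (\<mu>s n) x - f x * ?q \<mu> x\<bar> \<le> \<bar>?q (\<mu>s n) x - ?q \<mu> x\<bar>"
          by (simp add: abs_mult[symmetric] right_diff_distrib)
      qed
      finally show ?thesis .
    qed
    have lim: "\<bar>(\<integral>x. f x \<partial>\<mu>) - (\<integral>x. f x * ?q \<mu> x \<partial>lborel)\<bar> \<le> \<eta>"
      if f: "continuous_on UNIV f" "\<forall>x. 0 \<le> f x \<and> f x \<le> 1" for f
    proof -
      have "(\<lambda>n. \<integral>x. f x \<partial>\<mu>s n) \<longlonglongrightarrow> (\<integral>x. f x \<partial>\<mu>)"
        using f by (intro weak_conv_imp_integral_bdd_continuous_conv[OF dist conv, of f 1])
          (auto simp: continuous_on_eq_continuous_at)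
      moreover have "(\<lambda>n. \<integral>x. f x * ?q (\<mu>s n) x \<partial>lborel) \<longlonglongrightarrow> (\<integral>x. f x * ?q \<mu> x \<partial>lborel)"
      proof (rule Lim_null[THEN iffD2], rule Lim_null_comparison[OF _ d])
        show "\<forall>\<^sub>F n in sequentially. norm ((\<integral>x. f x * ?q (\<mu>s n) x \<partial>lborel) - (\<integral>x. f x * ?q \<mu> x \<partial>lborel)) \<le> ?d n"
          using diff[OF f] by auto
      qed
      ultimately have "(\<lambda>n. \<bar>(\<integral>x. f x \<partial>\<mu>s n) - (\<integral>x. f x * ?q (\<mu>s n) x \<partial>lborel)\<bar>)
          \<longlonglongrightarrow> \<bar>(\<integral>x. f x \<partial>\<mu>) - (\<integral>x. f x * ?q \<mu> x \<partial>lborel)\<bar>"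
        by (intro tendsto_intros)
      moreover have "\<forall>\<^sub>F n in sequentially. \<bar>(\<integral>x. f x \<partial>\<mu>s n) - (\<integral>x. f x * ?q (\<mu>s n) x \<partial>lborel)\<bar> \<le> \<eta>"
        using ev by eventually_elim (use f in auto)
      ultimately show ?thesis
        by (intro tendsto_upperbound[where F=sequentially]) auto
    qed
    have "\<forall>\<^sub>F n in sequentially. ?d n < \<eta>" using d \<eta> by (rule order_tendstoD(2))
    with ev have "\<forall>\<^sub>F n in sequentially. \<forall>f. continuous_on UNIV f \<longrightarrow> (\<forall>x. 0 \<le> f x \<and> f x \<le> 1) \<longrightarrow>
        \<bar>(\<integral>x. f x \<partial>\<mu>s n) - (\<integral>x. f x \<partial>\<mu>)\<bar> \<le> 3 * \<eta>"
    proof eventually_elim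
      case (elim n)
      show ?case
      proof (intro allI impI)
        fix f :: "real \<Rightarrow> real" assume f: "continuous_on UNIV f" "\<forall>x. 0 \<le> f x \<and> f x \<le> 1"
        have "\<bar>(\<integral>x. f x \<partial>\<mu>s n) - (\<integral>x. f x * ?q (\<mu>s n) x \<partial>lborel)\<bar> \<le> \<eta>"
          using elim(1) f by blast
        with diff[OF f, of n] lim[OF f] elim(2)
        show "\<bar>(\<integral>x. f x \<partial>\<mu>s n) - (\<integral>x. f x \<partial>\<mu>)\<bar> \<le> 3 * \<eta>" by linarith
      qed
    qed
    then show ?thesis using \<delta> lim by blast
  qed
  show "absolutely_continuous lborel \<mu>"
    unfolding absolutely_continuous_def
  proof
    fix A :: "real set" assume A: "A \<in> null_sets lborel"
    then have A_sets: "A \<in> sets borel" by auto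
    have "measure \<mu> A \<le> \<eta>" if "0 < \<eta>" for \<eta>
    proof -
      obtain \<delta> where \<delta>: "0 < \<delta>" and test: "\<And>f. continuous_on UNIV f \<Longrightarrow> (\<forall>x. 0 \<le> f x \<and> f x \<le> 1) \<Longrightarrow>
        \<bar>(\<integral>x. f x \<partial>\<mu>) - (\<integral>x. f x * window_density \<mu> \<delta> x \<partial>lborel)\<bar> \<le> \<eta>"
        using close[OF \<open>0 < \<eta>\<close>] by blast
      let ?q = "window_density \<mu> \<delta>"
      let ?\<sigma> = "density lborel ?q"
      have q: "0 \<le> ?q x" for x by (rule L.window_density_nonneg[OF \<delta>])
      have "emeasure ?\<sigma> (space ?\<sigma>) = (\<integral>\<^sup>+ x. ennreal (?q x) \<partial>lborel)"
        by (simp add: emeasure_density)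
      also have "\<dots> = 1"
        using nn_integral_eq_integral[OF L.window_density_integrable[OF \<delta>]] q L.window_density_integral[OF \<delta>] by simp
      finally have "prob_space ?\<sigma>" by (rule prob_spaceI)
      then have \<sigma>: "real_distribution ?\<sigma>"
        by (simp add: real_distribution_def real_distribution_axioms_def)
      have null: "measure ?\<sigma> A = 0"
      proof -
        have "AE x in lborel. x \<in> A \<longrightarrow> ennreal (?q x) = 0"
          using AE_not_in[OF A] by eventually_elim simp
        then have "A \<in> null_sets ?\<sigma>" using A_sets by (subst null_sets_density_iff) auto
        then show ?thesis by (simp add: null_sets_def measure_def)
      qed
      have "\<bar>measure \<mu> A - measure ?\<sigma> A\<bar> \<le> \<eta>"
      proof (rule measure_diff_le_of_tests[OF dist(2) \<sigma> _ A_sets])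
        fix f :: "real \<Rightarrow> real" assume f: "continuous_on UNIV f" "\<And>x. 0 \<le> f x" "\<And>x. f x \<le> 1"
        have [measurable]: "f \<in> borel_measurable borel" using f(1) by (rule borel_measurable_continuous_onI)
        have "(\<integral>x. f x \<partial>?\<sigma>) = (\<integral>x. f x * ?q x \<partial>lborel)"
          using q by (subst integral_real_density) (auto simp: mult.commute)
        then show "\<bar>(\<integral>x. f x \<partial>\<mu>) - (\<integral>x. f x \<partial>?\<sigma>)\<bar> \<le> \<eta>" using test f by simp
      qed
      then show ?thesis using null by simp
    qed
    then have "measure \<mu> A \<le> 0" using dense_ge[of 0 "measure \<mu> A"] by blast
    then have "measure \<mu> A = 0" using measure_nonneg[of \<mu> A] by linarith
    then show "A \<in> null_sets \<mu>" using A_sets by (auto simp: L.emeasure_eq_measure)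
  qed
  show "(\<lambda>n. tv_dist (\<mu>s n) \<mu>) \<longlonglongrightarrow> 0"
  proof (rule LIMSEQ_I)
    fix r :: real assume "0 < r"
    then have "0 < r / 4" by simp
    from close[OF this] have "\<forall>\<^sub>F n in sequentially. \<forall>f. continuous_on UNIV f \<longrightarrow> (\<forall>x. 0 \<le> f x \<and> f x \<le> 1) \<longrightarrow>
        \<bar>(\<integral>x. f x \<partial>\<mu>s n) - (\<integral>x. f x \<partial>\<mu>)\<bar> \<le> 3 * (r / 4)" by blast
    then have "\<forall>\<^sub>F n in sequentially. norm (tv_dist (\<mu>s n) \<mu> - 0) < r"
    proof eventually_elim
      case (elim n)
      have bound: "\<bar>measure (\<mu>s n) A - measure \<mu> A\<bar> \<le> 3 * (r / 4)" if "A \<in> sets borel" for A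
        by (rule measure_diff_le_of_tests[OF dist(1) dist(2) _ that]) (use elim in blast)
      have "tv_dist (\<mu>s n) \<mu> \<le> 3 * (r / 4)"
        unfolding tv_dist_def using bound by (intro cSUP_least) auto
      moreover have "\<bar>measure (\<mu>s n) {} - measure \<mu> {}\<bar> \<le> tv_dist (\<mu>s n) \<mu>"
        unfolding tv_dist_def using bound by (intro cSUP_upper bdd_aboveI2[where M="3 * (r / 4)"]) auto
      ultimately show ?case using \<open>0 < r\<close> by simp
    qed
    then show "\<exists>no. \<forall>n\<ge>no. norm (tv_dist (\<mu>s n) \<mu> - 0) < r"
      by (simp add: eventually_sequentially)
  qed
qed

section \<open>A variance that is continuous under weak convergence\<close>

lemma arctan_diff_le: "\<bar>arctan x - arctan y\<bar> \<le> \<bar>x - y\<bar>"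
proof -
  have *: "arctan b - arctan a \<le> b - a" if ab: "a < b" for a b :: real
  proof -
    obtain z where "arctan b - arctan a = (b - a) * inverse (1 + z\<^sup>2)"
      using MVT2[OF ab, of arctan "\<lambda>x. inverse (1 + x\<^sup>2)"] DERIV_arctan by blast
    moreover have "inverse (1 + z\<^sup>2) \<le> 1" by (rule inverse_le_1_iff[THEN iffD2]) simp
    ultimately show ?thesis using ab mult_left_mono[of "inverse (1 + z\<^sup>2)" 1 "b - a"] by simp
  qed
  consider "x < y" | "x = y" | "y < x" by linarith
  then show ?thesis
  proof cases
    case 1
    then show ?thesis using *[OF 1] arctan_less_iff[of x y] by simp
  next
    case 3
    then show ?thesis using *[OF 3] arctan_less_iff[of y x] by simp
  qed simp
qed

lemma arctan_square_le_4: "(arctan x)\<^sup>2 \<le> 4"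
  using abs_arctan_le_2[of x] abs_le_square_iff[of "arctan x" 2] by simp

text \<open>
  The second moment is not continuous under weak convergence, but the moments of the bounded function
  arctan are. As arctan is injective, its variance under a law that is not a point mass is positive;
  as it is 1-Lipschitz, its variance is at most that of the identity.
\<close>

definition arctan_variance :: "real measure \<Rightarrow> real" where
  "arctan_variance \<rho> = (\<integral>x. (arctan x)\<^sup>2 \<partial>\<rho>) - (\<integral>x. arctan x \<partial>\<rho>)\<^sup>2"

context real_distribution
begin

lemma
  shows arctan_integrable: "integrable M arctan"
    and arctan_square_integrable: "integrable M (\<lambda>x. (arctan x)\<^sup>2)"
    and arctan_diff_square_integrable: "integrable M (\<lambda>x. (arctan x - a)\<^sup>2)"
proof -
  show 1: "integrable M arctan"
    using abs_arctan_le_2 by (intro integrable_const_bound[where B=2]) auto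
  show 2: "integrable M (\<lambda>x. (arctan x)\<^sup>2)"
    using arctan_square_le_4 by (intro integrable_const_bound[where B=4]) auto
  show "integrable M (\<lambda>x. (arctan x - a)\<^sup>2)"
    unfolding power2_diff using 1 2 by auto
qed

lemma arctan_variance_eq:
  "(\<integral>x. (arctan x - a)\<^sup>2 \<partial>M) = arctan_variance M + ((\<integral>x. arctan x \<partial>M) - a)\<^sup>2"
  unfolding arctan_variance_def power2_diff
  using arctan_integrable arctan_square_integrable prob_space by (simp add: algebra_simps)

lemma arctan_variance_pos:
  assumes "\<not> (\<exists>c. M = return borel c)"
  shows "0 < arctan_variance M"
proof (rule ccontr)
  assume neg: "\<not> 0 < arctan_variance M"
  define m where "m = (\<integral>x. arctan x \<partial>M)"
  have "(\<integral>x. (arctan x - m)\<^sup>2 \<partial>M) = arctan_variance M"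
    using arctan_variance_eq[of m] by (simp add: m_def)
  moreover have "0 \<le> (\<integral>x. (arctan x - m)\<^sup>2 \<partial>M)" by simp
  ultimately have "(\<integral>x. (arctan x - m)\<^sup>2 \<partial>M) = 0" using neg by linarith
  then have "AE x in M. (arctan x - m)\<^sup>2 = 0"
    using integral_nonneg_eq_0_iff_AE[OF arctan_diff_square_integrable[of m]] by simp
  then have ae: "AE x in M. x = tan m"
    by eventually_elim (auto simp: tan_arctan)
  have "M = return borel (tan m)"
  proof (rule measure_eqI)
    fix A assume "A \<in> sets M"
    then have A: "A \<in> sets borel" "A \<in> events" by auto
    show "emeasure M A = emeasure (return borel (tan m)) A"
    proof (cases "tan m \<in> A")
      case True
      from ae have "AE x in M. x \<in> A" by eventually_elim (use True in simp)
      then have "prob A = 1" using A by (simp add: prob_eq_1)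
      then show ?thesis using True A by (simp add: emeasure_eq_measure)
    next
      case False
      from ae have "AE x in M. x \<notin> A" by eventually_elim (use False in auto)
      then have "prob A = 0" using A by (simp add: prob_eq_0)
      then show ?thesis using False A by (simp add: emeasure_eq_measure)
    qed
  qed simp
  then show False using assms by blast
qed

end

section \<open>Convergence of multilinear polynomials\<close>

context ibp_law begin

lemma real_distribution_mlin: "real_distribution (distr (samples I) borel (mlin c I b))"
proof -
  interpret S: prob_space "samples I" by (rule prob_space_Pi)
  show ?thesis by (intro real_distribution.intro S.prob_space_distr real_distribution_axioms.intro) auto
qed

lemma arctan_variance_le_mlin_var:
  assumes I: "finite I"
  shows "arctan_variance (distr (samples I) borel (mlin c I b)) \<le> mlin_var I b"
proof -
  let ?\<rho> = "distr (samples I) borel (mlin c I b)"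
  interpret R: real_distribution ?\<rho> by (rule real_distribution_mlin)
  have "arctan_variance ?\<rho> \<le> (\<integral>y. (arctan y - arctan (b {}))\<^sup>2 \<partial>?\<rho>)"
    by (simp add: R.arctan_variance_eq del: integral_distr)
  also have "\<dots> = (\<integral>x. (arctan (mlin c I b x) - arctan (b {}))\<^sup>2 \<partial>samples I)"
    by (intro integral_distr) auto
  also have "\<dots> \<le> (\<integral>x. (mlin c I b x - b {})\<^sup>2 \<partial>samples I)"
  proof (rule integral_mono)
    show "integrable (samples I) (\<lambda>x. (arctan (mlin c I b x) - arctan (b {}))\<^sup>2)"
      using R.arctan_diff_square_integrable[of "arctan (b {})"] by (subst (asm) integrable_distr_eq) auto
    show "integrable (samples I) (\<lambda>x. (mlin c I b x - b {})\<^sup>2)" by (rule mlin_variance_integrable[OF I])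
    show "(arctan (mlin c I b x) - arctan (b {}))\<^sup>2 \<le> (mlin c I b x - b {})\<^sup>2" for x
      using arctan_diff_le by (simp add: abs_le_square_iff[symmetric])
  qed
  also have "\<dots> = mlin_var I b" by (rule mlin_variance[OF I])
  finally show ?thesis .
qed

text \<open>
  Since the limit is not a point mass, its arctan-variance is positive, and half of it is eventually a
  lower bound for the variances of the polynomials. From then on their laws are smooth with a common
  constant.
\<close>

theorem multilinear_total_variation:
  assumes d: "1 \<le> d" and I: "\<And>n. finite (I n)" and deg: "\<And>n. deg_le d (b n)"
    and \<mu>s: "\<And>n. \<mu>s n = distr (samples (I n)) borel (mlin c (I n) (b n))"
    and L: "real_distribution L" and conv: "weak_conv_m \<mu>s L" and nondirac: "\<not> (\<exists>c. L = return borel c)"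
  shows "absolutely_continuous lborel L" "(\<lambda>n. tv_dist (\<mu>s n) L) \<longlonglongrightarrow> 0"
proof -
  have dist: "real_distribution (\<mu>s n)" for n unfolding \<mu>s by (rule real_distribution_mlin)
  interpret L: real_distribution L by (rule L)
  have V: "0 < arctan_variance L" by (rule L.arctan_variance_pos[OF nondirac])
  define v0 where "v0 = arctan_variance L / 2"
  have v0: "0 < v0" "v0 < arctan_variance L" using V by (simp_all add: v0_def)
  have "(\<lambda>n. \<integral>x. arctan x \<partial>\<mu>s n) \<longlonglongrightarrow> (\<integral>x. arctan x \<partial>L)"
    using abs_arctan_le_2 by (intro weak_conv_imp_integral_bdd_continuous_conv[OF dist L conv, where B=2]) (auto intro: isCont_arctan)
  moreover have "(\<lambda>n. \<integral>x. (arctan x)\<^sup>2 \<partial>\<mu>s n) \<longlonglongrightarrow> (\<integral>x. (arctan x)\<^sup>2 \<partial>L)"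
    using arctan_square_le_4 by (intro weak_conv_imp_integral_bdd_continuous_conv[OF dist L conv, where B=4]) (auto intro: isCont_power isCont_arctan)
  ultimately have "(\<lambda>n. arctan_variance (\<mu>s n)) \<longlonglongrightarrow> arctan_variance L"
    unfolding arctan_variance_def by (intro tendsto_intros)
  then have "\<forall>\<^sub>F n in sequentially. v0 < arctan_variance (\<mu>s n)"
    using v0(2) by (rule order_tendstoD(1))
  then have ev: "\<forall>\<^sub>F n in sequentially. v0 \<le> mlin_var (I n) (b n)"
  proof eventually_elim
    case (elim n)
    then show ?case using arctan_variance_le_mlin_var[OF I[of n], of "b n"] unfolding \<mu>s by linarith
  qed
  have smooth: "\<exists>K\<ge>0. \<forall>\<^sub>F n in sequentially. almost_smooth K \<eta> (\<mu>s n)" if \<eta>: "0 < \<eta>" for \<eta> :: real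
  proof -
    obtain K where K: "0 \<le> K" "\<forall>I b. finite I \<longrightarrow> deg_le d b \<longrightarrow> v0 \<le> mlin_var I b \<longrightarrow>
        almost_smooth K \<eta> (distr (samples I) borel (mlin c I b))"
      using smooth_laws_unnormalised[OF d v0(1) \<eta>] by blast
    have "\<forall>\<^sub>F n in sequentially. almost_smooth K \<eta> (\<mu>s n)"
      using ev by eventually_elim (use K(2) I deg in \<open>simp add: \<mu>s\<close>)
    then show ?thesis using K(1) by blast
  qed
  show "absolutely_continuous lborel L" "(\<lambda>n. tv_dist (\<mu>s n) L) \<longlonglongrightarrow> 0"
    using weak_convergence_in_total_variation[OF dist L conv smooth] by blast+
qed

end

theorem theorem1p1:
  fixes P :: "'p measure" and X0 :: "'p \<Rightarrow> real"
    and M :: "'a measure" and X :: "nat \<Rightarrow> 'a \<Rightarrow> real"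
    and d :: nat and m :: "nat \<Rightarrow> nat"
    and Q :: "nat \<Rightarrow> (nat \<Rightarrow> real) \<Rightarrow> real" and F :: "nat \<Rightarrow> 'a \<Rightarrow> real"
    and N :: "'b measure" and Finf :: "'b \<Rightarrow> real"
  assumes "prob_space P"
    and "distributed P lborel X0 (\<lambda>t. ennreal (std_normal_density t))
         \<or> (\<exists>r\<ge>1. distributed P lborel X0 (\<lambda>t. ennreal (gamma_density r t)))
         \<or> (\<exists>a\<ge>1. \<exists>b\<ge>1. distributed P lborel X0 (\<lambda>t. ennreal (beta_density a b t)))"
    and "prob_space M"
    and "prob_space.indep_vars M (\<lambda>_. borel) X {1..}"
    and "\<And>i. i \<ge> 1 \<Longrightarrow> distr M borel (X i) = distr P borel X0"
    and "d \<ge> 1"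
    and "\<And>n. n \<ge> 1 \<Longrightarrow> m n \<ge> 1"
    and "filterlim m at_top sequentially"
    and "\<And>n. n \<ge> 1 \<Longrightarrow> multilinear_poly d (m n) (Q n)"
    and "\<And>n \<omega>. n \<ge> 1 \<Longrightarrow> \<omega> \<in> space M \<Longrightarrow> F n \<omega> = Q n (\<lambda>i. X i \<omega>)"
    and "prob_space N" and "Finf \<in> borel_measurable N"
    and "weak_conv_m (\<lambda>n. distr M borel (F n)) (distr N borel Finf)"
    and "\<not> (\<exists>c. distr N borel Finf = return borel c)"
  shows "absolutely_continuous lborel (distr N borel Finf)
       \<and> (\<lambda>n. tv_dist (distr M borel (F n)) (distr N borel Finf)) \<longlonglongrightarrow> 0"
proof -
  interpret P: prob_space P by fact
  interpret M: prob_space M by fact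
  interpret N: prob_space N by fact
  have density: "distr P borel X0 = density lborel p" "prob_space (density lborel p)"
    if "distributed P lborel X0 p" for p
  proof -
    have "distr P borel X0 = distr P lborel X0" by (rule distr_cong) auto
    then show eq: "distr P borel X0 = density lborel p"
      using distributed_distr_eq_density[OF that] by simp
    have "X0 \<in> borel_measurable P" using distributed_measurable[OF that] by simp
    then show "prob_space (density lborel p)"
      unfolding eq[symmetric] by (rule P.prob_space_distr)
  qed
  have "\<exists>w w' \<tau>. ibp_law (distr P borel X0) w w' \<tau>"
    using assms(2) std_normal_ibp_law gamma_ibp_law beta_ibp_law density by metis
  then obtain w w' \<tau> where "ibp_law (distr P borel X0) w w' \<tau>" by blast
  then interpret ibp_law "distr P borel X0" w w' \<tau> .
  (* The sequences are shifted by one because nothing is known about F 0 and Q 0. *)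
  have "\<exists>b. deg_le d b \<and> (\<forall>x. Q (Suc n) x = mlin c {1..m (Suc n)} b x)" for n
    using multilinear_poly_imp_mlin[OF assms(9)[of "Suc n"], of c] by (metis le_add1 plus_1_eq_Suc)
  then obtain b where b: "\<And>n. deg_le d (b n)" "\<And>n x. Q (Suc n) x = mlin c {1..m (Suc n)} (b n) x"
    by metis
  have law: "distr M borel (F (Suc n)) = distr (samples {1..m (Suc n)}) borel (mlin c {1..m (Suc n)} (b n))" for n
  proof -
    let ?I = "{1..m (Suc n)}" and ?F = "mlin c {1..m (Suc n)} (b n)"
    have ne: "?I \<noteq> {}" using assms(7)[of "Suc n"] by auto
    have rv: "X i \<in> borel_measurable M" if "i \<in> ?I" for i
      using assms(4) that unfolding M.indep_vars_def by auto
    have "M.indep_vars (\<lambda>_. borel) X ?I"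
      by (rule M.indep_vars_subset[OF assms(4)]) auto
    then have "distr M (PiM ?I (\<lambda>_. borel)) (\<lambda>\<omega>. \<lambda>i\<in>?I. X i \<omega>) = PiM ?I (\<lambda>i. distr M borel (X i))"
      using M.indep_vars_iff_distr_eq_PiM'[OF ne, where M'="\<lambda>_. borel" and X=X] rv by simp
    also have "\<dots> = samples ?I"
      using assms(5) by (intro PiM_cong) auto
    finally have joint: "distr M (PiM ?I (\<lambda>_. borel)) (\<lambda>\<omega>. \<lambda>i\<in>?I. X i \<omega>) = samples ?I" .
    have meas: "?F \<in> borel_measurable (PiM ?I (\<lambda>_. borel))"
    proof -
      have "sets (samples ?I) = sets (PiM ?I (\<lambda>_. borel))" by (intro sets_PiM_cong) auto
      then show ?thesis using mlin_measurable[of ?I "b n"] measurable_cong_sets by blast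
    qed
    have X_meas: "(\<lambda>\<omega>. \<lambda>i\<in>?I. X i \<omega>) \<in> measurable M (PiM ?I (\<lambda>_. borel))"
      using rv by (intro measurable_restrict)
    have "distr (samples ?I) borel ?F = distr M borel (?F \<circ> (\<lambda>\<omega>. \<lambda>i\<in>?I. X i \<omega>))"
      unfolding joint[symmetric] by (rule distr_distr[OF meas X_meas])
    also have "\<dots> = distr M borel (F (Suc n))"
    proof (rule distr_cong)
      fix \<omega> assume "\<omega> \<in> space M"
      then have "F (Suc n) \<omega> = ?F (\<lambda>i. X i \<omega>)" using assms(10)[of "Suc n" \<omega>] b(2) by simp
      also have "\<dots> = ?F (\<lambda>i\<in>?I. X i \<omega>)" by (intro mlin_cong) auto
      finally show "(?F \<circ> (\<lambda>\<omega>. \<lambda>i\<in>?I. X i \<omega>)) \<omega> = F (Suc n) \<omega>" by simp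
    qed auto
    finally show ?thesis by simp
  qed
  have L: "real_distribution (distr N borel Finf)"
    using assms(12) by (intro real_distribution.intro N.prob_space_distr real_distribution_axioms.intro) auto
  have conv: "weak_conv_m (\<lambda>n. distr M borel (F (Suc n))) (distr N borel Finf)"
    using assms(13) unfolding weak_conv_m_def weak_conv_def by (auto intro: LIMSEQ_Suc)
  have fin: "finite {1..m (Suc n)}" for n by simp
  note main = multilinear_total_variation[OF assms(6) fin b(1) law L conv assms(14)]
  show ?thesis using main(1) LIMSEQ_imp_Suc[OF main(2)] by blast
qed

end
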